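(* Let $n\geq2$ and let $\mathcal{R}=\mathcal{R}(E,F)\subset\overline{\mathbb{R}}^n$ be a ring, i.e. a domain in $\overline{\mathbb{R}}^n$ whose complement consists of exactly two components $E$ and $F$. Then $$\mathrm{cap}(\mathcal{R})\geq\frac{1}{2}c_n\,\delta(E,F).$$
   Context: $\overline{\mathbb{R}}^n=\mathbb{R}^n\cup\{\infty\}$. Capacity of a ring: $\mathrm{cap}(\mathcal{R}(E,F))=\mathsf{M}(\Delta(E,F))$, where $\Delta(E,F)$ is the family of all curves in $\overline{\mathbb{R}}^n$ joining $E$ and $F$, and $\mathsf{M}(\Gamma)$ is the conformal modulus of a curve family $\Gamma$, i.e. $\mathsf{M}(\Gamma)=\inf_\sigma\int_{\mathbb{R}^n}\sigma^n\,dm$ over all nonnegative Borel functions $\sigma$ on $\mathbb{R}^n$ with $\int_\gamma\sigma\,ds\geq1$ for every locally rectifiable $\gamma\in\Gamma$ ($m$ is $n$-dimensional Lebesgue measure). The constant $c_n$ is $c_n=\omega_{n-2}\left(2\int_0^{\pi/2}(\sin t)^{(2-n)/(n-1)}\,dt\right)^{1-n}$, where $\omega_{n-2}$ is the $(n-2)$-dimensional surface area of the unit sphere $S^{n-2}$; in particular $c_2=2/\pi$. Cross-ratio: for points $a,b,c,d\in\overline{\mathbb{R}}^n$, $|a,b,c,d|=\dfrac{q(a,c)q(b,d)}{q(a,b)q(c,d)}$, where $q$ is the chordal metric, $q(x,y)=\dfrac{|x-y|}{\sqrt{1+|x|^2}\sqrt{1+|y|^2}}$ for $x,y\in\mathbb{R}^n$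 and $q(x,\infty)=\dfrac{1}{\sqrt{1+|x|^2}}$. For finite points $|a,b,c,d|=\dfrac{|a-c||b-d|}{|a-b||c-d|}$. For non-empty $E,F\subset\overline{\mathbb{R}}^n$ with $\overline{E}\cap\overline{F}=\varnothing$, $\delta(E,F)$ denotes the Möbius-metric diameter $\delta_{\overline{\mathbb{R}}^n\setminus F}(E)=\sup_{x,y\in E}\delta_{\overline{\mathbb{R}}^n\setminus F}(x,y)$, where $\delta_G(x,y)=\sup_{a,b\in\partial G}\log(1+|a,x,b,y|)$ (boundary taken in $\overline{\mathbb{R}}^n$, cross-ratio $0$ when $a=b$ or $x=y$). *)

theory Defs
  imports "HOL-Analysis.Analysis"
begin

text \<open>
  The extended space is the one-point compactification of \<open>real ^ 'n\<close>, with underlying type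
  \<open>(real ^ 'n) option\<close> and \<open>None\<close> as the point at infinity.
\<close>

type_synonym 'n ext_space = "(real ^ 'n) option"

abbreviation ext_top :: "('n::finite) ext_space topology" where
  "ext_top \<equiv> Alexandroff_compactification euclidean"

definition is_ring :: "('n::finite) ext_space set \<Rightarrow> 'n ext_space set \<Rightarrow> 'n ext_space set \<Rightarrow> bool" where
  "is_ring R E F \<longleftrightarrow>
     R \<noteq> {} \<and> openin ext_top R \<and> connectedin ext_top R \<and>
     E \<noteq> F \<and> connected_components_of (subtopology ext_top (- R)) = {E, F}"


section \<open>Curves and the conformal modulus\<close>

text \<open>
  The length of the restriction of \<open>g\<close> to \<open>[a, b]\<close>: the supremum of the lengths of inscribed
  polygons. The points \<open>p 0 \<le> ... \<le> p m\<close> need not include \<open>a\<close> and \<open>b\<close>, since adding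
  them can only increase the sum.
\<close>

definition curve_length :: "(real \<Rightarrow> 'a::real_normed_vector) \<Rightarrow> real \<Rightarrow> real \<Rightarrow> ennreal" where
  "curve_length g a b =
     (SUP (m, p) \<in> {(m :: nat, p :: nat \<Rightarrow> real). mono p \<and> range p \<subseteq> {a..b}}.
        \<Sum>i<m. ennreal (norm (g (p (Suc i)) - g (p i))))"

text \<open>
  Curves are parametrised by \<open>[0, 1]\<close>, as in \<^const>\<open>pathin\<close>. A curve is locally rectifiable if
  each of its compact subcurves is rectifiable; in particular it then avoids infinity.
\<close>

definition rectifiable_on :: "(real \<Rightarrow> ('n::finite) ext_space) \<Rightarrow> real \<Rightarrow> real \<Rightarrow> bool" where
  "rectifiable_on \<gamma> a b \<longleftrightarrow> None \<notin> \<gamma> ` {a..b} \<and> curve_length (the \<circ> \<gamma>) a b < \<infinity>"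

definition locally_rectifiable :: "(real \<Rightarrow> ('n::finite) ext_space) \<Rightarrow> bool" where
  "locally_rectifiable \<gamma> \<longleftrightarrow> (\<forall>a b. 0 \<le> a \<and> a \<le> b \<and> b \<le> 1 \<longrightarrow> rectifiable_on \<gamma> a b)"

text \<open>
  The arc length parametrisation. For a rectifiable curve all admissible choices of \<open>t\<close> give
  the same point, because \<open>g\<close> is constant wherever its length function is.
\<close>

definition arc_length_param :: "(real \<Rightarrow> 'a::real_normed_vector) \<Rightarrow> real \<Rightarrow> 'a" where
  "arc_length_param g s = g (SOME t. t \<in> {0..1} \<and> curve_length g 0 t = ennreal s)"

definition line_integral :: "('a::real_normed_vector \<Rightarrow> ennreal) \<Rightarrow> (real \<Rightarrow> 'a) \<Rightarrow> ennreal" where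
  "line_integral \<sigma> g =
     (\<integral>\<^sup>+ s \<in> {0 .. enn2real (curve_length g 0 1)}. \<sigma> (arc_length_param g s) \<partial>lborel)"

definition admissible :: "(real \<Rightarrow> ('n::finite) ext_space) set \<Rightarrow> (real ^ 'n \<Rightarrow> ennreal) set" where
  "admissible \<Gamma> =
     {\<sigma> \<in> borel_measurable borel.
        \<forall>\<gamma>\<in>\<Gamma>. locally_rectifiable \<gamma> \<longrightarrow> line_integral \<sigma> (the \<circ> \<gamma>) \<ge> 1}"

definition modulus :: "(real \<Rightarrow> ('n::finite) ext_space) set \<Rightarrow> ennreal" where
  "modulus \<Gamma> = (INF \<sigma> \<in> admissible \<Gamma>. \<integral>\<^sup>+ x. \<sigma> x ^ CARD('n) \<partial>lborel)"

definition joining_curves ::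
    "('n::finite) ext_space set \<Rightarrow> 'n ext_space set \<Rightarrow> (real \<Rightarrow> 'n ext_space) set" where
  "joining_curves E F =
     {\<gamma>. pathin ext_top \<gamma> \<and> (\<gamma> 0 \<in> E \<and> \<gamma> 1 \<in> F \<or> \<gamma> 0 \<in> F \<and> \<gamma> 1 \<in> E)}"

definition ring_capacity :: "('n::finite) ext_space set \<Rightarrow> 'n ext_space set \<Rightarrow> ennreal" where
  "ring_capacity E F = modulus (joining_curves E F)"


section \<open>The constant\<close>

text \<open>
  The \<open>k\<close>-dimensional area of the unit sphere in dimension \<open>k + 1\<close> is \<open>k + 1\<close> times the volume of
  the unit ball it bounds; for \<open>k = 0\<close> this is \<open>2\<close>, the number of points of the sphere.
\<close>

definition unit_sphere_area :: "nat \<Rightarrow> real" where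
  "unit_sphere_area k = real (k + 1) * unit_ball_vol (real (k + 1))"

definition ring_const :: "nat \<Rightarrow> real" where
  "ring_const n =
     unit_sphere_area (n - 2) *
     (2 * integral {0..pi / 2} (\<lambda>t. sin t powr ((2 - real n) / (real n - 1)))) powr (1 - real n)"


section \<open>The Moebius metric\<close>

fun chordal :: "'a::real_normed_vector option \<Rightarrow> 'a option \<Rightarrow> real" where
  "chordal (Some x) (Some y) = norm (x - y) / (sqrt (1 + (norm x)\<^sup>2) * sqrt (1 + (norm y)\<^sup>2))"
| "chordal (Some x) None = 1 / sqrt (1 + (norm x)\<^sup>2)"
| "chordal None (Some y) = 1 / sqrt (1 + (norm y)\<^sup>2)"
| "chordal None None = 0"

definition cross_ratio ::
    "'a::real_normed_vector option \<Rightarrow> 'a option \<Rightarrow> 'a option \<Rightarrow> 'a option \<Rightarrow> real" where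
  "cross_ratio a b c d = (chordal a c * chordal b d) / (chordal a b * chordal c d)"

text \<open>
  The suprema are taken in \<^typ>\<open>ennreal\<close>, so that none of them depends on an arbitrary value for
  empty or unbounded sets. The cross-ratio vanishes when \<open>a = b\<close> or \<open>x = y\<close>.
\<close>

definition moebius_metric :: "('n::finite) ext_space set \<Rightarrow> 'n ext_space \<Rightarrow> 'n ext_space \<Rightarrow> ennreal" where
  "moebius_metric G x y =
     (SUP a \<in> ext_top frontier_of G. SUP b \<in> ext_top frontier_of G.
        ennreal (ln (1 + cross_ratio a x b y)))"

definition moebius_diam :: "('n::finite) ext_space set \<Rightarrow> 'n ext_space set \<Rightarrow> ennreal" where
  "moebius_diam E F = (SUP x \<in> E. SUP y \<in> E. moebius_metric (- F) x y)"

end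

theory Submission
  imports Defs
begin

text \<open>
  Let \<open>x, y \<in> E\<close> and \<open>a, b \<in> F\<close>. Send \<open>y\<close> to infinity by a Moebius transformation \<open>\<psi>\<close>; then the
  cross-ratio \<open>|a, x, b, y|\<close> becomes \<open>t = |\<psi> a - \<psi> b| / |\<psi> a - \<psi> x|\<close>. After possibly exchanging \<open>a\<close> and
  \<open>b\<close>, two Apollonius balls provide a centre \<open>p\<close> from which \<open>\<psi> b\<close> is at least \<open>1 + t\<close> times as far
  away as \<open>\<psi> a\<close> and \<open>\<psi> x\<close>. By connectedness both \<open>\<psi> E\<close> (which contains infinity) and \<open>\<psi> F\<close> meet every
  sphere about \<open>p\<close> in the annulus between these radii. On a sphere of radius \<open>r\<close> meeting both sets,
  circular arcs joining the two sets show \<open>\<integral>\<sigma>\<^sup>n \<ge> c\<^sub>n / r\<close> for every admissible \<open>\<sigma>\<close>, and integrating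
  over \<open>r\<close> gives \<open>c\<^sub>n log (1 + t)\<close>, which is even stronger than the claim.
\<close>

section \<open>Polar coordinates\<close>

text \<open>The two endpoints found on a sphere need not be antipodal, so the arcs leaving the first
  endpoint in different directions meet the bisecting hyperplane at different angles. Each arc is
  therefore tested only against a linear inequality, the tangent of s^n at the density sin^p / (I
  r), where p = (2-n)/(n-1) and I is the integral of sin^p over (0, pi); this density has integral 1
  over a half great circle of radius r. Linearity allows averaging over all directions: the first
  halves of the arcs sweep out an open hemisphere, which carries at most half of the antipodally
  symmetric weight. What survives is n - (n-1) = 1 times I^(1-n) times the area of the equator, and
  this is where c_n comes from. The spheres live in the image of \<psi>. The density is transported
  with its conformal factor, which preserves line integrals and the integral of the n-th power; one
  radius is left out, because its sphere may pass through the image of infinity. The areas of the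
  sphere and of its equator are both cone measures of homogeneous measures, so one theorem on polar
  coordinates serves twice.\<close>

text \<open>Both sides are values of measures with a density on an increasing union of compact
  intervals, so continuity from below extends the compact substitution rule without any
  integrability. It serves the substitutions by the cotangent, by 1/s and by arc length.\<close>

lemma nn_integral_substitution_exhaustion:
  fixes f :: "real \<Rightarrow> ennreal" and a b :: "nat \<Rightarrow> real"
  assumes f [measurable]: "f \<in> borel_measurable borel"
    and deriv: "\<And>x. x \<in> I \<Longrightarrow> (g has_real_derivative g' x) (at x)"
    and cont: "continuous_on I g'"
    and nonneg: "\<And>x. x \<in> I \<Longrightarrow> 0 \<le> g' x"
    and I: "I = (\<Union>k. {a k..b k})" "\<And>k. a k < b k" "decseq a" "incseq b"
  shows "(\<integral>\<^sup>+x. f x * indicator (g ` I) x \<partial>lborel) =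
         (\<integral>\<^sup>+x. f (g x) * ennreal (g' x) * indicator I x \<partial>lborel)"
proof -
  define h where "h x = f (g x) * ennreal (g' x) * indicator I x" for x
  have sub: "{a k..b k} \<subseteq> I" for k using I(1) by auto
  have Imeas [measurable]: "I \<in> sets borel" unfolding I(1) by measurable
  have contg: "continuous_on I g"
    by (meson DERIV_isCont continuous_at_imp_continuous_on deriv)
  \<comment> \<open>Nothing is known about \<open>g\<close> and \<open>g'\<close> outside
    \<open>I\<close>, so measurability goes through their cut-offs.\<close>
  have "(\<lambda>x. f (g x * indicator I x) * ennreal (g' x * indicator I x)) \<in> borel_measurable borel"
  proof -
    have [measurable]: "(\<lambda>x. g x * indicator I x) \<in> borel_measurable borel"
      using borel_measurable_continuous_on_indicator[OF _ contg] Imeas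
      by (simp add: mult.commute)
    have [measurable]: "(\<lambda>x. g' x * indicator I x) \<in> borel_measurable borel"
      using borel_measurable_continuous_on_indicator[OF _ cont] Imeas
      by (simp add: mult.commute)
    show ?thesis by measurable
  qed
  moreover have "h = (\<lambda>x. f (g x * indicator I x) * ennreal (g' x * indicator I x) * indicator I x)"
    by (auto simp: h_def fun_eq_iff split: split_indicator)
  ultimately have hm [measurable]: "h \<in> borel_measurable borel"
    by simp
  have gab: "g ` {a k..b k} = {g (a k)..g (b k)}" for k
  proof
    have mono: "g x \<le> g y" if "x \<in> {a k..b k}" "y \<in> {a k..b k}" "x \<le> y" for x y
      using that sub[of k] by (intro DERIV_nonneg_imp_nondecreasing[of x y g])
        (meson atLeastAtMost_iff deriv nonneg order_trans subsetD)+
    show "g ` {a k..b k} \<subseteq> {g (a k)..g (b k)}"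
      using mono I(2)[of k] by (auto intro!: mono)
    have "continuous_on {a k..b k} g" using contg sub continuous_on_subset by blast
    then show "{g (a k)..g (b k)} \<subseteq> g ` {a k..b k}"
      using IVT'[of g "a k" _ "b k"] I(2)[of k] by (force simp: image_iff)
  qed
  have img: "g ` I = (\<Union>k. {g (a k)..g (b k)})"
    unfolding I(1) image_UN gab ..
  have incI: "incseq (\<lambda>k. {a k..b k})"
    using I(3,4) by (auto simp: incseq_def decseq_def intro: order_trans)
  then have incJ: "incseq (\<lambda>k. {g (a k)..g (b k)})"
    unfolding gab[symmetric] incseq_def by (meson image_mono)
  have "(\<integral>\<^sup>+x. f x * indicator (g ` I) x \<partial>lborel) = emeasure (density lborel f) (g ` I)"
    unfolding img by (subst emeasure_density) auto
  also have "\<dots> = (SUP k. emeasure (density lborel f) {g (a k)..g (b k)})"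
    unfolding img by (rule SUP_emeasure_incseq[symmetric]) (use incJ in auto)
  also have "\<dots> = (SUP k. emeasure (density lborel h) {a k..b k})"
  proof (intro SUP_cong refl)
    fix k
    have "emeasure (density lborel f) {g (a k)..g (b k)} =
        (\<integral>\<^sup>+x. f x * indicator {g (a k)..g (b k)} x \<partial>lborel)"
      by (subst emeasure_density) auto
    also have "\<dots> = (\<integral>\<^sup>+x. f (g x) * ennreal (g' x) * indicator {a k..b k} x \<partial>lborel)"
      using sub[of k] I(2)[of k] cont
      by (intro nn_integral_substitution_aux)
         (auto intro!: deriv nonneg intro: continuous_on_subset simp: subset_iff)
    also have "\<dots> = (\<integral>\<^sup>+x. h x * indicator {a k..b k} x \<partial>lborel)"
      using sub[of k] by (intro nn_integral_cong) (auto simp: h_def split: split_indicator)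
    also have "\<dots> = emeasure (density lborel h) {a k..b k}"
      by (subst emeasure_density) auto
    finally show "emeasure (density lborel f) {g (a k)..g (b k)} = \<dots>" .
  qed
  also have "\<dots> = emeasure (density lborel h) I"
    unfolding I(1) by (rule SUP_emeasure_incseq) (use incI in auto)
  also have "\<dots> = (\<integral>\<^sup>+x. h x \<partial>lborel)"
    by (subst emeasure_density) (auto simp: h_def intro!: nn_integral_cong split: split_indicator)
  finally show ?thesis by (simp add: h_def)
qed

lemma nn_integral_lborel_affine:
  fixes f :: "'a::euclidean_space \<Rightarrow> ennreal"
  assumes [measurable]: "f \<in> borel_measurable borel" and "c \<noteq> 0"
  shows "(\<integral>\<^sup>+x. f x \<partial>lborel) = ennreal (\<bar>c\<bar> ^ DIM('a)) * (\<integral>\<^sup>+x. f (t + c *\<^sub>R x) \<partial>lborel)"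
  by (subst lborel_affine[OF \<open>c \<noteq> 0\<close>, of t])
     (simp add: nn_integral_density nn_integral_distr nn_integral_cmult)

lemma nn_integral_power_tail:
  assumes "0 < a" "0 < k"
  shows "(\<integral>\<^sup>+s. ennreal (real k / s ^ (k + 1)) * indicator {a..} s \<partial>lborel) = ennreal (1 / a ^ k)"
proof -
  have "(\<integral>\<^sup>+s. ennreal (real k / s ^ (k + 1)) * indicator {a..} s \<partial>lborel) = ennreal (0 - (- 1 / a ^ k))"
  proof (rule nn_integral_FTC_atLeast)
    fix s assume "a \<le> s"
    then have "0 < s" using assms by simp
    then show "((\<lambda>s. - 1 / s ^ k) has_real_derivative real k / s ^ (k + 1)) (at s)"
    proof -
      have "((\<lambda>s. s powi (- int k)) has_real_derivative of_int (- int k) * s powi (- int k - 1)) (at s)"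
        using \<open>0 < s\<close> by (auto intro!: derivative_eq_intros)
      then have "((\<lambda>s. - (s powi (- int k))) has_real_derivative - (of_int (- int k) * s powi (- int k - 1))) (at s)"
        by (rule DERIV_minus)
      moreover have "- (of_int (- int k) * s powi (- int k - 1)) = real k / s ^ (k + 1)"
      proof -
        have "- int k - 1 = - int (k + 1)" by simp
        then show ?thesis by (simp only: power_int_minus power_int_of_nat) (simp add: field_simps)
      qed
      moreover have "(\<lambda>s::real. - (s powi (- int k))) = (\<lambda>s. - 1 / s ^ k)"
        by (simp add: power_int_minus fun_eq_iff field_simps)
      ultimately show ?thesis by simp
    qed
    show "0 \<le> real k / s ^ (k + 1)" using \<open>0 < s\<close> by simp
  next
    have lim: "filterlim (\<lambda>s::real. s ^ k) at_top at_top"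
      by (rule filterlim_pow_at_top) (use assms in \<open>auto simp: filterlim_ident\<close>)
    show "((\<lambda>s::real. - 1 / s ^ k) \<longlongrightarrow> 0) at_top"
      by (rule tendsto_divide_0[OF tendsto_const filterlim_at_top_imp_at_infinity[OF lim]])
  qed auto
  then show ?thesis by simp
qed

section \<open>Polar coordinates for homogeneous measures\<close>

text \<open>Abstracts what polar coordinates require. The instances are Lebesgue measure, whose cone
  measure is the area on the unit sphere, and hyperplane measure, whose degree is one less and whose
  cone measure is the area on the equator.\<close>

locale homogeneous_measure =
  fixes M :: "'a::euclidean_space measure" and k :: nat
  assumes sets_M [measurable_cong, simp]: "sets M = sets borel"
    and degree_pos: "0 < k"
    and scaling: "\<And>f s. f \<in> borel_measurable borel \<Longrightarrow> 0 < s \<Longrightarrow>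
          (\<integral>\<^sup>+x. f x \<partial>M) = ennreal (s ^ k) * (\<integral>\<^sup>+x. f (s *\<^sub>R x) \<partial>M)"
    and finite_cball: "emeasure M (cball 0 1) < \<infinity>"
begin

lemma space_M [simp]: "space M = UNIV"
  using sets_eq_imp_space_eq[OF sets_M] by simp

lemma sets_cball_borel [measurable]: "cball (c::'a) r \<in> sets borel"
  by simp

lemma sets_singleton_borel [measurable]: "{x} \<in> sets (borel :: 'a measure)"
  by simp

lemma emeasure_cball:
  assumes "0 < r"
  shows "emeasure M (cball 0 r) = ennreal (r ^ k) * emeasure M (cball 0 1)"
proof -
  have "emeasure M (cball 0 r) = (\<integral>\<^sup>+x. indicator (cball 0 r) x \<partial>M)"
    by simp
  also have "\<dots> = ennreal (r ^ k) * (\<integral>\<^sup>+x. indicator (cball 0 r) (r *\<^sub>R x) \<partial>M)"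
    by (rule scaling) (use assms in simp_all)
  also have "(\<lambda>x::'a. indicator (cball 0 r) (r *\<^sub>R x)) = (indicator (cball 0 1) :: 'a \<Rightarrow> ennreal)"
    using assms by (auto simp: fun_eq_iff split: split_indicator)
  finally show ?thesis by simp
qed

text \<open>Scaling by 2 fixes the origin, so its mass m satisfies m = 2^k m, and m is finite
  because the unit ball has finite mass.\<close>

lemma emeasure_origin: "emeasure M {0} = 0"
proof -
  have "emeasure M {0} = (\<integral>\<^sup>+x. indicator {0} x \<partial>M)"
    by simp
  also have "\<dots> = ennreal (2 ^ k) * (\<integral>\<^sup>+x. indicator {0} (2 *\<^sub>R x) \<partial>M)"
    by (rule scaling) auto
  also have "(\<lambda>x::'a. indicator {0} (2 *\<^sub>R x)) = (indicator {0} :: 'a \<Rightarrow> ennreal)"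
    by (auto simp: fun_eq_iff split: split_indicator)
  finally have eq: "emeasure M {0} = ennreal (2 ^ k) * emeasure M {0}" by simp
  have "emeasure M {0} \<le> emeasure M (cball 0 1)" by (rule emeasure_mono) auto
  then have "emeasure M {0} < \<infinity>" using finite_cball by (rule le_less_trans)
  then obtain m where m: "emeasure M {0} = ennreal m" "0 \<le> m"
    by (metis ennreal_cases infinity_ennreal_def less_irrefl)
  then have "m = 2 ^ k * m" using eq by (simp add: ennreal_mult'[symmetric])
  moreover have "(2::real) ^ k > 1" using degree_pos by (simp add: one_less_power)
  ultimately have "m = 0" by auto
  then show ?thesis using m by simp
qed

lemma AE_nonzero: "AE x in M. x \<noteq> 0"
  by (rule AE_I[of _ _ "{0}"]) (auto simp: emeasure_origin)

sublocale sigma_finite_measure M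
proof (rule sigma_finite_measure.intro, rule exI[of _ "range (\<lambda>i::nat. cball 0 (real i + 1))"], intro conjI)
  show "\<Union> (range (\<lambda>i::nat. cball 0 (real i + 1))) = space M"
  proof -
    have "\<exists>i::nat. norm x \<le> real i + 1" for x :: 'a
      using real_arch_simple[of "norm x"] by (meson add_increasing2 order_trans zero_le_one order_refl)
    then show ?thesis by auto
  qed
  have "emeasure M (cball 0 (real i + 1)) \<noteq> \<infinity>" for i
    using finite_cball by (subst emeasure_cball) (auto simp: ennreal_mult_eq_top_iff)
  then show "\<forall>a\<in>range (\<lambda>i::nat. cball 0 (real i + 1)). emeasure M a \<noteq> \<infinity>"
    by blast
qed auto

text \<open>Surface area without a parametrisation: a subset of the unit sphere gets
  \<open>k\<close> times the mass of the cone over it in the unit ball. The factor \<open>k\<close>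
  is what makes r^(k-1) the radial density in polar coordinates.\<close>

definition cone_measure :: "'a measure" where
  "cone_measure = distr (density M (\<lambda>x. of_nat k * indicator (cball 0 1 - {0}) x)) borel sgn"

lemma measurable_sgn [measurable]: "(sgn :: 'a \<Rightarrow> 'a) \<in> borel_measurable borel"
  unfolding sgn_div_norm by measurable

lemma sets_cone_measure [measurable_cong, simp]: "sets cone_measure = sets borel"
  by (simp add: cone_measure_def)

lemma nn_integral_cone_measure:
  assumes [measurable]: "f \<in> borel_measurable borel"
  shows "(\<integral>\<^sup>+u. f u \<partial>cone_measure) = (\<integral>\<^sup>+x. of_nat k * indicator (cball 0 1 - {0}) x * f (sgn x) \<partial>M)"
proof -
  have [measurable]: "cball 0 1 - {0::'a} \<in> sets M" by simp
  show ?thesis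
    unfolding cone_measure_def by (simp add: nn_integral_distr nn_integral_density)
qed

lemma AE_cone_measure_norm: "AE u in cone_measure. norm u = 1"
proof -
  have [measurable]: "cball 0 1 - {0::'a} \<in> sets M" by simp
  show ?thesis
    unfolding cone_measure_def by (subst AE_distr_iff, measurable, subst AE_density) (auto simp: norm_sgn)
qed

lemma emeasure_cone_measure: "emeasure cone_measure UNIV = of_nat k * emeasure M (cball 0 1)"
proof -
  have "emeasure cone_measure UNIV = (\<integral>\<^sup>+u. 1 \<partial>cone_measure)"
    by (simp add: cone_measure_def)
  also have "\<dots> = (\<integral>\<^sup>+x. of_nat k * indicator (cball 0 1 - {0}) x * 1 \<partial>M)"
    by (rule nn_integral_cone_measure) simp
  also have "\<dots> = (\<integral>\<^sup>+x. of_nat k * indicator (cball 0 1) x \<partial>M)"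
    using AE_nonzero by (intro nn_integral_cong_AE) (auto split: split_indicator)
  finally show ?thesis by (simp add: nn_integral_cmult_indicator)
qed

lemma finite_measure_cone: "finite_measure cone_measure"
  using finite_cball
  by (intro finite_measureI) (auto simp: cone_measure_def emeasure_cone_measure[unfolded cone_measure_def] ennreal_mult_eq_top_iff)

text \<open>
  Homogeneity allows a Fubini argument: with \<open>r = s |x|\<close> and then \<open>y = s x\<close>, the weight left at
  \<open>y\<close> is \<open>k |y|\<^sup>k\<close> times the integral of \<open>s ^ (-k-1)\<close> over \<open>s \<ge> |y|\<close>, which is \<open>1\<close>.
\<close>

lemma nn_integral_polar:
  assumes f [measurable]: "f \<in> borel_measurable borel"
  shows "(\<integral>\<^sup>+x. f x \<partial>M) =
    (\<integral>\<^sup>+r. ennreal (r ^ (k - 1)) * indicator {0<..} r * (\<integral>\<^sup>+u. f (r *\<^sub>R u) \<partial>cone_measure) \<partial>lborel)"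
proof -
  interpret P: pair_sigma_finite M "lborel :: real measure"
    by standard
  define B :: "'a set" where "B = cball 0 1 - {0}"
  have [measurable]: "B \<in> sets M" "B \<in> sets borel" by (auto simp: B_def)
  have "(\<integral>\<^sup>+r. ennreal (r ^ (k - 1)) * indicator {0<..} r * (\<integral>\<^sup>+u. f (r *\<^sub>R u) \<partial>cone_measure) \<partial>lborel)
      = (\<integral>\<^sup>+r. \<integral>\<^sup>+x. ennreal (r ^ (k - 1)) * indicator {0<..} r * (of_nat k * indicator B x * f (r *\<^sub>R sgn x)) \<partial>M \<partial>lborel)"
    by (simp add: nn_integral_cone_measure nn_integral_cmult flip: B_def)
  also have "\<dots> = (\<integral>\<^sup>+x. \<integral>\<^sup>+r. ennreal (r ^ (k - 1)) * indicator {0<..} r * (of_nat k * indicator B x * f (r *\<^sub>R sgn x)) \<partial>lborel \<partial>M)"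
    by (subst P.Fubini') (auto simp: case_prod_unfold)
  also have "\<dots> = (\<integral>\<^sup>+x. \<integral>\<^sup>+s. of_nat k * indicator B x * indicator {0<..} s * ennreal (norm (s *\<^sub>R x) ^ k / s) * f (s *\<^sub>R x) \<partial>lborel \<partial>M)"
  proof (rule nn_integral_cong)
    fix x
    show "(\<integral>\<^sup>+r. ennreal (r ^ (k - 1)) * indicator {0<..} r * (of_nat k * indicator B x * f (r *\<^sub>R sgn x)) \<partial>lborel) =
          (\<integral>\<^sup>+s. of_nat k * indicator B x * indicator {0<..} s * ennreal (norm (s *\<^sub>R x) ^ k / s) * f (s *\<^sub>R x) \<partial>lborel)"
    proof (cases "x \<in> B")
      case True
      then have x: "norm x \<noteq> 0" "norm x > 0" by (auto simp: B_def)
      have "(\<integral>\<^sup>+r. ennreal (r ^ (k - 1)) * indicator {0<..} r * (of_nat k * indicator B x * f (r *\<^sub>R sgn x)) \<partial>lborel)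
        = ennreal (norm x) * (\<integral>\<^sup>+s. ennreal ((norm x * s) ^ (k - 1)) * indicator {0<..} (norm x * s) *
             (of_nat k * indicator B x * f ((norm x * s) *\<^sub>R sgn x)) \<partial>lborel)"
        by (subst nn_integral_real_affine[of _ "norm x" 0]) (use x in auto)
      also have "\<dots> = (\<integral>\<^sup>+s. ennreal (norm x) * (ennreal ((norm x * s) ^ (k - 1)) * indicator {0<..} (norm x * s) *
             (of_nat k * indicator B x * f ((norm x * s) *\<^sub>R sgn x))) \<partial>lborel)"
        by (rule nn_integral_cmult[symmetric]) measurable
      also have "\<dots> = (\<integral>\<^sup>+s. of_nat k * indicator B x * indicator {0<..} s * ennreal (norm (s *\<^sub>R x) ^ k / s) * f (s *\<^sub>R x) \<partial>lborel)"
      proof (rule nn_integral_cong)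
        fix s :: real
        show "ennreal (norm x) * (ennreal ((norm x * s) ^ (k - 1)) * indicator {0<..} (norm x * s) *
             (of_nat k * indicator B x * f ((norm x * s) *\<^sub>R sgn x))) =
             of_nat k * indicator B x * indicator {0<..} s * ennreal (norm (s *\<^sub>R x) ^ k / s) * f (s *\<^sub>R x)"
        proof (cases "s > 0")
          case True
          have "norm x * (norm x * s) ^ (k - 1) = norm (s *\<^sub>R x) ^ k / s"
            using True x degree_pos
            by (cases k) (auto simp: power_mult_distrib field_simps)
          then have "ennreal (norm x) * ennreal ((norm x * s) ^ (k - 1)) = ennreal (norm (s *\<^sub>R x) ^ k / s)"
            by (metis ennreal_mult' norm_ge_zero)
          moreover have "(norm x * s) *\<^sub>R sgn x = s *\<^sub>R x"
            using x by (simp add: sgn_div_norm)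
          ultimately show ?thesis using True x \<open>x \<in> B\<close>
            by (simp add: zero_less_mult_iff mult.assoc[symmetric]) (simp add: mult_ac)
        qed (use x in \<open>auto simp: zero_less_mult_iff\<close>)
      qed
      finally show ?thesis .
    qed auto
  qed
  also have "\<dots> = (\<integral>\<^sup>+s. \<integral>\<^sup>+x. of_nat k * indicator B x * indicator {0<..} s * ennreal (norm (s *\<^sub>R x) ^ k / s) * f (s *\<^sub>R x) \<partial>M \<partial>lborel)"
    by (subst P.Fubini') (auto simp: case_prod_unfold)
  also have "\<dots> = (\<integral>\<^sup>+s. \<integral>\<^sup>+y. (indicator {0<..} s * (ennreal (real k / s ^ (k + 1)) * indicator {norm y..} s)) *
      (indicator (- {0}) y * ennreal (norm y ^ k) * f y) \<partial>M \<partial>lborel)"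
  proof (rule nn_integral_cong)
    fix s :: real
    show "(\<integral>\<^sup>+x. of_nat k * indicator B x * indicator {0<..} s * ennreal (norm (s *\<^sub>R x) ^ k / s) * f (s *\<^sub>R x) \<partial>M) =
      (\<integral>\<^sup>+y. (indicator {0<..} s * (ennreal (real k / s ^ (k + 1)) * indicator {norm y..} s)) *
      (indicator (- {0}) y * ennreal (norm y ^ k) * f y) \<partial>M)"
    proof (cases "s > 0")
      case True
      define h where "h y = ennreal (real k) * indicator (cball 0 s - {0}) y * ennreal (norm y ^ k / s) * f y" for y
      have [measurable]: "h \<in> borel_measurable borel" unfolding h_def by measurable
      have "(\<integral>\<^sup>+x. of_nat k * indicator B x * indicator {0<..} s * ennreal (norm (s *\<^sub>R x) ^ k / s) * f (s *\<^sub>R x) \<partial>M)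
        = (\<integral>\<^sup>+x. h (s *\<^sub>R x) \<partial>M)"
      proof (rule nn_integral_cong)
        fix x :: 'a
        have "s *\<^sub>R x \<in> cball 0 s - {0} \<longleftrightarrow> x \<in> B"
          using True by (auto simp: B_def)
        then show "of_nat k * indicator B x * indicator {0<..} s * ennreal (norm (s *\<^sub>R x) ^ k / s) * f (s *\<^sub>R x) = h (s *\<^sub>R x)"
          using True by (simp add: h_def ennreal_of_nat_eq_real_of_nat indicator_def)
      qed
      also have "\<dots> = ennreal (1 / s ^ k) * (ennreal (s ^ k) * (\<integral>\<^sup>+x. h (s *\<^sub>R x) \<partial>M))"
        using True by (simp add: mult.assoc[symmetric] ennreal_mult'[symmetric])
      also have "\<dots> = ennreal (1 / s ^ k) * (\<integral>\<^sup>+y. h y \<partial>M)"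
        using True by (simp only: scaling[of h s, OF \<open>h \<in> borel_measurable borel\<close>])
      also have "\<dots> = (\<integral>\<^sup>+y. ennreal (1 / s ^ k) * h y \<partial>M)"
        by (rule nn_integral_cmult[symmetric]) measurable
      also have "\<dots> = (\<integral>\<^sup>+y. (indicator {0<..} s * (ennreal (real k / s ^ (k + 1)) * indicator {norm y..} s)) *
      (indicator (- {0}) y * ennreal (norm y ^ k) * f y) \<partial>M)"
      proof (rule nn_integral_cong)
        fix y :: 'a
        have "ennreal (1 / s ^ k) * (ennreal (real k) * ennreal (norm y ^ k / s)) =
              ennreal (real k / s ^ (k + 1)) * ennreal (norm y ^ k)"
          using True by (simp add: ennreal_mult'[symmetric] field_simps)
        then show "ennreal (1 / s ^ k) * h y = (indicator {0<..} s * (ennreal (real k / s ^ (k + 1)) * indicator {norm y..} s)) *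
      (indicator (- {0}) y * ennreal (norm y ^ k) * f y)"
          using True by (cases "y \<in> cball 0 s - {0}")
            (simp_all add: h_def indicator_def mult.assoc[symmetric])
      qed
      finally show ?thesis .
    qed auto
  qed
  also have "\<dots> = (\<integral>\<^sup>+y. \<integral>\<^sup>+s. (indicator {0<..} s * (ennreal (real k / s ^ (k + 1)) * indicator {norm y..} s)) *
      (indicator (- {0}) y * ennreal (norm y ^ k) * f y) \<partial>lborel \<partial>M)"
  proof (subst P.Fubini')
    have [measurable]: "{x::'a \<times> real. norm (fst x) \<le> snd x} \<in> sets borel"
      by (intro borel_closed closed_Collect_le continuous_intros)
    have *: "(\<lambda>x::'a\<times>real. indicator {norm (fst x)..} (snd x) :: ennreal) = indicator {x. norm (fst x) \<le> snd x}"
      by (auto simp: fun_eq_iff split: split_indicator)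
    have [measurable]: "(\<lambda>x::'a\<times>real. indicator {norm (fst x)..} (snd x) :: ennreal) \<in> borel_measurable (borel \<Otimes>\<^sub>M borel)"
      unfolding * borel_prod by measurable
    show "(\<lambda>(y, s). (indicator {0<..} s * (ennreal (real k / s ^ (k + 1)) * indicator {norm y..} s)) *
      (indicator (- {0}) y * ennreal (norm y ^ k) * f y)) \<in> borel_measurable (M \<Otimes>\<^sub>M lborel)"
      unfolding case_prod_unfold by measurable
  qed simp
  also have "\<dots> = (\<integral>\<^sup>+y. f y \<partial>M)"
  proof (rule nn_integral_cong_AE, use AE_nonzero in eventually_elim)
    fix y :: 'a assume y: "y \<noteq> 0"
    have "(\<integral>\<^sup>+s. (indicator {0<..} s * (ennreal (real k / s ^ (k + 1)) * indicator {norm y..} s)) *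
      (indicator (- {0}) y * ennreal (norm y ^ k) * f y) \<partial>lborel) =
      (\<integral>\<^sup>+s. ennreal (real k / s ^ (k + 1)) * indicator {norm y..} s * (ennreal (norm y ^ k) * f y) \<partial>lborel)"
      using y by (intro nn_integral_cong) (auto split: split_indicator simp: not_less dest: order_trans)
    also have "\<dots> = ennreal (1 / norm y ^ k) * (ennreal (norm y ^ k) * f y)"
      using y degree_pos by (subst nn_integral_multc, measurable)
        (simp_all only: nn_integral_power_tail zero_less_norm_iff simp_thms)
    also have "\<dots> = f y"
      using y by (simp add: mult.assoc[symmetric] ennreal_mult'[symmetric])
    finally show "(\<integral>\<^sup>+s. (indicator {0<..} s * (ennreal (real k / s ^ (k + 1)) * indicator {norm y..} s)) *
      (indicator (- {0}) y * ennreal (norm y ^ k) * f y) \<partial>lborel) = f y" .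
  qed
  finally show ?thesis ..
qed

end

lemma emeasure_lborel_bounded_cball: "emeasure lborel (cball (0::'a::euclidean_space) r) < \<infinity>"
  by (metis bounded_cball emeasure_bounded_finite infinity_ennreal_def)

interpretation lborel_hom: homogeneous_measure "lborel :: 'a::euclidean_space measure" "DIM('a)"
proof
  fix f :: "'a \<Rightarrow> ennreal" and s :: real
  assume "f \<in> borel_measurable borel" "0 < s"
  then show "(\<integral>\<^sup>+x. f x \<partial>lborel) = ennreal (s ^ DIM('a)) * (\<integral>\<^sup>+x. f (s *\<^sub>R x) \<partial>lborel)"
    using nn_integral_lborel_affine[of f s 0] by simp
qed (use emeasure_lborel_bounded_cball in auto)

section \<open>Lebesgue measure on a hyperplane\<close>

text \<open>For a unit vector \<open>e\<close> the slab has thickness 1, so projecting its volume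
  along \<open>e\<close> yields hyperplane area with no normalising factor.\<close>

definition slab :: "'a::euclidean_space \<Rightarrow> 'a set" where
  "slab e = {x. 0 \<le> x \<bullet> e \<and> x \<bullet> e \<le> 1}"

definition proj_orth :: "'a::euclidean_space \<Rightarrow> 'a \<Rightarrow> 'a" where
  "proj_orth e x = x - (x \<bullet> e) *\<^sub>R e"

text \<open>
  This is \<open>(n - 1)\<close>-dimensional Lebesgue measure on the hyperplane orthogonal to the unit vector
  \<open>e\<close>, realised on the ambient space so that no type of dimension \<open>n - 1\<close> is needed.
\<close>

definition hyperplane_measure :: "'a::euclidean_space \<Rightarrow> 'a measure" where
  "hyperplane_measure e = distr (density lborel (indicator (slab e))) borel (proj_orth e)"

lemma sets_slab [measurable]: "slab e \<in> sets borel"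
  unfolding slab_def by measurable

lemma measurable_proj_orth [measurable]: "proj_orth e \<in> borel_measurable borel"
  unfolding proj_orth_def by measurable

lemma sets_hyperplane_measure [measurable_cong, simp]: "sets (hyperplane_measure e) = sets borel"
  by (simp add: hyperplane_measure_def)

lemma nn_integral_hyperplane_measure:
  assumes [measurable]: "f \<in> borel_measurable borel"
  shows "(\<integral>\<^sup>+y. f y \<partial>hyperplane_measure e) = (\<integral>\<^sup>+x. indicator (slab e) x * f (proj_orth e x) \<partial>lborel)"
  unfolding hyperplane_measure_def by (simp add: nn_integral_distr nn_integral_density)

lemma AE_hyperplane_measure:
  assumes "norm e = 1"
  shows "AE y in hyperplane_measure e. y \<bullet> e = 0"
proof -
  have "e \<bullet> e = 1" using assms by (simp add: norm_eq_1)
  then show ?thesis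
    unfolding hyperplane_measure_def
    by (subst AE_distr_iff) (auto simp: proj_orth_def inner_diff_left)
qed

text \<open>After translating along \<open>e\<close>, a fixed point x is counted for exactly those t
  for which x - t e lies in the slab. They form an interval of length 1.\<close>

lemma nn_integral_hyperplane_Fubini:
  fixes e :: "'a::euclidean_space"
  assumes f [measurable]: "f \<in> borel_measurable borel" and e: "norm e = 1"
  shows "(\<integral>\<^sup>+x. f x \<partial>lborel) = (\<integral>\<^sup>+y. \<integral>\<^sup>+t. f (t *\<^sub>R e + y) \<partial>lborel \<partial>hyperplane_measure e)"
proof -
  have ee: "e \<bullet> e = 1" using e by (simp add: norm_eq_1)
  have m [measurable]: "{x::'a \<times> real. 0 \<le> fst x \<bullet> e - snd x \<and> fst x \<bullet> e - snd x \<le> 1} \<in> sets borel"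
    by (intro borel_closed closed_Collect_le closed_Collect_conj continuous_intros)
  have *: "(\<lambda>x. indicator (slab e) (fst x - snd x *\<^sub>R e) :: ennreal) =
      indicator {x::'a \<times> real. 0 \<le> fst x \<bullet> e - snd x \<and> fst x \<bullet> e - snd x \<le> 1}"
    by (auto simp: fun_eq_iff slab_def inner_diff_left ee split: split_indicator)
  have [measurable]: "(\<lambda>x. indicator (slab e) (fst x - snd x *\<^sub>R e) :: ennreal) \<in> borel_measurable (borel \<Otimes>\<^sub>M borel)"
    unfolding * borel_prod by measurable
  have "(\<integral>\<^sup>+y. \<integral>\<^sup>+t. f (t *\<^sub>R e + y) \<partial>lborel \<partial>hyperplane_measure e) =
      (\<integral>\<^sup>+x. indicator (slab e) x * (\<integral>\<^sup>+t. f (t *\<^sub>R e + proj_orth e x) \<partial>lborel) \<partial>lborel)"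
    by (rule nn_integral_hyperplane_measure) measurable
  also have "\<dots> = (\<integral>\<^sup>+x. \<integral>\<^sup>+t. indicator (slab e) x * f (t *\<^sub>R e + x) \<partial>lborel \<partial>lborel)"
  proof (rule nn_integral_cong)
    fix x
    have "(\<integral>\<^sup>+t. f (t *\<^sub>R e + proj_orth e x) \<partial>lborel) = (\<integral>\<^sup>+t. f (t *\<^sub>R e + x) \<partial>lborel)"
      by (subst nn_integral_real_affine[of _ 1 "x \<bullet> e"]) (auto simp: proj_orth_def algebra_simps)
    then show "indicator (slab e) x * (\<integral>\<^sup>+t. f (t *\<^sub>R e + proj_orth e x) \<partial>lborel) =
        (\<integral>\<^sup>+t. indicator (slab e) x * f (t *\<^sub>R e + x) \<partial>lborel)"
      by (simp add: nn_integral_cmult)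
  qed
  also have "\<dots> = (\<integral>\<^sup>+t. \<integral>\<^sup>+x. indicator (slab e) x * f (t *\<^sub>R e + x) \<partial>lborel \<partial>lborel)"
    by (subst lborel_pair.Fubini') (auto simp: case_prod_unfold)
  also have "\<dots> = (\<integral>\<^sup>+t. \<integral>\<^sup>+x. indicator (slab e) (x - t *\<^sub>R e) * f x \<partial>lborel \<partial>lborel)"
  proof (rule nn_integral_cong)
    fix t :: real
    show "(\<integral>\<^sup>+x. indicator (slab e) x * f (t *\<^sub>R e + x) \<partial>lborel) =
        (\<integral>\<^sup>+x. indicator (slab e) (x - t *\<^sub>R e) * f x \<partial>lborel)"
      using nn_integral_lborel_affine[of "\<lambda>x. indicator (slab e) (x - t *\<^sub>R e) * f x" 1 "t *\<^sub>R e"]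
      by simp
  qed
  also have "\<dots> = (\<integral>\<^sup>+x. \<integral>\<^sup>+t. indicator (slab e) (x - t *\<^sub>R e) * f x \<partial>lborel \<partial>lborel)"
    by (subst lborel_pair.Fubini') (auto simp: case_prod_unfold)
  also have "\<dots> = (\<integral>\<^sup>+x. f x \<partial>lborel)"
  proof (rule nn_integral_cong)
    fix x
    have "(\<integral>\<^sup>+t. indicator (slab e) (x - t *\<^sub>R e) * f x \<partial>lborel) =
        (\<integral>\<^sup>+t. f x * indicator {x \<bullet> e - 1..x \<bullet> e} t \<partial>lborel)"
      by (intro nn_integral_cong) (auto simp: slab_def inner_diff_left ee split: split_indicator)
    then show "(\<integral>\<^sup>+t. indicator (slab e) (x - t *\<^sub>R e) * f x \<partial>lborel) = f x"
      by (simp add: nn_integral_cmult_indicator)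
  qed
  finally show ?thesis ..
qed

text \<open>The integral over a slab of thickness s is computed twice: slicing gives the factor s,
  and rescaling the slab of thickness 1 gives s^n with n the dimension. Cancelling one s leaves
  degree n - 1.\<close>

lemma hyperplane_homogeneous_measure:
  fixes e :: "'a::euclidean_space"
  assumes e: "norm e = 1" and dim: "2 \<le> DIM('a)"
  shows "homogeneous_measure (hyperplane_measure e) (DIM('a) - 1)"
proof
  have ee: "e \<bullet> e = 1" using e by (simp add: norm_eq_1)
  fix f :: "'a \<Rightarrow> ennreal" and s :: real
  assume f [measurable]: "f \<in> borel_measurable borel" and s: "0 < s"
  define h where "h x = indicator {0..s} (x \<bullet> e) * f (proj_orth e x)" for x
  have [measurable]: "h \<in> borel_measurable borel" unfolding h_def by measurable
  have "(\<integral>\<^sup>+x. h x \<partial>lborel) = (\<integral>\<^sup>+y. \<integral>\<^sup>+t. h (t *\<^sub>R e + y) \<partial>lborel \<partial>hyperplane_measure e)"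
    by (rule nn_integral_hyperplane_Fubini) (auto simp: e)
  also have "\<dots> = (\<integral>\<^sup>+y. ennreal s * f y \<partial>hyperplane_measure e)"
  proof (rule nn_integral_cong_AE, use AE_hyperplane_measure[OF e] in eventually_elim)
    fix y assume "y \<bullet> e = 0"
    then have "(\<integral>\<^sup>+t. h (t *\<^sub>R e + y) \<partial>lborel) = (\<integral>\<^sup>+t. f y * indicator {0..s} t \<partial>lborel)"
      by (intro nn_integral_cong) (simp add: h_def proj_orth_def inner_add_left ee mult.commute)
    then show "(\<integral>\<^sup>+t. h (t *\<^sub>R e + y) \<partial>lborel) = ennreal s * f y"
      using s by (simp add: nn_integral_cmult_indicator mult.commute)
  qed
  also have "\<dots> = ennreal s * (\<integral>\<^sup>+y. f y \<partial>hyperplane_measure e)"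
    by (rule nn_integral_cmult) measurable
  finally have 1: "(\<integral>\<^sup>+x. h x \<partial>lborel) = ennreal s * (\<integral>\<^sup>+y. f y \<partial>hyperplane_measure e)" .
  have "(\<integral>\<^sup>+x. h x \<partial>lborel) = ennreal (s ^ DIM('a)) * (\<integral>\<^sup>+x. h (s *\<^sub>R x) \<partial>lborel)"
    using nn_integral_lborel_affine[of h s 0] s by simp
  also have "(\<integral>\<^sup>+x. h (s *\<^sub>R x) \<partial>lborel) = (\<integral>\<^sup>+x. indicator (slab e) x * f (s *\<^sub>R proj_orth e x) \<partial>lborel)"
  proof (rule nn_integral_cong)
    fix x
    have "s * (x \<bullet> e) \<in> {0..s} \<longleftrightarrow> x \<in> slab e"
      using s by (auto simp: slab_def zero_le_mult_iff)
    then show "h (s *\<^sub>R x) = indicator (slab e) x * f (s *\<^sub>R proj_orth e x)"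
      by (simp add: h_def indicator_def proj_orth_def scaleR_diff_right)
  qed
  also have "\<dots> = (\<integral>\<^sup>+y. f (s *\<^sub>R y) \<partial>hyperplane_measure e)"
    by (rule nn_integral_hyperplane_measure[symmetric]) measurable
  finally have 2: "ennreal s * (\<integral>\<^sup>+y. f y \<partial>hyperplane_measure e) =
      ennreal (s ^ DIM('a)) * (\<integral>\<^sup>+y. f (s *\<^sub>R y) \<partial>hyperplane_measure e)"
    using 1 by simp
  have "s ^ DIM('a) = s * s ^ (DIM('a) - 1)"
    using dim by (simp add: power_eq_if)
  then have "ennreal (1 / s) * (ennreal s * (\<integral>\<^sup>+y. f y \<partial>hyperplane_measure e)) =
      ennreal (1 / s) * (ennreal s * (ennreal (s ^ (DIM('a) - 1)) * (\<integral>\<^sup>+y. f (s *\<^sub>R y) \<partial>hyperplane_measure e)))"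
    unfolding 2 using s by (simp add: ennreal_mult' mult.assoc)
  moreover have "ennreal (1 / s) * (ennreal s * X) = X" for X
    using s by (simp add: mult.assoc[symmetric] ennreal_mult'[symmetric])
  ultimately show "(\<integral>\<^sup>+y. f y \<partial>hyperplane_measure e) =
      ennreal (s ^ (DIM('a) - 1)) * (\<integral>\<^sup>+y. f (s *\<^sub>R y) \<partial>hyperplane_measure e)"
    by simp
next
  have bound: "norm x \<le> 2" if "x \<in> slab e" "norm (proj_orth e x) \<le> 1" for x
  proof -
    have "norm x = norm (proj_orth e x + (x \<bullet> e) *\<^sub>R e)" by (simp add: proj_orth_def)
    also have "\<dots> \<le> norm (proj_orth e x) + norm ((x \<bullet> e) *\<^sub>R e)" by (rule norm_triangle_ineq)
    finally show ?thesis using that e by (simp add: slab_def)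
  qed
  have "(\<integral>\<^sup>+x. indicator (slab e) x * indicator (cball 0 1) (proj_orth e x) \<partial>lborel)
      \<le> (\<integral>\<^sup>+x. indicator (cball (0::'a) 2) x \<partial>lborel)"
    by (intro nn_integral_mono) (auto simp: bound split: split_indicator)
  also have "\<dots> < \<infinity>"
    using emeasure_lborel_bounded_cball[of 2, where 'a='a] by simp
  finally show "emeasure (hyperplane_measure e) (cball 0 1) < \<infinity>"
    using nn_integral_hyperplane_measure[of "indicator (cball 0 1)" e] by simp
qed (use dim in auto)

text \<open>Slicing the n-ball orthogonally to \<open>e\<close> expresses its volume as a Beta value
  times the unknown mass. The Gamma formula shows that the same Beta value is the quotient of
  consecutive values of \<open>unit_ball_vol\<close>, so it cancels.\<close>

lemma emeasure_hyperplane_unit_ball: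
  fixes e :: "'a::euclidean_space"
  assumes e: "norm e = 1" and dim: "2 \<le> DIM('a)"
  shows "emeasure (hyperplane_measure e) (cball 0 1) = ennreal (unit_ball_vol (real (DIM('a) - 1)))"
proof -
  define m where "m = DIM('a) - 1"
  interpret H: homogeneous_measure "hyperplane_measure e" m
    unfolding m_def by (rule hyperplane_homogeneous_measure[OF e dim])
  interpret P: pair_sigma_finite "hyperplane_measure e" "lborel :: real measure"
    by standard
  define V where "V = emeasure (hyperplane_measure e) (cball 0 1)"
  define \<beta> where "\<beta> = Beta (1 / 2) (real m / 2 + 1)"
  have ee: "e \<bullet> e = 1" using e by (simp add: norm_eq_1)
  have [measurable]: "{x::'a \<times> real. norm (snd x *\<^sub>R e + fst x) \<le> 1} \<in> sets borel"
    by (intro borel_closed closed_Collect_le continuous_intros)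
  have *: "(\<lambda>x::'a\<times>real. indicator (cball 0 1) (snd x *\<^sub>R e + fst x) :: ennreal) = indicator {x. norm (snd x *\<^sub>R e + fst x) \<le> 1}"
    by (auto simp: fun_eq_iff split: split_indicator)
  have [measurable]: "(\<lambda>x::'a\<times>real. indicator (cball 0 1) (snd x *\<^sub>R e + fst x) :: ennreal) \<in> borel_measurable (borel \<Otimes>\<^sub>M borel)"
    unfolding * borel_prod by measurable
  have "ennreal (unit_ball_vol (real DIM('a))) = emeasure lborel (cball (0::'a) 1)"
    by (simp add: emeasure_cball)
  also have "\<dots> = (\<integral>\<^sup>+x. indicator (cball (0::'a) 1) x \<partial>lborel)"
    by simp
  also have "\<dots> = (\<integral>\<^sup>+y. \<integral>\<^sup>+t. indicator (cball 0 1) (t *\<^sub>R e + y) \<partial>lborel \<partial>hyperplane_measure e)"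
    by (rule nn_integral_hyperplane_Fubini) (auto simp: e)
  also have "\<dots> = (\<integral>\<^sup>+t. \<integral>\<^sup>+y. indicator (cball 0 1) (t *\<^sub>R e + y) \<partial>hyperplane_measure e \<partial>lborel)"
    by (subst P.Fubini') (auto simp: case_prod_unfold)
  also have "\<dots> = (\<integral>\<^sup>+t. indicator {-1<..<1} t * ennreal (sqrt (1 - t\<^sup>2) ^ m) * V \<partial>lborel)"
  \<comment> \<open>For t = 1 and t = -1 the slice has radius 0, which the scaling law for balls
    does not cover; the two values form a null set.\<close>
  proof (intro nn_integral_cong_AE AE_I[of _ _ "{-1, 1}"] subsetI)
    fix t :: real
    assume "t \<in> {t \<in> space lborel. (\<integral>\<^sup>+y. indicator (cball 0 1) (t *\<^sub>R e + y) \<partial>hyperplane_measure e) \<noteq>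
        indicator {-1<..<1} t * ennreal (sqrt (1 - t\<^sup>2) ^ m) * V}"
    then have neq: "(\<integral>\<^sup>+y. indicator (cball 0 1) (t *\<^sub>R e + y) \<partial>hyperplane_measure e) \<noteq>
        indicator {-1<..<1} t * ennreal (sqrt (1 - t\<^sup>2) ^ m) * V" by simp
    show "t \<in> {-1, 1}"
    proof (rule ccontr)
      assume t: "t \<notin> {-1, 1}"
      have iff: "norm (t *\<^sub>R e + y) \<le> 1 \<longleftrightarrow> t\<^sup>2 + (norm y)\<^sup>2 \<le> 1" if "y \<bullet> e = 0" for y
      proof -
        have "(norm (t *\<^sub>R e + y))\<^sup>2 = t\<^sup>2 + (norm y)\<^sup>2"
          using that ee unfolding power2_norm_eq_inner
          by (simp add: inner_add_left inner_add_right inner_commute power2_eq_square)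
        then show ?thesis
          using power2_le_iff_abs_le[of 1 "norm (t *\<^sub>R e + y)"] by simp
      qed
      show False
      proof (cases "t \<in> {-1<..<1}")
        case True
        then have t1: "t\<^sup>2 < 1" by (simp add: abs_square_less_1 abs_less_iff)
        have "(\<integral>\<^sup>+y. indicator (cball 0 1) (t *\<^sub>R e + y) \<partial>hyperplane_measure e) =
            (\<integral>\<^sup>+y. indicator (cball 0 (sqrt (1 - t\<^sup>2))) y \<partial>hyperplane_measure e)"
        proof (rule nn_integral_cong_AE, use AE_hyperplane_measure[OF e] in eventually_elim)
          fix y assume "y \<bullet> e = 0"
          then have "norm (t *\<^sub>R e + y) \<le> 1 \<longleftrightarrow> (norm y)\<^sup>2 \<le> (sqrt (1 - t\<^sup>2))\<^sup>2"
            using iff[of y] t1 by auto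
          also have "\<dots> \<longleftrightarrow> norm y \<le> sqrt (1 - t\<^sup>2)"
            using t1 power2_le_iff_abs_le[of "sqrt (1 - t\<^sup>2)" "norm y"] by simp
          finally show "indicator (cball 0 1) (t *\<^sub>R e + y) = (indicator (cball 0 (sqrt (1 - t\<^sup>2))) y :: ennreal)"
            by (simp add: indicator_def)
        qed
        also have "\<dots> = emeasure (hyperplane_measure e) (cball 0 (sqrt (1 - t\<^sup>2)))"
          by simp
        also have "\<dots> = ennreal (sqrt (1 - t\<^sup>2) ^ m) * V"
          unfolding V_def using t1 by (subst H.emeasure_cball) auto
        finally show False using neq True by simp
      next
        case False
        then have "1 < \<bar>t\<bar>" using t by auto
        then have "1 < t\<^sup>2" using abs_square_le_1 not_less by blast
        have "(\<integral>\<^sup>+y. indicator (cball 0 1) (t *\<^sub>R e + y) \<partial>hyperplane_measure e) = (\<integral>\<^sup>+y. 0 \<partial>hyperplane_measure e)"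
        proof (rule nn_integral_cong_AE, use AE_hyperplane_measure[OF e] in eventually_elim)
          fix y assume "y \<bullet> e = 0"
          moreover have "\<not> t\<^sup>2 + (norm y)\<^sup>2 \<le> 1"
            using \<open>1 < t\<^sup>2\<close> zero_le_power2[of "norm y"] by linarith
          ultimately show "indicator (cball 0 1) (t *\<^sub>R e + y) = (0 :: ennreal)"
            using iff[of y] by (simp add: indicator_def)
        qed
        then show False using neq False by simp
      qed
    qed
  qed (auto simp: emeasure_lborel_countable)
  also have "\<dots> = (\<integral>\<^sup>+t. ennreal (indicator {-1..1} t * sqrt (1 - t\<^sup>2) ^ m) * V \<partial>lborel)"
    using dim by (intro nn_integral_cong) (auto simp: m_def split: split_indicator)
  also have "\<dots> = (\<integral>\<^sup>+t. ennreal (indicator {-1..1} t * sqrt (1 - t\<^sup>2) ^ m) \<partial>lborel) * V"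
    by (rule nn_integral_multc) measurable
  also have "\<dots> = ennreal \<beta> * V"
    by (simp add: emeasure_cball_aux_integral \<beta>_def)
  finally have eq: "ennreal (unit_ball_vol (real DIM('a))) = ennreal \<beta> * V" .
  have n: "real DIM('a) = real m + 1" using dim by (simp add: m_def)
  have \<beta>: "0 < \<beta>" "unit_ball_vol (real DIM('a)) = \<beta> * unit_ball_vol (real m)"
  proof -
    have G: "Gamma (real m / 2 + 1) > 0" "Gamma (real m / 2 + 3 / 2) > 0"
      by (auto intro!: Gamma_real_pos)
    have b: "\<beta> = sqrt pi * Gamma (real m / 2 + 1) / Gamma (real m / 2 + 3 / 2)"
      by (simp add: \<beta>_def Beta_def Gamma_one_half_real add.commute)
    then show "0 < \<beta>" using G by simp
    have pw: "pi powr ((real m + 1) / 2) = pi powr (real m / 2) * sqrt pi"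
      by (simp add: add_divide_distrib powr_add powr_half_sqrt)
    show "unit_ball_vol (real DIM('a)) = \<beta> * unit_ball_vol (real m)"
    proof -
      have "(real m + 1) / 2 + 1 = real m / 2 + 3 / 2" by (simp add: field_simps)
      then have "unit_ball_vol (real m + 1) = pi powr (real m / 2) * sqrt pi / Gamma (real m / 2 + 3 / 2)"
        unfolding unit_ball_vol_def pw[symmetric] by simp
      then show ?thesis
        unfolding n b unit_ball_vol_def using less_imp_neq[OF G(1)] by simp
    qed
  qed
  have "ennreal \<beta> * V = ennreal \<beta> * ennreal (unit_ball_vol (real m))"
    using eq \<beta> by (simp add: ennreal_mult')
  then have "V = ennreal (unit_ball_vol (real m))"
    using \<beta> by (subst (asm) ennreal_mult_cancel_left) auto
  then show ?thesis by (simp add: V_def m_def)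
qed

section \<open>Angular coordinates on the sphere\<close>

text \<open>The cotangent decreases, so the rule for increasing substitutions is applied to f(-t)
  and -cot. This turns positions on a line into angles seen from the origin.\<close>

lemma nn_integral_cot_substitution:
  fixes f :: "real \<Rightarrow> ennreal"
  assumes f [measurable]: "f \<in> borel_measurable borel"
  shows "(\<integral>\<^sup>+t. f t \<partial>lborel) =
         (\<integral>\<^sup>+\<theta>. f (cot \<theta>) * ennreal (1 / (sin \<theta>)\<^sup>2) * indicator {0<..<pi} \<theta> \<partial>lborel)"
proof -
  define a b :: "nat \<Rightarrow> real" where "a k = 1 / real (k + 1)" and "b k = pi - 1 / real (k + 1)" for k
  have small: "1 / real (k + 1) \<le> 1" for k by simp
  have U: "{0<..<pi} = (\<Union>k. {a k..b k})"
  proof (intro equalityI subsetI)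
    fix x assume x: "x \<in> {0<..<pi}"
    obtain k where "inverse (real (Suc k)) < min x (pi - x)"
      using reals_Archimedean[of "min x (pi - x)"] x by auto
    then show "x \<in> (\<Union>k. {a k..b k})"
      by (auto simp: a_def b_def inverse_eq_divide intro!: exI[of _ k])
  next
    fix x assume "x \<in> (\<Union>k. {a k..b k})"
    then obtain k where "a k \<le> x" "x \<le> b k" by auto
    moreover have "0 < 1 / real (k + 1)" by simp
    ultimately show "x \<in> {0<..<pi}" unfolding a_def b_def greaterThanLessThan_iff by linarith
  qed
  have img: "(\<lambda>\<theta>. - cot \<theta>) ` {0<..<pi} = UNIV"
  proof -
    have "t \<in> (\<lambda>\<theta>. - cot \<theta>) ` {0<..<pi}" for t :: real
    proof (rule image_eqI)
      show "t = - cot (pi / 2 + arctan t)"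
        using tan_arctan[of t] by (simp add: cot_def cos_add sin_add tan_def)
      show "pi / 2 + arctan t \<in> {0<..<pi}"
        using arctan_bounded[of t] by auto
    qed
    then show ?thesis by blast
  qed
  have "(\<integral>\<^sup>+t. f t \<partial>lborel) = (\<integral>\<^sup>+t. f (- t) * indicator ((\<lambda>\<theta>. - cot \<theta>) ` {0<..<pi}) t \<partial>lborel)"
    unfolding img by (subst nn_integral_real_affine[of _ "-1" 0]) auto
  also have "\<dots> = (\<integral>\<^sup>+\<theta>. f (- (- cot \<theta>)) * ennreal (1 / (sin \<theta>)\<^sup>2) * indicator {0<..<pi} \<theta> \<partial>lborel)"
  proof (rule nn_integral_substitution_exhaustion[where a = a and b = b])
    fix \<theta> :: real assume "\<theta> \<in> {0<..<pi}"
    then have "sin \<theta> \<noteq> 0" using sin_gt_zero[of \<theta>] by auto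
    then show "((\<lambda>\<theta>. - cot \<theta>) has_real_derivative 1 / (sin \<theta>)\<^sup>2) (at \<theta>)"
      using DERIV_minus[OF DERIV_cot[of \<theta>]] by (simp add: inverse_eq_divide)
  next
    show "continuous_on {0<..<pi} (\<lambda>\<theta>. 1 / (sin \<theta>)\<^sup>2)"
      using sin_gt_zero by (intro continuous_intros) fastforce
    show "a k < b k" for k
      using small[of k] pi_gt3 unfolding a_def b_def by linarith
    have "1 / real (l + 1) \<le> 1 / real (k + 1)" if "k \<le> l" for k l :: nat
      using that by (intro divide_left_mono) auto
    then show "decseq a" "incseq b"
      unfolding a_def b_def decseq_def incseq_def by auto
  qed (use U in auto)
  finally show ?thesis by simp
qed

definition great_circle :: "'a::euclidean_space \<Rightarrow> 'a \<Rightarrow> real \<Rightarrow> 'a" where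
  "great_circle e u \<theta> = cos \<theta> *\<^sub>R e + sin \<theta> *\<^sub>R u"

lemma norm_great_circle:
  assumes "norm e = 1" "norm u = 1" "u \<bullet> e = 0"
  shows "norm (great_circle e u \<theta>) = 1"
proof -
  have "great_circle e u \<theta> \<bullet> great_circle e u \<theta> = (cos \<theta>)\<^sup>2 * (e \<bullet> e) + (sin \<theta>)\<^sup>2 * (u \<bullet> u)"
    using assms(3) by (simp add: great_circle_def inner_add_left inner_add_right inner_commute power2_eq_square)
  then show ?thesis
    using assms(1,2) by (simp add: norm_eq_1 norm_eq_sqrt_inner)
qed

abbreviation sphere_measure :: "'a::euclidean_space measure" where
  "sphere_measure \<equiv> homogeneous_measure.cone_measure lborel DIM('a)"

abbreviation equator_measure :: "'a::euclidean_space \<Rightarrow> 'a measure" where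
  "equator_measure e \<equiv> homogeneous_measure.cone_measure (hyperplane_measure e) (DIM('a) - 1)"

lemma nn_integral_power_Ioc:
  assumes "0 \<le> c" "0 < n"
  shows "(\<integral>\<^sup>+\<rho>. ennreal (real n * \<rho> ^ (n - 1)) * indicator {0<..c} \<rho> \<partial>lborel) = ennreal (c ^ n)"
proof -
  have "(\<integral>\<^sup>+\<rho>. ennreal (real n * \<rho> ^ (n - 1)) * indicator {0<..c} \<rho> \<partial>lborel) =
      (\<integral>\<^sup>+\<rho>. ennreal (real n * \<rho> ^ (n - 1)) * indicator {0..c} \<rho> \<partial>lborel)"
    by (intro nn_integral_cong_AE AE_I[of _ _ "{0}"]) (auto split: split_indicator)
  also have "\<dots> = ennreal (c ^ n - 0 ^ n)"
    using assms by (intro nn_integral_FTC_Icc) (auto intro!: derivative_eq_intros)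
  finally show ?thesis using assms by (simp add: zero_power)
qed

text \<open>In the half-plane spanned by \<open>e\<close> and \<open>u\<close>, the point at height
  \<rho> and angle \<theta> has abscissa \<rho> cot \<theta> and distance \<rho> / sin \<theta> from
  the origin. Hence it lies in the unit ball exactly when \<rho> \<le> sin \<theta>.\<close>

lemma nn_integral_line_sphere_cone:
  fixes g :: "'a::euclidean_space \<Rightarrow> ennreal"
  assumes g [measurable]: "g \<in> borel_measurable borel" and e: "norm e = 1"
    and u: "norm u = 1" "u \<bullet> e = 0" and \<rho>: "0 < \<rho>"
  shows "(\<integral>\<^sup>+t. of_nat DIM('a) * indicator (cball 0 1 - {0}) (t *\<^sub>R e + \<rho> *\<^sub>R u) *
             g (sgn (t *\<^sub>R e + \<rho> *\<^sub>R u)) \<partial>lborel) =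
         (\<integral>\<^sup>+\<theta>. ennreal (real DIM('a) * \<rho>) * indicator {0<..sin \<theta>} \<rho> *
             (g (great_circle e u \<theta>) * ennreal (1 / (sin \<theta>)\<^sup>2)) * indicator {0<..<pi} \<theta> \<partial>lborel)"
proof -
  define F where "F t = of_nat DIM('a) * indicator (cball 0 1 - {0}) (t *\<^sub>R e + \<rho> *\<^sub>R u) *
             g (sgn (t *\<^sub>R e + \<rho> *\<^sub>R u))" for t
  have [measurable]: "(sgn :: 'a \<Rightarrow> 'a) \<in> borel_measurable borel"
    unfolding sgn_div_norm by measurable
  have [measurable]: "cball 0 1 - {0::'a} \<in> sets borel" by simp
  have [measurable]: "F \<in> borel_measurable borel" unfolding F_def by measurable
  have "(\<integral>\<^sup>+t. F t \<partial>lborel) = ennreal \<rho> * (\<integral>\<^sup>+c. F (\<rho> * c) \<partial>lborel)"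
    by (subst nn_integral_real_affine[of _ \<rho> 0]) (use \<rho> in auto)
  also have "(\<integral>\<^sup>+c. F (\<rho> * c) \<partial>lborel) =
      (\<integral>\<^sup>+\<theta>. F (\<rho> * cot \<theta>) * ennreal (1 / (sin \<theta>)\<^sup>2) * indicator {0<..<pi} \<theta> \<partial>lborel)"
    by (rule nn_integral_cot_substitution) measurable
  also have "ennreal \<rho> * \<dots> = (\<integral>\<^sup>+\<theta>. ennreal \<rho> * (F (\<rho> * cot \<theta>) * ennreal (1 / (sin \<theta>)\<^sup>2) * indicator {0<..<pi} \<theta>) \<partial>lborel)"
    unfolding cot_def by (rule nn_integral_cmult[symmetric]) measurable
  also have "\<dots> = (\<integral>\<^sup>+\<theta>. ennreal (real DIM('a) * \<rho>) * indicator {0<..sin \<theta>} \<rho> *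
             (g (great_circle e u \<theta>) * ennreal (1 / (sin \<theta>)\<^sup>2)) * indicator {0<..<pi} \<theta> \<partial>lborel)"
  proof (rule nn_integral_cong)
    fix \<theta> :: real
    show "ennreal \<rho> * (F (\<rho> * cot \<theta>) * ennreal (1 / (sin \<theta>)\<^sup>2) * indicator {0<..<pi} \<theta>) =
        ennreal (real DIM('a) * \<rho>) * indicator {0<..sin \<theta>} \<rho> *
             (g (great_circle e u \<theta>) * ennreal (1 / (sin \<theta>)\<^sup>2)) * indicator {0<..<pi} \<theta>"
    proof (cases "\<theta> \<in> {0<..<pi}")
      case True
      then have s: "0 < sin \<theta>" by (simp add: sin_gt_zero)
      have x: "(\<rho> * cot \<theta>) *\<^sub>R e + \<rho> *\<^sub>R u = (\<rho> / sin \<theta>) *\<^sub>R great_circle e u \<theta>"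
        using s by (simp add: great_circle_def cot_def scaleR_add_right)
      have n1: "norm (great_circle e u \<theta>) = 1" by (rule norm_great_circle) fact+
      have nx: "norm ((\<rho> * cot \<theta>) *\<^sub>R e + \<rho> *\<^sub>R u) = \<rho> / sin \<theta>"
        unfolding x using s \<rho> n1 by simp
      then have nz: "(\<rho> * cot \<theta>) *\<^sub>R e + \<rho> *\<^sub>R u \<noteq> 0"
        using s \<rho> by (metis divide_pos_pos less_irrefl norm_zero)
      have "sgn ((\<rho> * cot \<theta>) *\<^sub>R e + \<rho> *\<^sub>R u) = great_circle e u \<theta>"
        unfolding sgn_div_norm nx unfolding x using s \<rho> by simp
      moreover have "indicator (cball 0 1 - {0}) ((\<rho> * cot \<theta>) *\<^sub>R e + \<rho> *\<^sub>R u) = (indicator {0<..sin \<theta>} \<rho> :: ennreal)"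
        using nz s \<rho> by (simp add: indicator_def nx)
      ultimately show ?thesis
        using True \<rho> by (simp add: F_def ennreal_mult' ennreal_of_nat_eq_real_of_nat mult_ac)
    qed simp
  qed
  finally show ?thesis by (simp add: F_def)
qed

lemma AE_equator_measure:
  fixes e :: "'a::euclidean_space"
  assumes e: "norm e = 1" and dim: "2 \<le> DIM('a)"
  shows "AE u in equator_measure e. norm u = 1 \<and> u \<bullet> e = 0"
proof -
  interpret H: homogeneous_measure "hyperplane_measure e" "DIM('a) - 1"
    by (rule hyperplane_homogeneous_measure[OF e dim])
  have [measurable]: "cball 0 1 - {0::'a} \<in> sets (hyperplane_measure e)" by simp
  have "AE u in H.cone_measure. u \<bullet> e = 0"
    unfolding H.cone_measure_def
    by (subst AE_distr_iff, measurable, subst AE_density, measurable)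
       (use AE_hyperplane_measure[OF e] in \<open>auto elim!: eventually_mono simp: sgn_div_norm\<close>)
  with H.AE_cone_measure_norm show ?thesis by eventually_elim simp
qed

text \<open>The sphere integral is unfolded to the solid ball, sliced along \<open>e\<close>, and
  written in polar coordinates of the hyperplane. For fixed \<theta> the radial integral of n
  \<rho>^(n-1) up to sin \<theta> is sin^n \<theta>; the factor 1 / sin^2 \<theta> of the cotangent
  substitution reduces it to the density sin^(n-2) \<theta>.\<close>

lemma nn_integral_sphere_polar:
  fixes g :: "'a::euclidean_space \<Rightarrow> ennreal"
  assumes g [measurable]: "g \<in> borel_measurable borel" and e: "norm e = 1" and dim: "2 \<le> DIM('a)"
  shows "(\<integral>\<^sup>+w. g w \<partial>sphere_measure) =
    (\<integral>\<^sup>+u. \<integral>\<^sup>+\<theta>. g (great_circle e u \<theta>) * ennreal (sin \<theta> ^ (DIM('a) - 2)) * indicator {0<..<pi} \<theta> \<partial>lborel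
       \<partial>equator_measure e)"
proof -
  define n where "n = DIM('a)"
  interpret H: homogeneous_measure "hyperplane_measure e" "n - 1"
    unfolding n_def by (rule hyperplane_homogeneous_measure[OF e dim])
  interpret C: finite_measure H.cone_measure by (rule H.finite_measure_cone)
  interpret P: pair_sigma_finite H.cone_measure "lborel :: real measure" by standard
  have [measurable]: "cball 0 1 - {0::'a} \<in> sets borel" by simp
  define F where "F x = of_nat n * indicator (cball 0 1 - {0}) x * g (sgn x)" for x
  have [measurable]: "F \<in> borel_measurable borel" unfolding F_def by measurable
  have "(\<integral>\<^sup>+w. g w \<partial>sphere_measure) = (\<integral>\<^sup>+x. F x \<partial>lborel)"
    unfolding F_def n_def by (rule lborel_hom.nn_integral_cone_measure) measurable
  also have "\<dots> = (\<integral>\<^sup>+y. \<integral>\<^sup>+t. F (t *\<^sub>R e + y) \<partial>lborel \<partial>hyperplane_measure e)"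
    by (rule nn_integral_hyperplane_Fubini) (auto simp: e)
  also have "\<dots> = (\<integral>\<^sup>+\<rho>. ennreal (\<rho> ^ (n - 1 - 1)) * indicator {0<..} \<rho> *
      (\<integral>\<^sup>+u. \<integral>\<^sup>+t. F (t *\<^sub>R e + \<rho> *\<^sub>R u) \<partial>lborel \<partial>H.cone_measure) \<partial>lborel)"
    by (rule H.nn_integral_polar) measurable
  also have "\<dots> = (\<integral>\<^sup>+\<rho>. \<integral>\<^sup>+u. ennreal (\<rho> ^ (n - 2)) * indicator {0<..} \<rho> *
      (\<integral>\<^sup>+t. F (t *\<^sub>R e + \<rho> *\<^sub>R u) \<partial>lborel) \<partial>H.cone_measure \<partial>lborel)"
    unfolding diff_diff_left one_add_one
    by (intro nn_integral_cong nn_integral_cmult[symmetric]) measurable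
  also have "\<dots> = (\<integral>\<^sup>+u. \<integral>\<^sup>+\<rho>. ennreal (\<rho> ^ (n - 2)) * indicator {0<..} \<rho> *
      (\<integral>\<^sup>+t. F (t *\<^sub>R e + \<rho> *\<^sub>R u) \<partial>lborel) \<partial>lborel \<partial>H.cone_measure)"
  proof (subst P.Fubini')
    show "(\<lambda>(u, \<rho>). ennreal (\<rho> ^ (n - 2)) * indicator {0<..} \<rho> * (\<integral>\<^sup>+t. F (t *\<^sub>R e + \<rho> *\<^sub>R u) \<partial>lborel))
        \<in> borel_measurable (H.cone_measure \<Otimes>\<^sub>M lborel)"
      unfolding case_prod_unfold by measurable
  qed (rule refl)
  also have "\<dots> = (\<integral>\<^sup>+u. \<integral>\<^sup>+\<theta>. g (great_circle e u \<theta>) * ennreal (sin \<theta> ^ (n - 2)) * indicator {0<..<pi} \<theta> \<partial>lborel \<partial>H.cone_measure)"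
  proof (rule nn_integral_cong_AE, use AE_equator_measure[OF e dim, folded n_def] in eventually_elim)
    fix u assume u: "norm u = 1 \<and> u \<bullet> e = 0"
    define G where "G \<theta> = g (great_circle e u \<theta>) * ennreal (1 / (sin \<theta>)\<^sup>2) * indicator {0<..<pi} \<theta>" for \<theta>
    have [measurable]: "G \<in> borel_measurable borel" unfolding G_def great_circle_def by measurable
    have *: "(\<lambda>x::real\<times>real. indicator {0<..sin (snd x)} (fst x) :: ennreal) =
        (\<lambda>x. if 0 < fst x \<and> fst x \<le> sin (snd x) then 1 else 0)"
      by (auto simp: fun_eq_iff)
    have [measurable]: "(\<lambda>x::real\<times>real. indicator {0<..sin (snd x)} (fst x) :: ennreal) \<in> borel_measurable (borel \<Otimes>\<^sub>M borel)"
      unfolding * by measurable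
    have [measurable]: "(\<lambda>\<theta>::real. indicator {0<..sin \<theta>} \<rho> :: ennreal) \<in> borel_measurable borel" for \<rho>
    proof -
      have **: "(\<lambda>\<theta>::real. indicator {0<..sin \<theta>} \<rho> :: ennreal) = (\<lambda>\<theta>::real. indicator {0<..} \<rho> * indicator {\<theta>::real. \<rho> \<le> sin \<theta>} \<theta>)"
        by (auto simp: fun_eq_iff split: split_indicator)
      have [measurable]: "{\<theta>::real. \<rho> \<le> sin \<theta>} \<in> sets borel"
        by (intro borel_closed closed_Collect_le continuous_intros)
      show ?thesis unfolding ** by measurable
    qed
    have pw: "\<rho> ^ (n - 2) * \<rho> = \<rho> ^ (n - 1)" for \<rho> :: real
      using dim by (simp add: n_def Suc_diff_Suc numeral_2_eq_2 flip: power_Suc2)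
    have "(\<integral>\<^sup>+\<rho>. ennreal (\<rho> ^ (n - 2)) * indicator {0<..} \<rho> * (\<integral>\<^sup>+t. F (t *\<^sub>R e + \<rho> *\<^sub>R u) \<partial>lborel) \<partial>lborel) =
      (\<integral>\<^sup>+\<rho>. \<integral>\<^sup>+\<theta>. ennreal (real n * \<rho> ^ (n - 1)) * indicator {0<..sin \<theta>} \<rho> * G \<theta> \<partial>lborel \<partial>lborel)"
    proof (rule nn_integral_cong)
      fix \<rho> :: real
      show "ennreal (\<rho> ^ (n - 2)) * indicator {0<..} \<rho> * (\<integral>\<^sup>+t. F (t *\<^sub>R e + \<rho> *\<^sub>R u) \<partial>lborel) =
        (\<integral>\<^sup>+\<theta>. ennreal (real n * \<rho> ^ (n - 1)) * indicator {0<..sin \<theta>} \<rho> * G \<theta> \<partial>lborel)"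
      proof (cases "0 < \<rho>")
        case True
        have "ennreal (\<rho> ^ (n - 2)) * (\<integral>\<^sup>+t. F (t *\<^sub>R e + \<rho> *\<^sub>R u) \<partial>lborel) =
          ennreal (\<rho> ^ (n - 2)) * (\<integral>\<^sup>+\<theta>. ennreal (real n * \<rho>) * indicator {0<..sin \<theta>} \<rho> *
             (g (great_circle e u \<theta>) * ennreal (1 / (sin \<theta>)\<^sup>2)) * indicator {0<..<pi} \<theta> \<partial>lborel)"
          unfolding F_def n_def using u True
          by (intro arg_cong[where f = "(*) _"] nn_integral_line_sphere_cone) (auto simp: e)
        also have "\<dots> = (\<integral>\<^sup>+\<theta>. ennreal (\<rho> ^ (n - 2)) * (ennreal (real n * \<rho>) * indicator {0<..sin \<theta>} \<rho> *
             (g (great_circle e u \<theta>) * ennreal (1 / (sin \<theta>)\<^sup>2)) * indicator {0<..<pi} \<theta>) \<partial>lborel)"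
          unfolding great_circle_def by (rule nn_integral_cmult[symmetric]) measurable
        also have "\<dots> = (\<integral>\<^sup>+\<theta>. ennreal (real n * \<rho> ^ (n - 1)) * indicator {0<..sin \<theta>} \<rho> * G \<theta> \<partial>lborel)"
        proof (rule nn_integral_cong)
          fix \<theta> :: real
          have eq: "ennreal (\<rho> ^ (n - 2)) * ennreal (real n * \<rho>) = ennreal (real n * \<rho> ^ (n - 1))"
          proof -
            have "\<rho> ^ (n - 2) * (real n * \<rho>) = real n * (\<rho> ^ (n - 2) * \<rho>)"
              by (rule mult.left_commute)
            then show ?thesis
              using True by (simp only: pw ennreal_mult'[symmetric] zero_le_power less_imp_le)
          qed
          show "ennreal (\<rho> ^ (n - 2)) * (ennreal (real n * \<rho>) * indicator {0<..sin \<theta>} \<rho> *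
             (g (great_circle e u \<theta>) * ennreal (1 / (sin \<theta>)\<^sup>2)) * indicator {0<..<pi} \<theta>) =
             ennreal (real n * \<rho> ^ (n - 1)) * indicator {0<..sin \<theta>} \<rho> * G \<theta>"
            by (simp only: G_def mult.assoc[symmetric] eq)
        qed
        finally show ?thesis using True by simp
      qed simp
    qed
    also have "\<dots> = (\<integral>\<^sup>+\<theta>. \<integral>\<^sup>+\<rho>. ennreal (real n * \<rho> ^ (n - 1)) * indicator {0<..sin \<theta>} \<rho> * G \<theta> \<partial>lborel \<partial>lborel)"
      by (subst lborel_pair.Fubini') (auto simp: case_prod_unfold)
    also have "\<dots> = (\<integral>\<^sup>+\<theta>. g (great_circle e u \<theta>) * ennreal (sin \<theta> ^ (n - 2)) * indicator {0<..<pi} \<theta> \<partial>lborel)"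
    proof (rule nn_integral_cong)
      fix \<theta> :: real
      have "(\<integral>\<^sup>+\<rho>. ennreal (real n * \<rho> ^ (n - 1)) * indicator {0<..sin \<theta>} \<rho> * G \<theta> \<partial>lborel) =
          (\<integral>\<^sup>+\<rho>. ennreal (real n * \<rho> ^ (n - 1)) * indicator {0<..sin \<theta>} \<rho> \<partial>lborel) * G \<theta>"
        by (rule nn_integral_multc) measurable
      also have "\<dots> = g (great_circle e u \<theta>) * ennreal (sin \<theta> ^ (n - 2)) * indicator {0<..<pi} \<theta>"
      proof (cases "\<theta> \<in> {0<..<pi}")
        case True
        then have s: "0 < sin \<theta>" by (simp add: sin_gt_zero)
        have "n = (n - 2) + 2" using dim by (simp add: n_def)
        then have "sin \<theta> ^ n * (1 / (sin \<theta>)\<^sup>2) = sin \<theta> ^ (n - 2)"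
          using s by (metis (no_types) less_irrefl mult.right_neutral nonzero_mult_div_cancel_right power_add power_not_zero times_divide_eq_right)
        then have "ennreal (sin \<theta> ^ n) * ennreal (1 / (sin \<theta>)\<^sup>2) = ennreal (sin \<theta> ^ (n - 2))"
          using s by (simp add: ennreal_mult'[symmetric])
        moreover have "(\<integral>\<^sup>+\<rho>. ennreal (real n * \<rho> ^ (n - 1)) * indicator {0<..sin \<theta>} \<rho> \<partial>lborel) = ennreal (sin \<theta> ^ n)"
          using s dim by (intro nn_integral_power_Ioc) (auto simp: n_def)
        ultimately show ?thesis
          using True by (simp add: G_def mult_ac) (metis mult.left_commute)
      qed (simp add: G_def)
      finally show "(\<integral>\<^sup>+\<rho>. ennreal (real n * \<rho> ^ (n - 1)) * indicator {0<..sin \<theta>} \<rho> * G \<theta> \<partial>lborel) =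
        g (great_circle e u \<theta>) * ennreal (sin \<theta> ^ (n - 2)) * indicator {0<..<pi} \<theta>" .
    qed
    finally show "(\<integral>\<^sup>+\<rho>. ennreal (\<rho> ^ (n - 2)) * indicator {0<..} \<rho> * (\<integral>\<^sup>+t. F (t *\<^sub>R e + \<rho> *\<^sub>R u) \<partial>lborel) \<partial>lborel) =
      (\<integral>\<^sup>+\<theta>. g (great_circle e u \<theta>) * ennreal (sin \<theta> ^ (n - 2)) * indicator {0<..<pi} \<theta> \<partial>lborel)" .
  qed
  finally show ?thesis by (simp add: n_def)
qed

section \<open>The capacity bound on spheres and annuli\<close>

text \<open>The constant speed \<open>k\<close> is part of the data so that line integrals can be
  written with the density \<open>k\<close> in the parameter. The midpoint is exempt because the
  arcs used later have a corner there.\<close>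

definition sphere_curve :: "'a::euclidean_space \<Rightarrow> real \<Rightarrow> 'a \<Rightarrow> 'a \<Rightarrow> (real \<Rightarrow> 'a) \<Rightarrow> real \<Rightarrow> bool" where
  "sphere_curve c r e f \<gamma> k \<longleftrightarrow> 0 < k \<and> continuous_on {0..1} \<gamma> \<and> \<gamma> ` {0..1} \<subseteq> sphere c r \<and>
     \<gamma> 0 = e \<and> \<gamma> 1 = f \<and>
     (\<forall>t\<in>{0<..<1} - {1 / 2}. \<exists>d. (\<gamma> has_vector_derivative d) (at t) \<and> norm d = k)"

definition reflect :: "'a::euclidean_space \<Rightarrow> 'a \<Rightarrow> 'a" where
  "reflect \<nu> x = x - (2 * (x \<bullet> \<nu>) / (\<nu> \<bullet> \<nu>)) *\<^sub>R \<nu>"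

lemma linear_reflect: "linear (reflect \<nu>)"
  by (rule linearI) (simp_all add: reflect_def inner_add_left algebra_simps add_divide_distrib)

lemma measurable_reflect [measurable]: "reflect \<nu> \<in> borel_measurable borel"
  unfolding reflect_def by measurable

lemma inner_reflect_normal: "reflect \<nu> x \<bullet> \<nu> = - (x \<bullet> \<nu>)"
  by (cases "\<nu> = 0") (auto simp: reflect_def inner_diff_left)

lemma reflect_reflect [simp]: "reflect \<nu> (reflect \<nu> x) = x"
proof -
  have "reflect \<nu> (reflect \<nu> x) = reflect \<nu> x - (2 * (reflect \<nu> x \<bullet> \<nu>) / (\<nu> \<bullet> \<nu>)) *\<^sub>R \<nu>"
    by (simp add: reflect_def)
  then show ?thesis
    unfolding inner_reflect_normal by (simp add: reflect_def)
qed

lemma reflect_id: "x \<bullet> \<nu> = 0 \<Longrightarrow> reflect \<nu> x = x"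
  by (simp add: reflect_def)

lemma norm_reflect [simp]: "norm (reflect \<nu> x) = norm x"
proof (cases "\<nu> = 0")
  case False
  define a where "a = 2 * (x \<bullet> \<nu>) / (\<nu> \<bullet> \<nu>)"
  have "a * (\<nu> \<bullet> \<nu>) = 2 * (x \<bullet> \<nu>)" using False by (simp add: a_def)
  then have "a * (a * (\<nu> \<bullet> \<nu>)) = a * (2 * (x \<bullet> \<nu>))" by simp
  then have "reflect \<nu> x \<bullet> reflect \<nu> x = x \<bullet> x"
    by (simp add: reflect_def a_def[symmetric] inner_diff_left inner_diff_right inner_commute algebra_simps)
  then show ?thesis by (simp add: norm_eq_sqrt_inner)
qed (simp add: reflect_def)

lemma reflect_bisector:
  assumes "norm a = norm b" "a \<noteq> b"
  shows "reflect (a - b) a = b"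
proof -
  have "a \<bullet> a = b \<bullet> b" using assms(1) by (simp add: norm_eq)
  then have "(a - b) \<bullet> (a - b) = 2 * (a \<bullet> (a - b))"
    by (simp add: inner_diff_left inner_diff_right inner_commute)
  moreover have "(a - b) \<bullet> (a - b) \<noteq> 0" using assms(2) by simp
  ultimately show ?thesis by (simp add: reflect_def)
qed

text \<open>Slicing along the normal reduces the reflection to t \<mapsto> -t on each line.\<close>

lemma nn_integral_lborel_reflect:
  fixes f :: "'a::euclidean_space \<Rightarrow> ennreal"
  assumes [measurable]: "f \<in> borel_measurable borel" and "\<nu> \<noteq> 0"
  shows "(\<integral>\<^sup>+x. f (reflect \<nu> x) \<partial>lborel) = (\<integral>\<^sup>+x. f x \<partial>lborel)"
proof -
  define e where "e = sgn \<nu>"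
  have e: "norm e = 1" using assms(2) by (simp add: e_def norm_sgn)
  have \<nu>: "\<nu> = norm \<nu> *\<^sub>R e" using assms(2) by (simp add: e_def sgn_div_norm)
  have ee: "e \<bullet> e = 1" using e by (simp add: norm_eq_1)
  have "(\<integral>\<^sup>+x. f (reflect \<nu> x) \<partial>lborel) =
      (\<integral>\<^sup>+y. \<integral>\<^sup>+t. f (reflect \<nu> (t *\<^sub>R e + y)) \<partial>lborel \<partial>hyperplane_measure e)"
    by (rule nn_integral_hyperplane_Fubini) (auto simp: e)
  also have "\<dots> = (\<integral>\<^sup>+y. \<integral>\<^sup>+t. f (t *\<^sub>R e + y) \<partial>lborel \<partial>hyperplane_measure e)"
  proof (rule nn_integral_cong_AE, use AE_hyperplane_measure[OF e] in eventually_elim)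
    fix y assume y: "y \<bullet> e = 0"
    have "reflect \<nu> (t *\<^sub>R e + y) = (- t) *\<^sub>R e + y" for t
    proof -
      have "reflect \<nu> (t *\<^sub>R e + y) = (t *\<^sub>R e + y) - (2 * t) *\<^sub>R e"
        unfolding reflect_def using y ee assms(2)
        by (subst (1 2 3 4) \<nu>) (simp add: inner_add_left)
      then show ?thesis
        by (simp only: mult_2 scaleR_add_left scaleR_minus_left) simp
    qed
    then show "(\<integral>\<^sup>+t. f (reflect \<nu> (t *\<^sub>R e + y)) \<partial>lborel) = (\<integral>\<^sup>+t. f (t *\<^sub>R e + y) \<partial>lborel)"
      by (subst (2) nn_integral_real_affine[of _ "-1" 0]) auto
  qed
  also have "\<dots> = (\<integral>\<^sup>+x. f x \<partial>lborel)"
    by (rule nn_integral_hyperplane_Fubini[symmetric]) (auto simp: e)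
  finally show ?thesis .
qed

text \<open>A norm-preserving linear map commutes with \<open>sgn\<close> and fixes the punctured
  unit ball, so invariance of the volume passes to the cone measure.\<close>

lemma nn_integral_sphere_isometry:
  fixes g :: "'a::euclidean_space \<Rightarrow> ennreal" and T :: "'a \<Rightarrow> 'a"
  assumes [measurable]: "g \<in> borel_measurable borel" "T \<in> borel_measurable borel"
    and T: "linear T" "\<And>x. norm (T x) = norm x"
    and inv: "\<And>f::'a \<Rightarrow> ennreal. f \<in> borel_measurable borel \<Longrightarrow> (\<integral>\<^sup>+x. f (T x) \<partial>lborel) = (\<integral>\<^sup>+x. f x \<partial>lborel)"
  shows "(\<integral>\<^sup>+w. g (T w) \<partial>sphere_measure) = (\<integral>\<^sup>+w. g w \<partial>sphere_measure)"
proof -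
  have [measurable]: "cball 0 1 - {0::'a} \<in> sets borel" by simp
  define F where "F x = of_nat DIM('a) * indicator (cball 0 1 - {0}) x * g (sgn x)" for x
  have [measurable]: "F \<in> borel_measurable borel"
    unfolding F_def sgn_div_norm by measurable
  have "(\<integral>\<^sup>+w. g (T w) \<partial>sphere_measure) =
      (\<integral>\<^sup>+x. of_nat DIM('a) * indicator (cball 0 1 - {0}) x * g (T (sgn x)) \<partial>lborel)"
    by (rule lborel_hom.nn_integral_cone_measure) measurable
  also have "\<dots> = (\<integral>\<^sup>+x. F (T x) \<partial>lborel)"
  proof (rule nn_integral_cong)
    fix x
    have "T (sgn x) = sgn (T x)"
      by (simp add: sgn_div_norm T linear_scale[OF T(1)])
    moreover have "T x = 0 \<longleftrightarrow> x = 0" using T(2)[of x] by (metis norm_eq_zero)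
    ultimately show "of_nat DIM('a) * indicator (cball 0 1 - {0}) x * g (T (sgn x)) = F (T x)"
      by (simp add: F_def indicator_def T)
  qed
  also have "\<dots> = (\<integral>\<^sup>+x. F x \<partial>lborel)" by (rule inv) measurable
  also have "\<dots> = (\<integral>\<^sup>+w. g w \<partial>sphere_measure)"
    unfolding F_def by (rule lborel_hom.nn_integral_cone_measure[symmetric]) measurable
  finally show ?thesis .
qed

text \<open>The left-hand side is a positive multiple of sin(pi/2 + \<beta> - \<theta>) with tan
  \<beta> = m / \<kappa>, which has a single change of sign on (0, pi), at \<alpha> = pi/2 +
  \<beta>. It locates where a great semicircle leaves the open hemisphere in which it
  starts.\<close>

lemma great_circle_crossing:
  fixes \<kappa> m :: real
  assumes "0 < \<kappa>"
  obtains \<alpha> where "0 < \<alpha>" "\<alpha> < pi" "\<kappa> * cos \<alpha> + m * sin \<alpha> = 0"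
    "\<And>\<theta>. 0 < \<theta> \<Longrightarrow> \<theta> < pi \<Longrightarrow> 0 < \<kappa> * cos \<theta> + m * sin \<theta> \<longleftrightarrow> \<theta> < \<alpha>"
proof -
  define \<beta> where "\<beta> = arctan (m / \<kappa>)"
  have b: "- (pi / 2) < \<beta>" "\<beta> < pi / 2" using arctan_bounded by (auto simp: \<beta>_def)
  then have cb: "0 < cos \<beta>" by (simp add: cos_gt_zero_pi)
  have "tan \<beta> = m / \<kappa>" by (simp add: \<beta>_def tan_arctan)
  then have m: "m = \<kappa> * sin \<beta> / cos \<beta>"
    using assms by (simp add: tan_def field_simps)
  have eq: "\<kappa> * cos \<theta> + m * sin \<theta> = (\<kappa> / cos \<beta>) * sin (pi / 2 + \<beta> - \<theta>)" for \<theta>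
  proof -
    have "sin (pi / 2 + \<beta> - \<theta>) = sin ((\<beta> - \<theta>) + pi / 2)" by (simp add: algebra_simps)
    also have "\<dots> = cos \<beta> * cos \<theta> + sin \<beta> * sin \<theta>" by (simp add: sin_add cos_diff)
    finally show ?thesis using cb by (simp add: m field_simps)
  qed
  show ?thesis
  proof (rule that[of "pi / 2 + \<beta>"])
    show "\<kappa> * cos (pi / 2 + \<beta>) + m * sin (pi / 2 + \<beta>) = 0" by (simp only: eq) simp
    fix \<theta> :: real assume \<theta>: "0 < \<theta>" "\<theta> < pi"
    have "0 < \<kappa> * cos \<theta> + m * sin \<theta> \<longleftrightarrow> 0 < sin (pi / 2 + \<beta> - \<theta>)"
      unfolding eq using assms cb by (simp add: zero_less_mult_iff zero_less_divide_iff)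
    also have "\<dots> \<longleftrightarrow> \<theta> < pi / 2 + \<beta>"
    proof
      show "\<theta> < pi / 2 + \<beta> \<Longrightarrow> 0 < sin (pi / 2 + \<beta> - \<theta>)"
        using b \<theta> by (intro sin_gt_zero) auto
      show "\<theta> < pi / 2 + \<beta>" if "0 < sin (pi / 2 + \<beta> - \<theta>)"
      proof (rule ccontr)
        assume "\<not> \<theta> < pi / 2 + \<beta>"
        then have "0 \<le> sin (\<theta> - (pi / 2 + \<beta>))"
          using b \<theta> by (intro sin_ge_zero) auto
        then show False using that sin_minus[of "\<theta> - (pi / 2 + \<beta>)"] by simp
      qed
    qed
    finally show "0 < \<kappa> * cos \<theta> + m * sin \<theta> \<longleftrightarrow> \<theta> < pi / 2 + \<beta>" .
  qed (use b in auto)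
qed

text \<open>The substitutions \<theta> = 2 \<alpha> t and \<theta> = 2 \<alpha> (1 - t) carry the
  two halves of the parameter interval to the same range of angles, the second one run
  backwards.\<close>

lemma nn_integral_bent_halves:
  fixes f g :: "real \<Rightarrow> ennreal"
  assumes [measurable]: "f \<in> borel_measurable borel" "g \<in> borel_measurable borel" and \<alpha>: "0 < \<alpha>" "0 < r"
  shows "(\<integral>\<^sup>+t. (if t \<le> 1 / 2 then f (2 * \<alpha> * t) else g (2 * \<alpha> * (1 - t))) * ennreal (2 * \<alpha> * r) * indicator {0<..<1} t \<partial>lborel)
     = ennreal r * (\<integral>\<^sup>+\<theta>. (f \<theta> + g \<theta>) * indicator {0<..<\<alpha>} \<theta> \<partial>lborel)"
proof -
  have "(\<integral>\<^sup>+t. (if t \<le> 1 / 2 then f (2 * \<alpha> * t) else g (2 * \<alpha> * (1 - t))) * ennreal (2 * \<alpha> * r) * indicator {0<..<1} t \<partial>lborel)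
      = (\<integral>\<^sup>+t. f (2 * \<alpha> * t) * ennreal (2 * \<alpha> * r) * indicator {0<..<1/2} t +
          g (2 * \<alpha> * (1 - t)) * ennreal (2 * \<alpha> * r) * indicator {1/2<..<1} t \<partial>lborel)"
    by (intro nn_integral_cong_AE AE_I[of _ _ "{1/2}"]) (auto split: split_indicator)
  also have "\<dots> = (\<integral>\<^sup>+t. f (2 * \<alpha> * t) * ennreal (2 * \<alpha> * r) * indicator {0<..<1/2} t \<partial>lborel) +
      (\<integral>\<^sup>+t. g (2 * \<alpha> * (1 - t)) * ennreal (2 * \<alpha> * r) * indicator {1/2<..<1} t \<partial>lborel)"
    by (rule nn_integral_add) measurable
  also have "(\<integral>\<^sup>+t. g (2 * \<alpha> * (1 - t)) * ennreal (2 * \<alpha> * r) * indicator {1/2<..<1} t \<partial>lborel) =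
      (\<integral>\<^sup>+t. g (2 * \<alpha> * t) * ennreal (2 * \<alpha> * r) * indicator {0<..<1/2} t \<partial>lborel)"
    by (subst nn_integral_real_affine[of _ "-1" 1])
       (auto intro!: nn_integral_cong split: split_indicator)
  also have half: "(\<integral>\<^sup>+t. h (2 * \<alpha> * t) * ennreal (2 * \<alpha> * r) * indicator {0<..<1/2} t \<partial>lborel) =
      ennreal r * (\<integral>\<^sup>+\<theta>. h \<theta> * indicator {0<..<\<alpha>} \<theta> \<partial>lborel)"
    if [measurable]: "h \<in> borel_measurable borel" for h :: "real \<Rightarrow> ennreal"
  proof -
    have "(\<integral>\<^sup>+\<theta>. h \<theta> * indicator {0<..<\<alpha>} \<theta> \<partial>lborel) =
        ennreal (2 * \<alpha>) * (\<integral>\<^sup>+t. h (2 * \<alpha> * t) * indicator {0<..<\<alpha>} (2 * \<alpha> * t) \<partial>lborel)"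
      using \<alpha> by (subst nn_integral_real_affine[of _ "2 * \<alpha>" 0]) auto
    also have "(\<lambda>t. h (2 * \<alpha> * t) * indicator {0<..<\<alpha>} (2 * \<alpha> * t)) = (\<lambda>t. h (2 * \<alpha> * t) * indicator {0<..<1/2} t)"
      using \<alpha> by (auto simp: fun_eq_iff zero_less_mult_iff split: split_indicator)
    finally have "ennreal r * (\<integral>\<^sup>+\<theta>. h \<theta> * indicator {0<..<\<alpha>} \<theta> \<partial>lborel) =
        ennreal (2 * \<alpha> * r) * (\<integral>\<^sup>+t. h (2 * \<alpha> * t) * indicator {0<..<1/2} t \<partial>lborel)"
      using \<alpha> by (simp add: ennreal_mult' mult_ac)
    also have "\<dots> = (\<integral>\<^sup>+t. ennreal (2 * \<alpha> * r) * (h (2 * \<alpha> * t) * indicator {0<..<1/2} t) \<partial>lborel)"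
      by (rule nn_integral_cmult[symmetric]) measurable
    finally show ?thesis by (simp add: mult_ac)
  qed
  have "(\<integral>\<^sup>+t. f (2 * \<alpha> * t) * ennreal (2 * \<alpha> * r) * indicator {0<..<1/2} t \<partial>lborel) +
      (\<integral>\<^sup>+t. g (2 * \<alpha> * t) * ennreal (2 * \<alpha> * r) * indicator {0<..<1/2} t \<partial>lborel) =
      ennreal r * (\<integral>\<^sup>+\<theta>. (f \<theta> + g \<theta>) * indicator {0<..<\<alpha>} \<theta> \<partial>lborel)"
    by (simp add: half distrib_left distrib_right nn_integral_add)
  finally show ?thesis .
qed

text \<open>
  The arc runs along a great circle from one endpoint to the hyperplane bisecting both endpoints
  and continues along the mirror image of the first half.
\<close>

lemma bent_arc:
  fixes \<omega>1 \<omega>2 u c :: "'a::euclidean_space"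
  assumes norms: "norm \<omega>1 = 1" "norm \<omega>2 = 1" "\<omega>1 \<noteq> \<omega>2" "norm u = 1" "u \<bullet> \<omega>1 = 0"
    and r: "0 < r" and \<alpha>: "0 < \<alpha>" and cross: "great_circle \<omega>1 u \<alpha> \<bullet> (\<omega>1 - \<omega>2) = 0"
  defines "R \<equiv> reflect (\<omega>1 - \<omega>2)"
  obtains \<gamma> k where "sphere_curve c r (c + r *\<^sub>R \<omega>1) (c + r *\<^sub>R \<omega>2) \<gamma> k"
    "\<And>\<sigma>::'a \<Rightarrow> ennreal. \<sigma> \<in> borel_measurable borel \<Longrightarrow>
       (\<integral>\<^sup>+t. \<sigma> (\<gamma> t) * ennreal k * indicator {0<..<1} t \<partial>lborel) =
       ennreal r * (\<integral>\<^sup>+\<theta>. (\<sigma> (c + r *\<^sub>R great_circle \<omega>1 u \<theta>) + \<sigma> (c + r *\<^sub>R R (great_circle \<omega>1 u \<theta>))) *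
          indicator {0<..<\<alpha>} \<theta> \<partial>lborel)"
proof -
  define G1 where "G1 t = c + r *\<^sub>R great_circle \<omega>1 u (2 * \<alpha> * t)" for t
  define G2 where "G2 t = c + r *\<^sub>R R (great_circle \<omega>1 u (2 * \<alpha> * (1 - t)))" for t
  define \<gamma> where "\<gamma> t = (if t \<le> 1 / 2 then G1 t else G2 t)" for t
  define k where "k = 2 * \<alpha> * r"
  have gc_deriv: "((\<lambda>t. great_circle \<omega>1 u (h t)) has_vector_derivative (h' *\<^sub>R great_circle \<omega>1 u (h t + pi / 2))) (at t)"
    if "(h has_real_derivative h') (at t)" for h h' t
    unfolding great_circle_def
    by (rule derivative_eq_intros that refl)+ (simp add: sin_add cos_add algebra_simps)
  have n1: "norm (great_circle \<omega>1 u \<theta>) = 1" for \<theta> by (rule norm_great_circle) fact+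
  have bR: "bounded_linear R" unfolding R_def by (rule linear_conv_bounded_linear[THEN iffD1, OF linear_reflect])
  have dG1: "(G1 has_vector_derivative (r *\<^sub>R (2 * \<alpha>) *\<^sub>R great_circle \<omega>1 u (2 * \<alpha> * t + pi / 2))) (at t)" for t
    unfolding G1_def
    by (rule derivative_eq_intros gc_deriv refl)+ (auto intro!: derivative_eq_intros)
  have dG2: "(G2 has_vector_derivative (r *\<^sub>R R ((- 2 * \<alpha>) *\<^sub>R great_circle \<omega>1 u (2 * \<alpha> * (1 - t) + pi / 2)))) (at t)" for t
    unfolding G2_def
    by (rule derivative_eq_intros gc_deriv bounded_linear.has_vector_derivative[OF bR] refl)+
       (auto intro!: derivative_eq_intros)
  \<comment> \<open>At the midpoint the angle is \<alpha>, where the point lies on the mirror and is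
    fixed by \<open>R\<close>.\<close>
  have half: "G1 t = G2 t" if "t * 2 = 1" for t
  proof -
    have "t = 1 / 2" using that by simp
    then have "2 * \<alpha> * t = \<alpha>" "2 * \<alpha> * (1 - t) = \<alpha>" by auto
    then show ?thesis using cross by (simp only: G1_def G2_def R_def reflect_id)
  qed
  have "continuous_on ({0..1/2} \<union> {1/2..1}) \<gamma>"
    unfolding \<gamma>_def using dG1 dG2 half
    by (intro continuous_on_If)
       (auto intro!: continuous_at_imp_continuous_on has_vector_derivative_continuous intro: antisym)
  moreover have "{0..1/2} \<union> {1/2..1} = {0..1::real}" by auto
  ultimately have cont: "continuous_on {0..1} \<gamma>" by simp
  have "sphere_curve c r (c + r *\<^sub>R \<omega>1) (c + r *\<^sub>R \<omega>2) \<gamma> k"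
    unfolding sphere_curve_def
  proof (intro conjI ballI)
    show "\<gamma> ` {0..1} \<subseteq> sphere c r"
      using r n1 by (auto simp: \<gamma>_def G1_def G2_def R_def dist_norm)
    show "\<gamma> 0 = c + r *\<^sub>R \<omega>1" by (simp add: \<gamma>_def G1_def great_circle_def)
    show "\<gamma> 1 = c + r *\<^sub>R \<omega>2"
      using reflect_bisector[of \<omega>1 \<omega>2] norms by (simp add: \<gamma>_def G2_def great_circle_def R_def)
    fix t :: real assume t: "t \<in> {0<..<1} - {1 / 2}"
    show "\<exists>d. (\<gamma> has_vector_derivative d) (at t) \<and> norm d = k"
    proof (cases "t < 1 / 2")
      case True
      have "(\<gamma> has_vector_derivative (r *\<^sub>R (2 * \<alpha>) *\<^sub>R great_circle \<omega>1 u (2 * \<alpha> * t + pi / 2))) (at t)"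
        by (rule has_vector_derivative_transform_within_open[OF dG1 open_lessThan[of "1 / 2"]]) (use True in \<open>auto simp: \<gamma>_def\<close>)
      then show ?thesis using r \<alpha> n1 by (auto simp: k_def intro!: exI)
    next
      case False
      then have "t > 1 / 2" using t by auto
      then have "(\<gamma> has_vector_derivative (r *\<^sub>R R ((- 2 * \<alpha>) *\<^sub>R great_circle \<omega>1 u (2 * \<alpha> * (1 - t) + pi / 2)))) (at t)"
        by (intro has_vector_derivative_transform_within_open[OF dG2 open_greaterThan[of "1 / 2"]]) (auto simp: \<gamma>_def)
      then show ?thesis using r \<alpha> n1 by (auto simp: k_def R_def intro!: exI)
    qed
  qed (use r \<alpha> cont in \<open>auto simp: k_def\<close>)
  moreover have "(\<integral>\<^sup>+t. \<sigma> (\<gamma> t) * ennreal k * indicator {0<..<1} t \<partial>lborel) =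
       ennreal r * (\<integral>\<^sup>+\<theta>. (\<sigma> (c + r *\<^sub>R great_circle \<omega>1 u \<theta>) + \<sigma> (c + r *\<^sub>R R (great_circle \<omega>1 u \<theta>))) *
          indicator {0<..<\<alpha>} \<theta> \<partial>lborel)" if [measurable]: "\<sigma> \<in> borel_measurable borel" for \<sigma> :: "'a \<Rightarrow> ennreal"
  proof -
    have "(\<integral>\<^sup>+t. \<sigma> (\<gamma> t) * ennreal k * indicator {0<..<1} t \<partial>lborel) =
      (\<integral>\<^sup>+t. (if t \<le> 1 / 2 then \<sigma> (c + r *\<^sub>R great_circle \<omega>1 u (2 * \<alpha> * t))
         else \<sigma> (c + r *\<^sub>R R (great_circle \<omega>1 u (2 * \<alpha> * (1 - t))))) * ennreal (2 * \<alpha> * r) * indicator {0<..<1} t \<partial>lborel)"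
      by (intro nn_integral_cong) (simp add: \<gamma>_def G1_def G2_def k_def)
    also have "\<dots> = ennreal r * (\<integral>\<^sup>+\<theta>. (\<sigma> (c + r *\<^sub>R great_circle \<omega>1 u \<theta>) + \<sigma> (c + r *\<^sub>R R (great_circle \<omega>1 u \<theta>))) *
          indicator {0<..<\<alpha>} \<theta> \<partial>lborel)"
      by (rule nn_integral_bent_halves) (use \<alpha> r in \<open>auto simp: great_circle_def R_def\<close>)
    finally show ?thesis .
  qed
  ultimately show ?thesis by (rule that)
qed

text \<open>Tangent-line form of Young's inequality at \<open>k = S powr p / y\<close>, the extremal density.\<close>

lemma young_extremal:
  fixes s :: ennreal and S y :: real
  assumes n: "2 \<le> n" and S: "0 < S" and y: "0 < y"
  defines "p \<equiv> (2 - real n) / (real n - 1)"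
  shows "ennreal (real n / y ^ (n - 1)) * s \<le>
      s ^ n * ennreal (S ^ (n - 2)) + ennreal ((real n - 1) / y ^ n * S powr p)"
proof (cases s)
  case top
  then show ?thesis using n S by (simp add: ennreal_top_mult top_power_ennreal)
next
  case (real x)
  define k where "k = S powr p / y"
  have k: "0 < k" using S y by (simp add: k_def)
  \<comment> \<open>The exponent \<open>p\<close> is designed for this: k^(n-1) S^(n-2) no longer
    depends on S, so the coefficient of s is the same at every angle.\<close>
  have "(S powr p) ^ (n - 1) = S powr (p * real (n - 1))"
    using S by (simp add: powr_realpow[symmetric] powr_powr)
  also have "p * real (n - 1) = - real (n - 2)"
    using n by (simp add: p_def of_nat_diff)
  also have "S powr (- real (n - 2)) = 1 / S ^ (n - 2)"
    using S by (simp add: powr_minus powr_realpow divide_inverse)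
  finally have k1: "k ^ (n - 1) * S ^ (n - 2) = 1 / y ^ (n - 1)"
    using S by (simp add: k_def power_divide)
  have nn: "n = Suc (n - 1)" using n by simp
  have kn: "k ^ n * S ^ (n - 2) = S powr p / y ^ n"
  proof -
    have "k ^ n * S ^ (n - 2) = k * (k ^ (n - 1) * S ^ (n - 2))"
      by (subst nn) simp
    also have "\<dots> = S powr p / (y * y ^ (n - 1))" unfolding k1 by (simp add: k_def)
    also have "y * y ^ (n - 1) = y ^ n" by (subst (2) nn) simp
    finally show ?thesis .
  qed
  \<comment> \<open>Bernoulli at x/k - 1 \<ge> -1 says that x^n lies above its tangent at x =
    k.\<close>
  have "1 + real n * (x / k - 1) \<le> (1 + (x / k - 1)) ^ n"
    using real k by (intro Bernoulli_inequality) simp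
  then have "(1 + real n * (x / k - 1)) * k ^ n \<le> (x / k) ^ n * k ^ n"
    using k by (intro mult_right_mono) auto
  moreover have "(x / k) ^ n * k ^ n = x ^ n" using k by (simp add: power_divide)
  moreover have "(1 + real n * (x / k - 1)) * k ^ n = real n * x * k ^ (n - 1) - (real n - 1) * k ^ n"
    using k by (subst (2 4) nn) (simp add: field_simps)
  ultimately have "real n * x * k ^ (n - 1) \<le> x ^ n + (real n - 1) * k ^ n" by simp
  then have "real n * x * k ^ (n - 1) * S ^ (n - 2) \<le> (x ^ n + (real n - 1) * k ^ n) * S ^ (n - 2)"
    using S by (intro mult_right_mono) auto
  then have "real n * x * (k ^ (n - 1) * S ^ (n - 2)) \<le> x ^ n * S ^ (n - 2) + (real n - 1) * (k ^ n * S ^ (n - 2))"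
    by (simp add: algebra_simps)
  then have "real n / y ^ (n - 1) * x \<le> x ^ n * S ^ (n - 2) + (real n - 1) / y ^ n * S powr p"
    unfolding k1 kn by simp
  then show ?thesis
    using real S y n
    by (simp add: ennreal_power ennreal_mult'[symmetric] ennreal_plus[symmetric] ennreal_leI del: ennreal_plus)
qed

lemma emeasure_equator_measure:
  fixes e :: "'a::euclidean_space"
  assumes e: "norm e = 1" and dim: "2 \<le> DIM('a)"
  shows "emeasure (equator_measure e) UNIV = ennreal (unit_sphere_area (DIM('a) - 2))"
proof -
  interpret H: homogeneous_measure "hyperplane_measure e" "DIM('a) - 1"
    by (rule hyperplane_homogeneous_measure[OF e dim])
  have eq: "DIM('a) - 2 + 1 = DIM('a) - 1" using dim by simp
  have "emeasure H.cone_measure UNIV = of_nat (DIM('a) - 1) * ennreal (unit_ball_vol (real (DIM('a) - 1)))"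
    unfolding H.emeasure_cone_measure emeasure_hyperplane_unit_ball[OF e dim] ..
  then show ?thesis
    unfolding unit_sphere_area_def eq by (simp only: ennreal_of_nat_eq_real_of_nat ennreal_mult' of_nat_0_le_iff)
qed

section \<open>Lower bounds on spheres and shells\<close>

text \<open>For every direction \<open>u\<close> at \<open>\<omega>1\<close> the bent arc gives 1
  \<le> r times an integral over (0, \<alpha>), with \<alpha> depending on \<open>u\<close>. Young's
  inequality with y = I r turns this into n-th powers of \<sigma> plus a weight term. After
  averaging over the equator the n-th powers are bounded by the integral over the whole sphere, and
  the weight over a hemisphere by half of its total I A.\<close>

lemma sphere_lower_bound:
  fixes \<sigma> :: "'a::euclidean_space \<Rightarrow> ennreal" and c \<omega>1 \<omega>2 :: 'a
  defines "n \<equiv> DIM('a)"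
  defines "p \<equiv> (2 - real n) / (real n - 1)"
  assumes \<sigma> [measurable]: "\<sigma> \<in> borel_measurable borel" and dim: "2 \<le> n"
    and norms: "norm \<omega>1 = 1" "norm \<omega>2 = 1" "\<omega>1 \<noteq> \<omega>2" and r: "0 < r" and I: "0 < I"
    and I_eq: "(\<integral>\<^sup>+\<theta>. ennreal (sin \<theta> powr p) * indicator {0<..<pi} \<theta> \<partial>lborel) = ennreal I"
    and curves: "\<And>\<gamma> k. sphere_curve c r (c + r *\<^sub>R \<omega>1) (c + r *\<^sub>R \<omega>2) \<gamma> k \<Longrightarrow>
       1 \<le> (\<integral>\<^sup>+t. \<sigma> (\<gamma> t) * ennreal k * indicator {0<..<1} t \<partial>lborel)"
  shows "ennreal (unit_sphere_area (n - 2) / (I ^ (n - 1) * r ^ n)) \<le>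
    (\<integral>\<^sup>+w. \<sigma> (c + r *\<^sub>R w) ^ n \<partial>sphere_measure)"
proof -
  note dim' = dim[unfolded n_def]
  interpret Hyp: homogeneous_measure "hyperplane_measure \<omega>1" "DIM('a) - 1"
    by (rule hyperplane_homogeneous_measure[OF norms(1) dim'])
  define \<nu> where "\<nu> = \<omega>1 - \<omega>2"
  have \<nu>: "\<nu> \<noteq> 0" using norms by (simp add: \<nu>_def)
  define R where "R = reflect \<nu>"
  have [measurable]: "R \<in> borel_measurable borel" by (simp add: R_def)
  define H :: "'a set" where "H = {w. 0 < w \<bullet> \<nu>}"
  have [measurable]: "H \<in> sets borel" unfolding H_def by measurable
  \<comment> \<open>\<open>W\<close> must equal sin^(p-(n-2)) in terms of the angle from
    \<open>\<omega>1\<close>, so that the polar density sin^(n-2) turns it into sin^p. The exponent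
    is halved because 1 - (w \<bullet> \<omega>1)^2 is sin^2.\<close>
  define q where "q = (p - real (n - 2)) / 2"
  define W where "W w = ennreal ((1 - (w \<bullet> \<omega>1)\<^sup>2) powr q)" for w
  have [measurable]: "W \<in> borel_measurable borel" unfolding W_def by measurable
  define G where "G w = \<sigma> (c + r *\<^sub>R w) ^ n" for w
  have [measurable]: "G \<in> borel_measurable borel" unfolding G_def by measurable
  \<comment> \<open>The sphere is folded along the mirror: \<open>G w\<close> belongs to the first
    half of an arc and \<open>G (R w)\<close> to its mirror image.\<close>
  define g1 where "g1 w = indicator H w * (G w + G (R w))" for w
  have [measurable]: "g1 \<in> borel_measurable borel" unfolding g1_def by measurable
  define g2 where "g2 w = indicator H w * W w" for w
  have [measurable]: "g2 \<in> borel_measurable borel" unfolding g2_def by measurable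
  define A where "A = unit_sphere_area (n - 2)"
  have A: "0 \<le> A" by (simp add: A_def unit_sphere_area_def)
  define X where "X = (\<integral>\<^sup>+w. G w \<partial>sphere_measure)"
  define polar where "polar g u = (\<integral>\<^sup>+\<theta>. g (great_circle \<omega>1 u \<theta>) * ennreal (sin \<theta> ^ (n - 2)) * indicator {0<..<pi} \<theta> \<partial>lborel)"
    for g :: "'a \<Rightarrow> ennreal" and u
  have polar: "(\<integral>\<^sup>+w. g w \<partial>sphere_measure) = (\<integral>\<^sup>+u. polar g u \<partial>equator_measure \<omega>1)"
    if "g \<in> borel_measurable borel" for g
    unfolding polar_def n_def by (rule nn_integral_sphere_polar[OF that norms(1) dim'])
  have [measurable]: "polar g \<in> borel_measurable borel" if [measurable]: "g \<in> borel_measurable borel" for g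
    unfolding polar_def great_circle_def by measurable
  have mass: "emeasure (equator_measure \<omega>1) UNIV = ennreal A"
    unfolding A_def n_def by (rule emeasure_equator_measure[OF norms(1) dim'])
  have const: "(\<integral>\<^sup>+u. C \<partial>equator_measure \<omega>1) = C * ennreal A" for C :: ennreal
    using mass sets_eq_imp_space_eq[OF Hyp.sets_cone_measure] by simp
  have W_polar: "W (great_circle \<omega>1 u \<theta>) * ennreal (sin \<theta> ^ (n - 2)) = ennreal (sin \<theta> powr p)"
    if u: "norm u = 1" "u \<bullet> \<omega>1 = 0" and \<theta>: "0 < \<theta>" "\<theta> < pi" for u \<theta>
  proof -
    have s: "0 < sin \<theta>" using \<theta> by (rule sin_gt_zero)
    have "\<omega>1 \<bullet> \<omega>1 = 1" using norms by (simp add: norm_eq_1)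
    then have "great_circle \<omega>1 u \<theta> \<bullet> \<omega>1 = cos \<theta>"
      using u by (simp add: great_circle_def inner_add_left)
    then have "1 - (great_circle \<omega>1 u \<theta> \<bullet> \<omega>1)\<^sup>2 = sin \<theta> powr 2"
      using s by (simp add: sin_squared_eq powr_numeral)
    then have "(1 - (great_circle \<omega>1 u \<theta> \<bullet> \<omega>1)\<^sup>2) powr q * sin \<theta> ^ (n - 2) = sin \<theta> powr (2 * q) * sin \<theta> powr real (n - 2)"
      using s by (simp only: powr_powr powr_realpow)
    also have "\<dots> = sin \<theta> powr (2 * q + real (n - 2))"
      by (rule powr_add[symmetric])
    also have "2 * q + real (n - 2) = p"
      by (simp add: q_def field_simps)
    finally show ?thesis
      unfolding W_def using s by (simp add: ennreal_mult'[symmetric])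
  qed
  \<comment> \<open>Unfolding by the invariance of area under \<open>R\<close>: \<open>H\<close> and
    its mirror image are disjoint.\<close>
  have g1_le: "(\<integral>\<^sup>+w. g1 w \<partial>sphere_measure) \<le> X"
  proof -
    have "(\<integral>\<^sup>+w. g1 w \<partial>sphere_measure) = (\<integral>\<^sup>+w. indicator H w * G w \<partial>sphere_measure) + (\<integral>\<^sup>+w. indicator H w * G (R w) \<partial>sphere_measure)"
      unfolding g1_def distrib_left by (rule nn_integral_add) measurable
    also have "(\<integral>\<^sup>+w. indicator H w * G (R w) \<partial>sphere_measure) = (\<integral>\<^sup>+w. indicator H (R (R w)) * G (R w) \<partial>sphere_measure)"
      by (simp add: R_def)
    also have "\<dots> = (\<integral>\<^sup>+w. indicator H (R w) * G w \<partial>sphere_measure)"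
      by (rule nn_integral_sphere_isometry[where g = "\<lambda>w. indicator H (R w) * G w"])
         (auto simp: R_def linear_reflect nn_integral_lborel_reflect \<nu>)
    also have "(\<integral>\<^sup>+w. indicator H w * G w \<partial>sphere_measure) + \<dots> = (\<integral>\<^sup>+w. indicator H w * G w + indicator H (R w) * G w \<partial>sphere_measure)"
      by (rule nn_integral_add[symmetric]) measurable
    also have "\<dots> \<le> X"
      unfolding X_def by (intro nn_integral_mono) (auto simp: H_def R_def inner_reflect_normal split: split_indicator)
    finally show ?thesis .
  qed
  \<comment> \<open>\<open>W\<close> is even and \<open>H\<close> is disjoint from its antipodal
    set. This is the point at which the dependence of \<alpha> on \<open>u\<close>, and so the
    position of the second endpoint, drops out.\<close>
  have g2_le: "2 * (\<integral>\<^sup>+w. g2 w \<partial>sphere_measure) \<le> ennreal I * ennreal A"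
  proof -
    have neg: "(\<integral>\<^sup>+w. g2 (- w) \<partial>sphere_measure) = (\<integral>\<^sup>+w. g2 w \<partial>sphere_measure)"
    proof (rule nn_integral_sphere_isometry)
      show "(\<integral>\<^sup>+x. f (- x) \<partial>lborel) = (\<integral>\<^sup>+x. f x \<partial>lborel)" if "f \<in> borel_measurable borel" for f :: "'a \<Rightarrow> ennreal"
        using nn_integral_lborel_affine[OF that, of "-1" 0] by simp
    qed (auto intro!: linearI)
    have "2 * (\<integral>\<^sup>+w. g2 w \<partial>sphere_measure) = (\<integral>\<^sup>+w. g2 w \<partial>sphere_measure) + (\<integral>\<^sup>+w. g2 (- w) \<partial>sphere_measure)"
      by (simp add: neg mult_2)
    also have "\<dots> = (\<integral>\<^sup>+w. g2 w + g2 (- w) \<partial>sphere_measure)"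
      by (rule nn_integral_add[symmetric]) measurable
    also have "\<dots> \<le> (\<integral>\<^sup>+w. W w \<partial>sphere_measure)"
      by (intro nn_integral_mono) (auto simp: g2_def W_def H_def split: split_indicator)
    also have "\<dots> = (\<integral>\<^sup>+u. polar W u \<partial>equator_measure \<omega>1)"
      by (rule polar) measurable
    also have "\<dots> = (\<integral>\<^sup>+u. ennreal I \<partial>equator_measure \<omega>1)"
    proof (rule nn_integral_cong_AE, use AE_equator_measure[OF norms(1) dim'] in eventually_elim)
      fix u assume u: "norm u = 1 \<and> u \<bullet> \<omega>1 = 0"
      have "polar W u = (\<integral>\<^sup>+\<theta>. ennreal (sin \<theta> powr p) * indicator {0<..<pi} \<theta> \<partial>lborel)"
        unfolding polar_def using u by (intro nn_integral_cong) (auto simp: W_polar split: split_indicator)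
      then show "polar W u = ennreal I" by (simp add: I_eq)
    qed
    also have "\<dots> = ennreal I * ennreal A" by (rule const)
    finally show ?thesis .
  qed
  \<comment> \<open>The coefficients of Young's inequality at y = I r, with \<open>K\<close> already
    divided by the r in front of the arc integral. With this y, D I is exactly (n-1)/n of K.\<close>
  define K where "K = real n / ((I * r) ^ (n - 1) * r)"
  define D where "D = (real n - 1) / (I * r) ^ n"
  have Dpos: "0 \<le> D" using dim I r by (simp add: D_def)
  have Kpos: "0 \<le> K" using I r by (simp add: K_def)
  have "ennreal K * ennreal A = (\<integral>\<^sup>+u. ennreal K \<partial>equator_measure \<omega>1)"
    by (rule const[symmetric])
  also have "\<dots> \<le> (\<integral>\<^sup>+u. polar g1 u + ennreal (2 * D) * polar g2 u \<partial>equator_measure \<omega>1)"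
  proof (rule nn_integral_mono_AE, use AE_equator_measure[OF norms(1) dim'] in eventually_elim)
    fix u assume u': "norm u = 1 \<and> u \<bullet> \<omega>1 = 0"
    then have u: "norm u = 1" "u \<bullet> \<omega>1 = 0" by auto
    \<comment> \<open>The first endpoint is strictly on the positive side of the mirror, so each
      semicircle from it starts in \<open>H\<close> and leaves it at one angle \<alpha> <
      pi.\<close>
    have "(\<omega>1 - \<omega>2) \<bullet> (\<omega>1 - \<omega>2) = 2 * (\<omega>1 \<bullet> \<nu>)"
      using norms by (simp add: \<nu>_def norm_eq_1 inner_diff_left inner_diff_right inner_commute)
    moreover have "0 < (\<omega>1 - \<omega>2) \<bullet> (\<omega>1 - \<omega>2)" using norms by simp
    ultimately have "0 < \<omega>1 \<bullet> \<nu>" by simp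
    then obtain \<alpha> where \<alpha>: "0 < \<alpha>" "\<alpha> < pi" "(\<omega>1 \<bullet> \<nu>) * cos \<alpha> + (u \<bullet> \<nu>) * sin \<alpha> = 0"
      "\<And>\<theta>. 0 < \<theta> \<Longrightarrow> \<theta> < pi \<Longrightarrow> 0 < (\<omega>1 \<bullet> \<nu>) * cos \<theta> + (u \<bullet> \<nu>) * sin \<theta> \<longleftrightarrow> \<theta> < \<alpha>"
      using great_circle_crossing[of "\<omega>1 \<bullet> \<nu>" "u \<bullet> \<nu>"] by blast
    have gc: "great_circle \<omega>1 u \<theta> \<bullet> \<nu> = (\<omega>1 \<bullet> \<nu>) * cos \<theta> + (u \<bullet> \<nu>) * sin \<theta>" for \<theta>
      by (simp add: great_circle_def inner_add_left mult.commute)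
    have cross: "great_circle \<omega>1 u \<alpha> \<bullet> (\<omega>1 - \<omega>2) = 0" using \<alpha>(3) gc by (simp add: \<nu>_def)
    obtain \<gamma> k where \<gamma>1: "sphere_curve c r (c + r *\<^sub>R \<omega>1) (c + r *\<^sub>R \<omega>2) \<gamma> k"
      and arcs: "\<And>\<sigma>::'a \<Rightarrow> ennreal. \<sigma> \<in> borel_measurable borel \<Longrightarrow>
       (\<integral>\<^sup>+t. \<sigma> (\<gamma> t) * ennreal k * indicator {0<..<1} t \<partial>lborel) =
       ennreal r * (\<integral>\<^sup>+\<theta>. (\<sigma> (c + r *\<^sub>R great_circle \<omega>1 u \<theta>) +
          \<sigma> (c + r *\<^sub>R reflect (\<omega>1 - \<omega>2) (great_circle \<omega>1 u \<theta>))) * indicator {0<..<\<alpha>} \<theta> \<partial>lborel)"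
      by (rule bent_arc[OF norms u r \<alpha>(1) cross, where c = c]) (rule that)
    note \<gamma>2 = arcs[OF \<sigma>, folded \<nu>_def, folded R_def]
    define s1 where "s1 \<theta> = \<sigma> (c + r *\<^sub>R great_circle \<omega>1 u \<theta>)" for \<theta>
    define s2 where "s2 \<theta> = \<sigma> (c + r *\<^sub>R R (great_circle \<omega>1 u \<theta>))" for \<theta>
    have [measurable]: "s1 \<in> borel_measurable borel" "s2 \<in> borel_measurable borel"
      unfolding s1_def s2_def great_circle_def by measurable
    define C where "C = real n / (I * r) ^ (n - 1)"
    have C: "0 \<le> C" using I r by (simp add: C_def)
    have "1 \<le> ennreal r * (\<integral>\<^sup>+\<theta>. (s1 \<theta> + s2 \<theta>) * indicator {0<..<\<alpha>} \<theta> \<partial>lborel)"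
      using curves[OF \<gamma>1] unfolding \<gamma>2 s1_def s2_def .
    then have "ennreal (C / r) * 1 \<le> ennreal (C / r) * (ennreal r * (\<integral>\<^sup>+\<theta>. (s1 \<theta> + s2 \<theta>) * indicator {0<..<\<alpha>} \<theta> \<partial>lborel))"
      by (rule mult_left_mono) simp
    also have "\<dots> = ennreal C * (\<integral>\<^sup>+\<theta>. (s1 \<theta> + s2 \<theta>) * indicator {0<..<\<alpha>} \<theta> \<partial>lborel)"
      using r C by (simp add: mult.assoc[symmetric] ennreal_mult'[symmetric])
    also have "\<dots> = (\<integral>\<^sup>+\<theta>. ennreal C * ((s1 \<theta> + s2 \<theta>) * indicator {0<..<\<alpha>} \<theta>) \<partial>lborel)"
      by (rule nn_integral_cmult[symmetric]) measurable
    also have "\<dots> \<le> (\<integral>\<^sup>+\<theta>. g1 (great_circle \<omega>1 u \<theta>) * ennreal (sin \<theta> ^ (n - 2)) * indicator {0<..<pi} \<theta> +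
        ennreal (2 * D) * (g2 (great_circle \<omega>1 u \<theta>) * ennreal (sin \<theta> ^ (n - 2)) * indicator {0<..<pi} \<theta>) \<partial>lborel)"
    proof (rule nn_integral_mono)
      fix \<theta> :: real
      show "ennreal C * ((s1 \<theta> + s2 \<theta>) * indicator {0<..<\<alpha>} \<theta>) \<le>
        g1 (great_circle \<omega>1 u \<theta>) * ennreal (sin \<theta> ^ (n - 2)) * indicator {0<..<pi} \<theta> +
        ennreal (2 * D) * (g2 (great_circle \<omega>1 u \<theta>) * ennreal (sin \<theta> ^ (n - 2)) * indicator {0<..<pi} \<theta>)"
      proof (cases "\<theta> \<in> {0<..<\<alpha>}")
        case True
        then have \<theta>: "0 < \<theta>" "\<theta> < pi" "\<theta> < \<alpha>" using \<alpha>(2) by auto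
        have s: "0 < sin \<theta>" using \<theta> by (intro sin_gt_zero)
        have inH: "great_circle \<omega>1 u \<theta> \<in> H"
          using \<alpha>(4)[OF \<theta>(1,2)] \<theta>(3) by (simp add: H_def gc)
        have "ennreal C * (s1 \<theta> + s2 \<theta>) = ennreal C * s1 \<theta> + ennreal C * s2 \<theta>"
          by (rule distrib_left)
        also have "\<dots> \<le> (s1 \<theta> ^ n * ennreal (sin \<theta> ^ (n - 2)) + ennreal (D * sin \<theta> powr p)) +
            (s2 \<theta> ^ n * ennreal (sin \<theta> ^ (n - 2)) + ennreal (D * sin \<theta> powr p))"
          unfolding C_def D_def p_def using dim I r s by (intro add_mono young_extremal) auto
        also have "\<dots> = (s1 \<theta> ^ n + s2 \<theta> ^ n) * ennreal (sin \<theta> ^ (n - 2)) + ennreal (2 * D) * ennreal (sin \<theta> powr p)"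
        proof -
          have "ennreal (D * sin \<theta> powr p) + ennreal (D * sin \<theta> powr p) = ennreal (2 * D) * ennreal (sin \<theta> powr p)"
            using Dpos by (simp add: ennreal_mult'[symmetric] ennreal_plus[symmetric] del: ennreal_plus)
          then show ?thesis by (simp add: distrib_right add_ac)
        qed
        also have "\<dots> = g1 (great_circle \<omega>1 u \<theta>) * ennreal (sin \<theta> ^ (n - 2)) +
            ennreal (2 * D) * (g2 (great_circle \<omega>1 u \<theta>) * ennreal (sin \<theta> ^ (n - 2)))"
          using inH W_polar[OF u \<theta>(1,2)] by (simp add: g1_def g2_def G_def s1_def s2_def)
        finally show ?thesis using True \<theta> by simp
      qed simp
    qed
    also have "\<dots> = polar g1 u + ennreal (2 * D) * polar g2 u"
      unfolding polar_def great_circle_def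
      by (subst nn_integral_add, measurable, subst nn_integral_cmult) auto
    finally show "ennreal K \<le> polar g1 u + ennreal (2 * D) * polar g2 u"
      by (simp add: K_def C_def)
  qed
  also have "\<dots> = (\<integral>\<^sup>+u. polar g1 u \<partial>equator_measure \<omega>1) + ennreal (2 * D) * (\<integral>\<^sup>+u. polar g2 u \<partial>equator_measure \<omega>1)"
    by (subst nn_integral_add, measurable, subst nn_integral_cmult, measurable)
  also have "\<dots> = (\<integral>\<^sup>+w. g1 w \<partial>sphere_measure) + ennreal (2 * D) * (\<integral>\<^sup>+w. g2 w \<partial>sphere_measure)"
    by (simp add: polar)
  also have "ennreal (2 * D) * (\<integral>\<^sup>+w. g2 w \<partial>sphere_measure) = ennreal D * (2 * (\<integral>\<^sup>+w. g2 w \<partial>sphere_measure))"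
    using Dpos by (simp add: ennreal_mult' mult_ac)
  also have "(\<integral>\<^sup>+w. g1 w \<partial>sphere_measure) + \<dots> \<le> X + ennreal D * (ennreal I * ennreal A)"
    by (intro add_mono mult_left_mono g1_le g2_le) simp
  finally have main: "ennreal (K * A) \<le> X + ennreal (D * I * A)"
    using A I Dpos Kpos by (simp add: ennreal_mult' mult.assoc)
  show ?thesis
  proof (cases X)
    case (real x)
    then have "K * A \<le> x + D * I * A"
      using main A I Dpos by (simp add: ennreal_plus[symmetric] del: ennreal_plus)
    moreover have "(I * r) ^ n = I * r * (I * r) ^ (n - 1)" using dim by (cases n) auto
    then have "D * I = (real n - 1) / ((I * r) ^ (n - 1) * r)"
      using I r by (simp add: D_def)
    \<comment> \<open>Of the n in \<open>K\<close>, the weight term consumes n - 1 and exactly one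
      is left.\<close>
    then have "K * A - D * I * A = (real n - (real n - 1)) / ((I * r) ^ (n - 1) * r) * A"
      by (simp only: K_def diff_divide_distrib left_diff_distrib)
    then have "K * A - D * I * A = A / ((I * r) ^ (n - 1) * r)"
      by simp
    moreover have "(I * r) ^ (n - 1) * r = I ^ (n - 1) * r ^ n"
      using dim by (cases n) (auto simp: power_mult_distrib)
    ultimately show ?thesis
      using real by (simp add: A_def[symmetric] X_def[symmetric, unfolded G_def] ennreal_leI)
  qed (simp add: X_def G_def)
qed

text \<open>The polar weight r^(n-1) turns the sphere bound of order r^(-n) into a multiple of 1/r,
  whose integral is the logarithm. A single radius \<rho> is a null set; it is reserved for the
  sphere on which the chart may break down.\<close>

lemma shell_lower_bound:
  fixes \<sigma> :: "'a::euclidean_space \<Rightarrow> ennreal" and c :: 'a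
  defines "n \<equiv> DIM('a)"
  defines "p \<equiv> (2 - real n) / (real n - 1)"
  assumes \<sigma> [measurable]: "\<sigma> \<in> borel_measurable borel" and dim: "2 \<le> n"
    and r01: "0 < r0" "r0 \<le> r1" and I: "0 < I"
    and I_eq: "(\<integral>\<^sup>+\<theta>. ennreal (sin \<theta> powr p) * indicator {0<..<pi} \<theta> \<partial>lborel) = ennreal I"
    and curves: "\<And>r. r \<in> {r0<..<r1} - {\<rho>} \<Longrightarrow> \<exists>e\<in>sphere c r. \<exists>f\<in>sphere c r. e \<noteq> f \<and>
       (\<forall>\<gamma> k. sphere_curve c r e f \<gamma> k \<longrightarrow> 1 \<le> (\<integral>\<^sup>+t. \<sigma> (\<gamma> t) * ennreal k * indicator {0<..<1} t \<partial>lborel))"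
  shows "ennreal (unit_sphere_area (n - 2) / I ^ (n - 1) * ln (r1 / r0)) \<le> (\<integral>\<^sup>+x. \<sigma> x ^ n \<partial>lborel)"
proof -
  define A where "A = unit_sphere_area (n - 2)"
  have A: "0 \<le> A" by (simp add: A_def unit_sphere_area_def)
  define B where "B = A / I ^ (n - 1)"
  have B: "0 \<le> B" using A I by (simp add: B_def)
  have "ennreal (B * ln (r1 / r0)) = ennreal (B * ln r1 - B * ln r0)"
    using r01 by (simp add: ln_div algebra_simps)
  also have "\<dots> = (\<integral>\<^sup>+r. ennreal (B / r) * indicator {r0..r1} r \<partial>lborel)"
    using r01 B by (intro nn_integral_FTC_Icc[symmetric]) (auto intro!: derivative_eq_intros)
  also have "\<dots> = (\<integral>\<^sup>+r. ennreal (B / r) * indicator ({r0<..<r1} - {\<rho>}) r \<partial>lborel)"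
    by (intro nn_integral_cong_AE AE_I[of _ _ "{r0, r1, \<rho>}"])
       (auto simp: emeasure_lborel_countable split: split_indicator)
  also have "\<dots> \<le> (\<integral>\<^sup>+r. ennreal (r ^ (n - 1)) * indicator {0<..} r * (\<integral>\<^sup>+w. \<sigma> (c + r *\<^sub>R w) ^ n \<partial>sphere_measure) \<partial>lborel)"
  proof (rule nn_integral_mono)
    fix r
    show "ennreal (B / r) * indicator ({r0<..<r1} - {\<rho>}) r \<le>
      ennreal (r ^ (n - 1)) * indicator {0<..} r * (\<integral>\<^sup>+w. \<sigma> (c + r *\<^sub>R w) ^ n \<partial>sphere_measure)"
    proof (cases "r \<in> {r0<..<r1} - {\<rho>}")
      case True
      then have r: "0 < r" using r01 by auto
      obtain e f where ef: "e \<in> sphere c r" "f \<in> sphere c r" "e \<noteq> f"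
        and cv: "\<And>\<gamma> k. sphere_curve c r e f \<gamma> k \<Longrightarrow> 1 \<le> (\<integral>\<^sup>+t. \<sigma> (\<gamma> t) * ennreal k * indicator {0<..<1} t \<partial>lborel)"
        using curves[OF True] by blast
      have e: "c + r *\<^sub>R ((e - c) /\<^sub>R r) = e" "c + r *\<^sub>R ((f - c) /\<^sub>R r) = f"
        using r by simp_all
      have "ennreal (A / (I ^ (n - 1) * r ^ n)) \<le> (\<integral>\<^sup>+w. \<sigma> (c + r *\<^sub>R w) ^ n \<partial>sphere_measure)"
        unfolding A_def n_def
      proof (rule sphere_lower_bound[of _ "(e - c) /\<^sub>R r" "(f - c) /\<^sub>R r"])
        show "norm ((e - c) /\<^sub>R r) = 1" "norm ((f - c) /\<^sub>R r) = 1"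
          using ef r by (auto simp: dist_norm norm_minus_commute)
        show "(e - c) /\<^sub>R r \<noteq> (f - c) /\<^sub>R r" using ef r by simp
      qed (use dim I I_eq r cv in \<open>auto simp: n_def p_def e\<close>)
      then have "ennreal (r ^ (n - 1)) * ennreal (A / (I ^ (n - 1) * r ^ n)) \<le>
          ennreal (r ^ (n - 1)) * (\<integral>\<^sup>+w. \<sigma> (c + r *\<^sub>R w) ^ n \<partial>sphere_measure)"
        by (rule mult_left_mono) simp
      moreover have "r ^ n = r ^ (n - 1) * r" using dim by (cases n) auto
      then have "r ^ (n - 1) * (A / (I ^ (n - 1) * r ^ n)) = B / r"
        using r by (simp add: B_def)
      then have "ennreal (r ^ (n - 1)) * ennreal (A / (I ^ (n - 1) * r ^ n)) = ennreal (B / r)"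
        using r by (simp only: ennreal_mult'[symmetric] zero_le_power less_imp_le)
      ultimately show ?thesis using True r by simp
    qed simp
  qed
  also have "\<dots> = (\<integral>\<^sup>+x. \<sigma> (c + x) ^ n \<partial>lborel)"
    unfolding n_def by (rule lborel_hom.nn_integral_polar[symmetric]) measurable
  also have "\<dots> = (\<integral>\<^sup>+x. \<sigma> x ^ n \<partial>lborel)"
    using nn_integral_lborel_affine[of "\<lambda>x. \<sigma> x ^ n" 1 c] by simp
  finally show ?thesis by (simp add: A_def B_def)
qed

text \<open>
  If the integral in the definition of the constant diverged, \<^const>\<open>integral\<close> would return the
  junk value \<open>0\<close> and the constant would vanish, so its convergence need not be proved.
\<close>

lemma ring_const_cases:
  fixes n :: nat
  assumes n: "2 \<le> n"
  defines "p \<equiv> (2 - real n) / (real n - 1)"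
  obtains "ring_const n = 0"
  | I where "0 < I" "(\<integral>\<^sup>+\<theta>. ennreal (sin \<theta> powr p) * indicator {0<..<pi} \<theta> \<partial>lborel) = ennreal I"
      "ring_const n = unit_sphere_area (n - 2) / I ^ (n - 1)"
proof -
  define f where "f \<theta> = sin \<theta> powr p * indicator {0..pi / 2} \<theta>" for \<theta> :: real
  have [measurable]: "f \<in> borel_measurable borel" unfolding f_def by measurable
  have fint: "(f has_integral i) UNIV \<longleftrightarrow> ((\<lambda>\<theta>. sin \<theta> powr p) has_integral i) {0..pi / 2}" for i
  proof -
    have "f = (\<lambda>\<theta>. if \<theta> \<in> {0..pi / 2} then sin \<theta> powr p else 0)"
      by (auto simp: f_def fun_eq_iff)
    then show ?thesis by (simp only: has_integral_restrict_UNIV)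
  qed
  have p: "p \<le> 0" using n by (simp add: p_def divide_nonpos_nonneg)
  define j where "j = (\<integral>\<^sup>+\<theta>. ennreal (f \<theta>) \<partial>lborel)"
  have eq: "(\<integral>\<^sup>+\<theta>. ennreal (sin \<theta> powr p) * indicator {0<..<pi} \<theta> \<partial>lborel) = 2 * j"
  proof -
    \<comment> \<open>The sine is symmetric about pi/2, so the integral over (0, pi) is twice the
      one in the constant; this accounts for the 2 in \<open>ring_const\<close>.\<close>
    have "(\<integral>\<^sup>+\<theta>. ennreal (sin \<theta> powr p) * indicator {0<..<pi} \<theta> \<partial>lborel) = (\<integral>\<^sup>+\<theta>. ennreal (f \<theta>) + ennreal (f (pi - \<theta>)) \<partial>lborel)"
      by (intro nn_integral_cong_AE AE_I[of _ _ "{0, pi / 2, pi}"])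
         (auto simp: f_def emeasure_lborel_countable split: split_indicator)
    also have "\<dots> = j + (\<integral>\<^sup>+\<theta>. ennreal (f (pi - \<theta>)) \<partial>lborel)"
      unfolding j_def by (rule nn_integral_add) measurable
    also have "(\<integral>\<^sup>+\<theta>. ennreal (f (pi - \<theta>)) \<partial>lborel) = j"
      unfolding j_def by (subst (2) nn_integral_real_affine[of _ "-1" pi]) auto
    finally show ?thesis by (simp add: mult_2)
  qed
  show ?thesis
  proof (cases j)
    case top
    have "\<not> (\<lambda>\<theta>. sin \<theta> powr p) integrable_on {0..pi / 2}"
    proof
      assume "(\<lambda>\<theta>. sin \<theta> powr p) integrable_on {0..pi / 2}"
      then obtain i where "(f has_integral i) UNIV" using fint by blast
      then have "(\<integral>\<^sup>+\<theta>. ennreal (f \<theta>) \<partial>lborel) = ennreal i"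
        using nn_integral_has_integral_lborel[of f i] by (auto simp: f_def)
      then show False using top by (simp add: j_def)
    qed
    then have "ring_const n = 0"
      by (simp add: ring_const_def p_def not_integrable_integral)
    then show ?thesis by (rule that(1))
  next
    case (real i)
    have "(f has_integral i) UNIV"
      using real by (intro nn_integral_has_integral) (auto simp: f_def j_def)
    then have int: "integral {0..pi / 2} (\<lambda>\<theta>. sin \<theta> powr p) = i"
      using fint by blast
    \<comment> \<open>Positivity of the integral: since p \<le> 0, the integrand is at least 1
      wherever the sine is positive. The point 0 is excepted because \<open>0 powr p\<close> is
      0.\<close>
    have "ennreal (pi / 2) = (\<integral>\<^sup>+\<theta>. indicator {0..pi / 2} \<theta> \<partial>lborel)"
      by simp
    also have "\<dots> \<le> j"
      unfolding j_def
    proof (intro nn_integral_mono_AE AE_I[of _ _ "{0}"] subsetI)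
      fix \<theta> :: real assume "\<theta> \<in> {x \<in> space lborel. \<not> indicator {0..pi / 2} x \<le> ennreal (f x)}"
      then have \<theta>: "\<theta> \<in> {0..pi / 2}" "\<not> 1 \<le> f \<theta>"
        by (auto split: split_indicator_asm)
      show "\<theta> \<in> {0}"
      proof (rule ccontr)
        assume "\<theta> \<notin> {0}"
        then have "0 < sin \<theta>" using \<theta> pi_gt_zero by (intro sin_gt_zero) auto
        then have "1 powr p \<le> sin \<theta> powr p" using p by (intro powr_mono2') auto
        then show False using \<theta> by (simp add: f_def)
      qed
    qed auto
    finally have "pi / 2 \<le> i" using real by simp
    then have i: "0 < i" using pi_gt_zero by linarith
    show ?thesis
    proof (rule that(2)[of "2 * i"])
      show "(\<integral>\<^sup>+\<theta>. ennreal (sin \<theta> powr p) * indicator {0<..<pi} \<theta> \<partial>lborel) = ennreal (2 * i)"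
        unfolding eq real using i by (simp add: ennreal_mult')
      have "(2 * i) powr (1 - real n) = (2 * i) powr (- real (n - 1))"
        using n by (simp add: of_nat_diff)
      also have "\<dots> = 1 / (2 * i) ^ (n - 1)"
        using i by (simp add: powr_minus powr_realpow divide_inverse)
      finally show "ring_const n = unit_sphere_area (n - 2) / (2 * i) ^ (n - 1)"
        using int by (simp add: ring_const_def p_def)
    qed (use i in auto)
  qed
qed

section \<open>Arc length\<close>

lemma curve_length_append:
  assumes "0 \<le> a" "a \<le> b"
  shows "curve_length \<gamma> 0 a + ennreal (norm (\<gamma> b - \<gamma> a)) \<le> curve_length \<gamma> 0 b"
proof -
  have "(\<Sum>i<m. ennreal (norm (\<gamma> (p (Suc i)) - \<gamma> (p i)))) + ennreal (norm (\<gamma> b - \<gamma> a)) \<le> curve_length \<gamma> 0 b"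
    if p: "mono p" "range p \<subseteq> {0..a}" for m and p :: "nat \<Rightarrow> real"
  proof -
    \<comment> \<open>The polygon need not end at \<open>a\<close>, so the vertex \<open>a\<close>
      is inserted before \<open>b\<close>; the chord from \<open>p m\<close> to \<open>a\<close>
      only increases the sum.\<close>
    define q where "q i = (if i \<le> m then p i else if i = Suc m then a else b)" for i
    have pa: "0 \<le> p i" "p i \<le> a" for i using p(2) by (auto simp: image_subset_iff)
    have "mono q"
      unfolding mono_iff_le_Suc q_def using pa(2) assms(2) monoD[OF p(1), of _ "Suc _"]
      by (auto intro: order_trans)
    moreover have "range q \<subseteq> {0..b}"
      using pa assms order_trans[OF pa(2) assms(2)] by (auto simp: q_def)
    ultimately have "(\<Sum>i<Suc (Suc m). ennreal (norm (\<gamma> (q (Suc i)) - \<gamma> (q i)))) \<le> curve_length \<gamma> 0 b"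
      unfolding curve_length_def
      by (intro SUP_upper2[of "(Suc (Suc m), q)"]) (simp_all del: sum.lessThan_Suc sum_ennreal)
    moreover have "(\<Sum>i<m. ennreal (norm (\<gamma> (q (Suc i)) - \<gamma> (q i)))) = (\<Sum>i<m. ennreal (norm (\<gamma> (p (Suc i)) - \<gamma> (p i))))"
      by (intro sum.cong) (auto simp: q_def)
    moreover have "norm (\<gamma> (q (Suc (Suc m))) - \<gamma> (q (Suc m))) = norm (\<gamma> b - \<gamma> a)"
      by (simp add: q_def)
    ultimately show ?thesis
      by (simp del: sum_ennreal) (meson add_right_mono le_iff_add order_trans)
  qed
  then have "(SUP (m, p) \<in> {(m :: nat, p :: nat \<Rightarrow> real). mono p \<and> range p \<subseteq> {0..a}}.
      (\<Sum>i<m. ennreal (norm (\<gamma> (p (Suc i)) - \<gamma> (p i)))) + ennreal (norm (\<gamma> b - \<gamma> a))) \<le> curve_length \<gamma> 0 b"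
    by (intro SUP_least) auto
  moreover have "{(m :: nat, p :: nat \<Rightarrow> real). mono p \<and> range p \<subseteq> {0..a}} \<noteq> {}"
    using assms by (auto intro!: exI[of _ "\<lambda>_. 0"] simp: mono_def)
  ultimately show ?thesis
    unfolding curve_length_def case_prod_unfold by (subst ennreal_SUP_add_left[symmetric]) auto
qed

text \<open>Each chord is cut at \<open>a\<close> by \<open>min\<close> and \<open>max\<close>. The
  \<open>min\<close> parts form a polygon on [0, a], while the \<open>max\<close> parts are bounded
  by increments of \<open>h\<close>, which telescope.\<close>

lemma curve_length_extend_le:
  fixes h :: "real \<Rightarrow> real"
  assumes "0 \<le> a" "a \<le> b"
    and bound: "\<And>x y. a \<le> x \<Longrightarrow> x \<le> y \<Longrightarrow> y \<le> b \<Longrightarrow> norm (\<gamma> y - \<gamma> x) \<le> h y - h x"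
  shows "curve_length \<gamma> 0 b \<le> curve_length \<gamma> 0 a + ennreal (h b - h a)"
  unfolding curve_length_def[of _ _ b]
proof (rule SUP_least, safe)
  fix m and p :: "nat \<Rightarrow> real"
  assume p: "mono p" "range p \<subseteq> {0..b}"
  have pb: "0 \<le> p i" "p i \<le> b" for i using p(2) by (auto simp: image_subset_iff)
  have step: "p i \<le> p (Suc i)" for i using p(1) by (simp add: mono_def)
  have hmono: "h x \<le> h y" if "a \<le> x" "x \<le> y" "y \<le> b" for x y
    using bound[OF that] norm_ge_zero[of "\<gamma> y - \<gamma> x"] by linarith
  have "(\<Sum>i<m. ennreal (norm (\<gamma> (p (Suc i)) - \<gamma> (p i)))) \<le>
      (\<Sum>i<m. ennreal (norm (\<gamma> (min (p (Suc i)) a) - \<gamma> (min (p i) a))) +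
             ennreal (h (max (p (Suc i)) a) - h (max (p i) a)))"
  proof (rule sum_mono)
    fix i
    have "norm (\<gamma> (p (Suc i)) - \<gamma> (p i)) \<le> norm (\<gamma> (min (p (Suc i)) a) - \<gamma> (min (p i) a)) +
       norm (\<gamma> (max (p (Suc i)) a) - \<gamma> (max (p i) a))"
      using step[of i] norm_triangle_ineq[of "\<gamma> (p (Suc i)) - \<gamma> a" "\<gamma> a - \<gamma> (p i)"]
      by (auto simp: min_def max_def)
    also have "norm (\<gamma> (max (p (Suc i)) a) - \<gamma> (max (p i) a)) \<le> h (max (p (Suc i)) a) - h (max (p i) a)"
      using step[of i] pb[of "Suc i"] assms(2) by (intro bound) auto
    finally have "norm (\<gamma> (p (Suc i)) - \<gamma> (p i)) \<le> norm (\<gamma> (min (p (Suc i)) a) - \<gamma> (min (p i) a)) +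
       (h (max (p (Suc i)) a) - h (max (p i) a))" by simp
    moreover have "0 \<le> h (max (p (Suc i)) a) - h (max (p i) a)"
      using hmono[of "max (p i) a" "max (p (Suc i)) a"] step[of i] pb[of "Suc i"] assms(2) by (simp add: max_def)
    ultimately show "ennreal (norm (\<gamma> (p (Suc i)) - \<gamma> (p i))) \<le>
      ennreal (norm (\<gamma> (min (p (Suc i)) a) - \<gamma> (min (p i) a))) + ennreal (h (max (p (Suc i)) a) - h (max (p i) a))"
      by (metis ennreal_leI ennreal_plus norm_ge_zero)
  qed
  also have "\<dots> = (\<Sum>i<m. ennreal (norm (\<gamma> (min (p (Suc i)) a) - \<gamma> (min (p i) a)))) +
             (\<Sum>i<m. ennreal (h (max (p (Suc i)) a) - h (max (p i) a)))"
    by (rule sum.distrib)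
  also have "(\<Sum>i<m. ennreal (norm (\<gamma> (min (p (Suc i)) a) - \<gamma> (min (p i) a)))) \<le> curve_length \<gamma> 0 a"
  proof -
    have "mono (\<lambda>i. min (p i) a)" "range (\<lambda>i. min (p i) a) \<subseteq> {0..a}"
      using p(1) pb assms(1) by (auto simp: mono_def min_le_iff_disj)
    then show ?thesis
      unfolding curve_length_def
      by (intro SUP_upper2[of "(m, \<lambda>i. min (p i) a)"]) (simp_all del: sum_ennreal)
  qed
  also have "(\<Sum>i<m. ennreal (h (max (p (Suc i)) a) - h (max (p i) a))) \<le> ennreal (h b - h a)"
  proof -
    have "(\<Sum>i<m. ennreal (h (max (p (Suc i)) a) - h (max (p i) a))) =
        ennreal (\<Sum>i<m. h (max (p (Suc i)) a) - h (max (p i) a))"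
      using hmono[OF max.cobounded2 max.mono[OF step order_refl]] pb assms(2) by (intro sum_ennreal) simp
    also have "(\<Sum>i<m. h (max (p (Suc i)) a) - h (max (p i) a)) = h (max (p m) a) - h (max (p 0) a)"
      by (rule sum_lessThan_telescope)
    also have "ennreal \<dots> \<le> ennreal (h b - h a)"
      using hmono[of a "max (p 0) a"] hmono[of "max (p m) a" b] pb assms(2) by (intro ennreal_leI) auto
    finally show ?thesis .
  qed
  finally show "(\<Sum>i<m. ennreal (norm (\<gamma> (p (Suc i)) - \<gamma> (p i)))) \<le> curve_length \<gamma> 0 a + ennreal (h b - h a)"
    by (simp add: add_mono)
qed

lemma curve_length_0 [simp]: "curve_length \<gamma> a a = 0"
proof -
  have "(\<Sum>i<m. ennreal (norm (\<gamma> (p (Suc i)) - \<gamma> (p i)))) = 0" if "range p \<subseteq> {a..a}" for m and p :: "nat \<Rightarrow> real"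
  proof -
    have "p i = a" for i using that by (auto simp: image_subset_iff)
    then show ?thesis by simp
  qed
  then show ?thesis unfolding curve_length_def by (auto intro!: antisym SUP_least)
qed

section \<open>Length and line integrals of piecewise smooth curves\<close>

text \<open>The curve may have corners at \<open>K\<close>, but its speed \<open>v\<close> extends
  continuously and positively across them. Hence the integral of \<open>v\<close> is continuously
  differentiable and strictly increasing on all of [0, 1].\<close>

locale piecewise_smooth_curve =
  fixes \<gamma> :: "real \<Rightarrow> 'a::euclidean_space" and v :: "real \<Rightarrow> real" and K :: "real set"
  assumes cont_curve: "continuous_on {0..1} \<gamma>"
    and cont_speed: "continuous_on {0..1} v"
    and speed_pos: "\<And>t. t \<in> {0..1} \<Longrightarrow> 0 < v t"
    and finite_K: "finite K"
    and deriv: "\<And>t. t \<in> {0<..<1} - K \<Longrightarrow> \<exists>d. (\<gamma> has_vector_derivative d) (at t) \<and> norm d = v t"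
begin

definition len :: "real \<Rightarrow> real" where "len t = integral {0..t} v"

lemma len_diff:
  assumes "0 \<le> a" "a \<le> b" "b \<le> 1"
  shows "(v has_integral (len b - len a)) {a..b}"
proof -
  have "v integrable_on {0..b}" "v integrable_on {a..b}"
    using assms cont_speed by (auto intro!: integrable_continuous_real intro: continuous_on_subset)
  moreover have "integral {0..a} v + integral {a..b} v = integral {0..b} v"
    using assms calculation by (intro Henstock_Kurzweil_Integration.integral_combine) auto
  ultimately show ?thesis by (simp add: len_def has_integral_iff)
qed

lemma len_0 [simp]: "len 0 = 0"
  by (simp add: len_def)

lemma len_deriv: "t \<in> {0..1} \<Longrightarrow> (len has_real_derivative v t) (at t within {0..1})"
  using integral_has_real_derivative[OF cont_speed] by (simp add: len_def[abs_def])

lemma len_strict_mono: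
  assumes "0 \<le> a" "a < b" "b \<le> 1"
  shows "len a < len b"
proof (rule DERIV_pos_imp_increasing_open[OF assms(2)])
  fix x assume x: "a < x" "x < b"
  then have "x \<in> {0<..<1}" using assms by auto
  then show "\<exists>y. DERIV len x :> y \<and> 0 < y"
    using len_deriv[of x] speed_pos[of x] by (auto simp: at_within_Icc_at)
next
  show "continuous_on {a..b} len"
    using DERIV_continuous_on[OF len_deriv] assms by (meson atLeastatMost_subset_iff continuous_on_subset)
qed

lemma len_mono: "0 \<le> a \<Longrightarrow> a \<le> b \<Longrightarrow> b \<le> 1 \<Longrightarrow> len a \<le> len b"
  using len_strict_mono[of a b] by (cases "a = b") auto

lemma norm_diff_le_len:
  assumes "0 \<le> a" "a \<le> b" "b \<le> 1"
  shows "norm (\<gamma> b - \<gamma> a) \<le> len b - len a"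
proof -
  define d where "d t = (if t \<in> {0<..<1} - K then SOME d. (\<gamma> has_vector_derivative d) (at t) \<and> norm d = v t else 0)" for t
  have d: "(\<gamma> has_vector_derivative d t) (at t)" "norm (d t) = v t" if "t \<in> {0<..<1} - K" for t
    using someI_ex[OF deriv[OF that]] that by (auto simp: d_def)
  have "(d has_integral (\<gamma> b - \<gamma> a)) {a..b}"
    using assms cont_curve by (intro fundamental_theorem_of_calculus_interior_strong[OF finite_K] d)
      (auto intro: continuous_on_subset)
  moreover have "norm (d t) \<le> v t" if "t \<in> {a..b}" for t
    using d(2)[of t] speed_pos[of t] that assms by (cases "t \<in> {0<..<1} - K") (auto simp: d_def)
  ultimately show ?thesis
    using integral_norm_bound_integral[of d "{a..b}" v] len_diff[OF assms] by (auto simp: has_integral_iff)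
qed

text \<open>The increments of the polygonal length \<open>L\<close> lie between chord lengths and
  increments of \<open>len\<close>. Off the finite set both difference quotients tend to
  \<open>v\<close>, so \<open>L\<close> and \<open>len\<close> have the same derivative there; being
  continuous and equal at 0, they agree.\<close>

lemma curve_length_eq:
  assumes t: "t \<in> {0..1}"
  shows "curve_length \<gamma> 0 t = ennreal (len t)"
proof -
  have le: "curve_length \<gamma> 0 b \<le> curve_length \<gamma> 0 a + ennreal (len b - len a)"
    if "0 \<le> a" "a \<le> b" "b \<le> 1" for a b
    using that by (intro curve_length_extend_le norm_diff_le_len) auto
  have fin: "curve_length \<gamma> 0 b < \<infinity>" if "b \<in> {0..1}" for b
    using le[of 0 b] that by (auto simp: le_less_trans)
  define L where "L t = enn2real (curve_length \<gamma> 0 t)" for t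
  have L: "curve_length \<gamma> 0 b = ennreal (L b)" "0 \<le> L b" if "b \<in> {0..1}" for b
    using fin[OF that] by (auto simp: L_def)
  have Lle: "L b - L a \<le> len b - len a" if "0 \<le> a" "a \<le> b" "b \<le> 1" for a b
    using le[OF that] that L[of a] L[of b] len_mono[OF that]
    by (simp add: ennreal_plus[symmetric] del: ennreal_plus)
  have Lge: "norm (\<gamma> b - \<gamma> a) \<le> L b - L a" if "0 \<le> a" "a \<le> b" "b \<le> 1" for a b
    using curve_length_append[OF that(1,2), of \<gamma>] that L[of a] L[of b]
    by (simp add: ennreal_plus[symmetric] del: ennreal_plus)
  have "len t - L t = 0"
  proof (rule has_derivative_zero_unique_strong_interval[where f = "\<lambda>t. len t - L t" and k = "K \<union> {0, 1}"])
    show "continuous_on {0..1} (\<lambda>t. len t - L t)"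
    proof (intro continuous_on_diff)
      show cl: "continuous_on {0..1} len"
        using len_deriv by (rule DERIV_continuous_on)
      show "continuous_on {0..1} L"
        unfolding continuous_on_iff
      proof (intro ballI allI impI)
        fix x e :: real assume x: "x \<in> {0..1}" and "0 < e"
        then obtain \<delta> where \<delta>: "0 < \<delta>" "\<And>y. y \<in> {0..1} \<Longrightarrow> dist y x < \<delta> \<Longrightarrow> dist (len y) (len x) < e"
          using cl unfolding continuous_on_iff by blast
        have "dist (L y) (L x) \<le> dist (len y) (len x)" if y: "y \<in> {0..1}" for y
        proof (cases "x \<le> y")
          case True
          have "0 \<le> L y - L x" using Lge[of x y] True x y by (smt (verit) norm_ge_zero atLeastAtMost_iff)
          then show ?thesis using Lle[of x y] True x y by (auto simp: dist_real_def)
        next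
          case False
          have "0 \<le> L x - L y" using Lge[of y x] False x y by (smt (verit) norm_ge_zero atLeastAtMost_iff)
          then show ?thesis using Lle[of y x] False x y by (auto simp: dist_real_def)
        qed
        then show "\<exists>d>0. \<forall>x'\<in>{0..1}. dist x' x < d \<longrightarrow> dist (L x') (L x) < e"
          using \<delta> by (meson le_less_trans)
      qed
    qed
  next
    fix x assume x: "x \<in> {0..1} - (K \<union> {0, 1})"
    then have x': "x \<in> {0<..<1} - K" by auto
    then obtain d where d: "(\<gamma> has_vector_derivative d) (at x)" "norm d = v x" using deriv by blast
    have len': "(len has_real_derivative v x) (at x)"
      using len_deriv[of x] x' by (simp add: at_within_Icc_at)
    have "((\<lambda>y. (L y - L x) / (y - x)) \<longlongrightarrow> v x) (at x)"
    proof (rule tendsto_sandwich)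
      have "((\<lambda>y. norm ((\<gamma> y - \<gamma> x) /\<^sub>R (y - x))) \<longlongrightarrow> norm d) (at x)"
      proof (rule tendsto_norm, rule LIM_zero_cancel, rule tendsto_norm_zero_cancel)
        have lim: "((\<lambda>y. norm (\<gamma> y - \<gamma> x - (y - x) *\<^sub>R d) / norm (y - x)) \<longlongrightarrow> 0) (at x)"
          using d(1) unfolding has_vector_derivative_def has_derivative_iff_norm by simp
        have eq: "norm ((\<gamma> y - \<gamma> x) /\<^sub>R (y - x) - d) = norm (\<gamma> y - \<gamma> x - (y - x) *\<^sub>R d) / norm (y - x)"
          if "y \<noteq> x" for y
        proof -
          have "(\<gamma> y - \<gamma> x) /\<^sub>R (y - x) - d = (\<gamma> y - \<gamma> x - (y - x) *\<^sub>R d) /\<^sub>R (y - x)"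
            using that by (simp add: scaleR_diff_right)
          then show ?thesis by (simp add: divide_inverse mult.commute)
        qed
        show "((\<lambda>y. norm ((\<gamma> y - \<gamma> x) /\<^sub>R (y - x) - d)) \<longlongrightarrow> 0) (at x)"
          by (rule Lim_transform_eventually[OF lim]) (auto simp: eventually_at_filter eq)
      qed
      then show "((\<lambda>y. norm ((\<gamma> y - \<gamma> x) /\<^sub>R (y - x))) \<longlongrightarrow> v x) (at x)" by (simp add: d)
      show "((\<lambda>y. (len y - len x) / (y - x)) \<longlongrightarrow> v x) (at x)"
        using len' by (simp add: has_field_derivative_iff)
      have ev: "eventually (\<lambda>y. y \<in> {0<..<1} \<and> y \<noteq> x) (at x)"
        using x' by (intro eventually_conj eventually_at_in_open' eventually_neq_at_within) auto
      show "eventually (\<lambda>y. norm ((\<gamma> y - \<gamma> x) /\<^sub>R (y - x)) \<le> (L y - L x) / (y - x)) (at x)"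
        using ev
      proof eventually_elim
        case (elim y)
        have "norm ((\<gamma> y - \<gamma> x) /\<^sub>R (y - x)) = norm (\<gamma> y - \<gamma> x) / \<bar>y - x\<bar>"
          by (simp add: divide_inverse mult.commute)
        also have "\<dots> \<le> (L y - L x) / (y - x)"
        proof (cases "x \<le> y")
          case True
          then show ?thesis using Lge[of x y] elim x' by (auto intro: divide_right_mono)
        next
          case False
          then have "norm (\<gamma> y - \<gamma> x) / (x - y) \<le> (L x - L y) / (x - y)"
            using Lge[of y x] elim x' by (intro divide_right_mono) (auto simp: norm_minus_commute)
          also have "(L x - L y) / (x - y) = (L y - L x) / (y - x)"
            by (metis minus_diff_eq minus_divide_divide)
          finally show ?thesis using False by simp
        qed
        finally show ?case .
      qed
      show "eventually (\<lambda>y. (L y - L x) / (y - x) \<le> (len y - len x) / (y - x)) (at x)"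
        using ev
      proof eventually_elim
        case (elim y)
        then show ?case
          using Lle[of x y] Lle[of y x] x' by (cases "x \<le> y") (auto intro: divide_right_mono divide_right_mono_neg)
      qed
    qed
    then have "(L has_real_derivative v x) (at x)" by (simp add: has_field_derivative_iff)
    from DERIV_diff[OF len' this] have "((\<lambda>t. len t - L t) has_derivative (\<lambda>h. 0)) (at x)"
      by (simp add: has_field_derivative_def lambda_zero)
    then show "((\<lambda>t. len t - L t) has_derivative (\<lambda>h. 0)) (at x within {0..1})"
      by (rule has_derivative_at_withinI)
  qed (use t finite_K in \<open>auto simp: L_def\<close>)
  then show ?thesis using L(1)[OF t] by simp
qed

text \<open>Positive speed makes \<open>len\<close> injective, so the choice in
  \<open>arc_length_param\<close> has only one candidate.\<close>

lemma arc_length_param_len: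
  assumes "t \<in> {0..1}"
  shows "arc_length_param \<gamma> (len t) = \<gamma> t"
proof -
  have "(SOME s. s \<in> {0..1} \<and> curve_length \<gamma> 0 s = ennreal (len t)) = t"
  proof (rule some_equality)
    fix s assume s: "s \<in> {0..1} \<and> curve_length \<gamma> 0 s = ennreal (len t)"
    then have "len s = len t"
      using assms curve_length_eq[of s] len_mono[of 0 s] len_mono[of 0 t] by auto
    then show "s = t"
      using s assms len_strict_mono[of s t] len_strict_mono[of t s] by (cases s t rule: linorder_cases) auto
  qed (use assms curve_length_eq in auto)
  then show ?thesis by (simp add: arc_length_param_def)
qed

lemma len_image: "len ` {0..1} = {0..len 1}" "len ` {0<..<1} = {0<..<len 1}"
proof -
  have cl: "continuous_on {0..1} len"
    using len_deriv by (rule DERIV_continuous_on)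
  have ex: "\<exists>x\<in>{0..1}. len x = s" if "0 \<le> s" "s \<le> len 1" for s
    using IVT'[of len 0 s 1] that cl by auto
  show "len ` {0..1} = {0..len 1}"
    using ex len_mono[of 0] len_mono[of _ 1] by (fastforce simp: image_iff)
  show "len ` {0<..<1} = {0<..<len 1}"
  proof (intro equalityI subsetI)
    fix s assume s: "s \<in> {0<..<len 1}"
    then obtain x where x: "x \<in> {0..1}" "len x = s" using ex[of s] by auto
    then have "x \<noteq> 0" "x \<noteq> 1" using s by auto
    then show "s \<in> len ` {0<..<1}" using x by (intro image_eqI[of _ _ x]) auto
  qed (use len_strict_mono[of 0] len_strict_mono[of _ 1] in auto)
qed

lemma line_integral_eq:
  assumes \<sigma> [measurable]: "\<sigma> \<in> borel_measurable borel"
  shows "line_integral \<sigma> \<gamma> = (\<integral>\<^sup>+t. \<sigma> (\<gamma> t) * ennreal (v t) * indicator {0<..<1} t \<partial>lborel)"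
proof -
  have cl: "continuous_on {0..1} len"
    using len_deriv by (rule DERIV_continuous_on)
  have inj: "inj_on len {0..1}"
  proof (rule inj_onI)
    fix x y assume "x \<in> {0..1}" "y \<in> {0..1}" "len x = len y"
    then show "x = y"
      using len_strict_mono[of x y] len_strict_mono[of y x] by (cases x y rule: linorder_cases) auto
  qed
  \<comment> \<open>\<open>arc_length_param\<close> is given by a choice, so its measurability has
    to be earned: on [0, len 1] it is the curve composed with the inverse of \<open>len\<close>,
    which is continuous by compactness. Beyond that interval it is cut off.\<close>
  have inv_cont: "continuous_on {0..len 1} (the_inv_into {0..1} len)"
    using continuous_on_inv[OF cl compact_Icc, of "the_inv_into {0..1} len"] inj
    unfolding len_image(1) by (simp add: the_inv_into_f_f)
  have inv_mem: "the_inv_into {0..1} len s \<in> {0..1}" "len (the_inv_into {0..1} len s) = s" if "s \<in> {0..len 1}" for s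
    using that the_inv_into_into[OF inj, of s "{0..1}"] f_the_inv_into_f[OF inj, of s] len_image(1) by auto
  have "continuous_on {0..len 1} (\<lambda>s. \<gamma> (the_inv_into {0..1} len s))"
    using inv_mem by (intro continuous_on_compose2[OF cont_curve inv_cont]) auto
  then have "continuous_on {0..len 1} (arc_length_param \<gamma>)"
    by (rule continuous_on_eq) (metis arc_length_param_len inv_mem)
  then have [measurable]: "(\<lambda>s. indicator {0..len 1} s *\<^sub>R arc_length_param \<gamma> s) \<in> borel_measurable borel"
    by (intro borel_measurable_continuous_on_indicator) auto
  define f where "f s = \<sigma> (indicator {0..len 1} s *\<^sub>R arc_length_param \<gamma> s)" for s
  have [measurable]: "f \<in> borel_measurable borel" unfolding f_def by measurable
  have "line_integral \<sigma> \<gamma> = (\<integral>\<^sup>+s. \<sigma> (arc_length_param \<gamma> s) * indicator {0..len 1} s \<partial>lborel)"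
    using len_mono[of 0 1] by (simp add: line_integral_def curve_length_eq mult.commute)
  also have "\<dots> = (\<integral>\<^sup>+s. f s * indicator {0<..<len 1} s \<partial>lborel)"
    by (intro nn_integral_cong_AE AE_I[of _ _ "{0, len 1}"])
       (auto simp: f_def emeasure_lborel_countable split: split_indicator)
  also have "\<dots> = (\<integral>\<^sup>+t. f (len t) * ennreal (v t) * indicator {0<..<1} t \<partial>lborel)"
    unfolding len_image(2)[symmetric]
  \<comment> \<open>The shift by 3 makes the first interval nondegenerate, as 1/3 < 2/3.\<close>
  proof (rule nn_integral_substitution_exhaustion[where a = "\<lambda>k. 1 / real (k + 3)" and b = "\<lambda>k. 1 - 1 / real (k + 3)"])
    show "(len has_real_derivative v x) (at x)" "0 \<le> v x" if "x \<in> {0<..<1}" for x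
      using that len_deriv[of x] speed_pos[of x] by (auto simp: at_within_Icc_at)
    show "continuous_on {0<..<1} v"
      using cont_speed by (rule continuous_on_subset) auto
    show "{0<..<1} = (\<Union>k. {1 / real (k + 3)..1 - 1 / real (k + 3)})"
    proof (intro equalityI subsetI)
      fix x :: real assume x: "x \<in> {0<..<1}"
      then obtain k where k: "inverse (real (Suc k)) < min x (1 - x)"
        using reals_Archimedean[of "min x (1 - x)"] by auto
      have "1 / real (k + 3) \<le> inverse (real (Suc k))"
        by (simp add: field_simps)
      then show "x \<in> (\<Union>k. {1 / real (k + 3)..1 - 1 / real (k + 3)})"
        using k by (intro UN_I[of k]) auto
    next
      fix x :: real assume "x \<in> (\<Union>k. {1 / real (k + 3)..1 - 1 / real (k + 3)})"
      then obtain k where "1 / real (k + 3) \<le> x" "x \<le> 1 - 1 / real (k + 3)" by auto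
      moreover have "0 < 1 / real (k + 3)" by simp
      ultimately show "x \<in> {0<..<1}" unfolding greaterThanLessThan_iff by linarith
    qed
    show "1 / real (k + 3) < 1 - 1 / real (k + 3)" for k by (simp add: field_simps)
    have "1 / real (l + 3) \<le> 1 / real (k + 3)" if "k \<le> l" for k l :: nat
      using that by (intro divide_left_mono) auto
    then show "decseq (\<lambda>k. 1 / real (k + 3))" "incseq (\<lambda>k. 1 - 1 / real (k + 3))"
      by (auto simp: decseq_def incseq_def)
  qed measurable
  also have "\<dots> = (\<integral>\<^sup>+t. \<sigma> (\<gamma> t) * ennreal (v t) * indicator {0<..<1} t \<partial>lborel)"
  proof (rule nn_integral_cong)
    fix t :: real
    show "f (len t) * ennreal (v t) * indicator {0<..<1} t = \<sigma> (\<gamma> t) * ennreal (v t) * indicator {0<..<1} t"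
      using arc_length_param_len[of t] len_mono[of 0 t] len_mono[of t 1]
      by (cases "t \<in> {0<..<1}") (auto simp: f_def)
  qed
  finally show ?thesis .
qed

lemma curve_length_finite:
  assumes "0 \<le> a" "a \<le> b" "b \<le> 1"
  shows "curve_length \<gamma> a b < \<infinity>"
proof -
  have "curve_length \<gamma> a b \<le> curve_length \<gamma> 0 b"
    unfolding curve_length_def using assms by (intro SUP_subset_mono) auto
  also have "\<dots> < \<infinity>" using assms by (simp add: curve_length_eq)
  finally show ?thesis .
qed

end

section \<open>Inversions\<close>

lemma nn_integral_inverse_substitution:
  fixes h :: "real \<Rightarrow> ennreal"
  assumes [measurable]: "h \<in> borel_measurable borel"
  shows "(\<integral>\<^sup>+r. h r * indicator {0<..} r \<partial>lborel) =
         (\<integral>\<^sup>+s. h (1 / s) * ennreal (1 / s\<^sup>2) * indicator {0<..} s \<partial>lborel)"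
proof -
  have img: "(\<lambda>s. - 1 / s) ` {0<..} = {..<0::real}"
  proof (intro equalityI subsetI)
    fix t :: real assume "t \<in> {..<0}"
    then show "t \<in> (\<lambda>s. - 1 / s) ` {0<..}" by (intro image_eqI[of _ _ "- 1 / t"]) auto
  qed auto
  have "(\<integral>\<^sup>+r. h r * indicator {0<..} r \<partial>lborel) = (\<integral>\<^sup>+t. h (- t) * indicator {..<0} t \<partial>lborel)"
    by (subst nn_integral_real_affine[of _ "-1" 0]) (auto intro!: nn_integral_cong split: split_indicator)
  also have "\<dots> = (\<integral>\<^sup>+s. h (- (- 1 / s)) * ennreal (1 / s\<^sup>2) * indicator {0<..} s \<partial>lborel)"
    unfolding img[symmetric]
  proof (rule nn_integral_substitution_exhaustion[where a = "\<lambda>k. 1 / real (k + 2)" and b = "\<lambda>k. real (k + 2)"])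
    show "((\<lambda>s. - 1 / s) has_real_derivative 1 / s\<^sup>2) (at s)" if "s \<in> {0<..}" for s :: real
      using that by (auto intro!: derivative_eq_intros simp: power2_eq_square)
    show "continuous_on {0<..} (\<lambda>s::real. 1 / s\<^sup>2)"
      by (intro continuous_intros) auto
    show "{0<..} = (\<Union>k. {1 / real (k + 2)..real (k + 2)})"
    proof (intro equalityI subsetI)
      fix s :: real assume "s \<in> {0<..}"
      then have s: "0 < s" by simp
      obtain k where k: "max s (1 / s) \<le> real k" using real_arch_simple by blast
      then have "1 / real (k + 2) \<le> s"
        using s by (simp add: field_simps)
      then show "s \<in> (\<Union>k. {1 / real (k + 2)..real (k + 2)})" using k by (intro UN_I[of k]) auto
    next
      fix s :: real assume "s \<in> (\<Union>k. {1 / real (k + 2)..real (k + 2)})"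
      then obtain k where "1 / real (k + 2) \<le> s" by auto
      moreover have "0 < 1 / real (k + 2)" by simp
      ultimately show "s \<in> {0<..}" unfolding greaterThan_iff by linarith
    qed
    show "1 / real (k + 2) < real (k + 2)" for k by (rule less_trans[of _ 1]) simp_all
    have "1 / real (l + 2) \<le> 1 / real (k + 2)" if "k \<le> l" for k l :: nat
      using that by (intro divide_left_mono) auto
    then show "decseq (\<lambda>k. 1 / real (k + 2))" by (auto simp: decseq_def)
    show "incseq (\<lambda>k. real (k + 2))" by (auto simp: incseq_def)
  qed auto
  finally show ?thesis by simp
qed

text \<open>Inversion in the unit sphere about \<open>q\<close>. By division by zero the centre is
  mapped to itself, so the identities below exclude it.\<close>

definition inversion :: "'a::euclidean_space \<Rightarrow> 'a \<Rightarrow> 'a" where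
  "inversion q w = q + (w - q) /\<^sub>R (norm (w - q))\<^sup>2"

lemma measurable_inversion [measurable]: "inversion q \<in> borel_measurable borel"
  unfolding inversion_def by measurable

lemma inversion_diff: "inversion q w - q = (w - q) /\<^sub>R (norm (w - q))\<^sup>2"
  by (simp add: inversion_def)

lemma norm_inversion_diff: "w \<noteq> q \<Longrightarrow> norm (inversion q w - q) = 1 / norm (w - q)"
  by (simp add: inversion_diff power2_eq_square divide_inverse)

lemma inversion_inversion:
  assumes "w \<noteq> q"
  shows "inversion q (inversion q w) = w"
  unfolding inversion_def[of q "inversion q w"] norm_inversion_diff[OF assms]
  unfolding inversion_diff using assms by (simp add: power_divide)

lemma norm_inversion_inversion:
  assumes "u \<noteq> q" "w \<noteq> q"
  shows "norm (inversion q u - inversion q w) = norm (u - w) / (norm (u - q) * norm (w - q))"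
proof -
  define x y where "x = u - q" and "y = w - q"
  have xy: "x \<noteq> 0" "y \<noteq> 0" using assms by (auto simp: x_def y_def)
  have xx: "0 < x \<bullet> x" "0 < y \<bullet> y" using xy by simp_all
  define X Y where "X = x \<bullet> x" and "Y = y \<bullet> y"
  have "(norm (x /\<^sub>R X - y /\<^sub>R Y))\<^sup>2 = 1 / X + 1 / Y - 2 * (x \<bullet> y) / (X * Y)"
    unfolding power2_norm_eq_inner inner_diff_left inner_diff_right using xx
    by (simp add: X_def[symmetric] Y_def[symmetric] inner_commute field_simps)
  also have "\<dots> = (X + Y - 2 * (x \<bullet> y)) / (X * Y)"
    using xx by (simp add: X_def[symmetric] Y_def[symmetric] field_simps)
  also have "X + Y - 2 * (x \<bullet> y) = (norm (x - y))\<^sup>2"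
    by (simp add: power2_norm_eq_inner inner_diff_left inner_diff_right inner_commute X_def Y_def)
  also have "X * Y = (norm x * norm y)\<^sup>2"
    by (simp add: X_def Y_def power2_norm_eq_inner power_mult_distrib)
  finally have "(norm (x /\<^sub>R X - y /\<^sub>R Y))\<^sup>2 = (norm (x - y) / (norm x * norm y))\<^sup>2"
    by (simp add: power_divide)
  then have "norm (x /\<^sub>R X - y /\<^sub>R Y) = norm (x - y) / (norm x * norm y)"
    by (simp add: power2_eq_iff_nonneg)
  then show ?thesis
    by (simp add: inversion_def x_def y_def X_def Y_def power2_norm_eq_inner)
qed

text \<open>The derivative of x / |x|^2 is the reflection in the hyperplane orthogonal to x, divided
  by |x|^2. Reflections are isometries, so the inversion is conformal with factor 1 / |x|^2.\<close>

lemma inversion_has_vector_derivative: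
  assumes \<gamma>: "(\<gamma> has_vector_derivative d) (at t)" and ne: "\<gamma> t \<noteq> q"
  shows "\<exists>D. ((\<lambda>t. inversion q (\<gamma> t)) has_vector_derivative D) (at t) \<and> norm D = norm d / (norm (\<gamma> t - q))\<^sup>2"
proof -
  define x where "x t = \<gamma> t - q" for t
  have x: "(x has_vector_derivative d) (at t)"
    unfolding x_def using has_vector_derivative_diff[OF \<gamma> has_vector_derivative_const[of q]] by simp
  have x0: "x t \<bullet> x t \<noteq> 0" using ne by (simp add: x_def)
  have "((\<lambda>t. x t \<bullet> x t) has_vector_derivative (x t \<bullet> d + d \<bullet> x t)) (at t)"
    using bounded_bilinear.has_vector_derivative[OF bounded_bilinear_inner x x] .
  then have xx: "((\<lambda>t. x t \<bullet> x t) has_real_derivative (2 * (d \<bullet> x t))) (at t)"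
    by (simp add: has_real_derivative_iff_has_vector_derivative inner_commute)
  have "((\<lambda>t. inverse (x t \<bullet> x t)) has_real_derivative (- (inverse (x t \<bullet> x t) * (2 * (d \<bullet> x t)) * inverse (x t \<bullet> x t)))) (at t)"
    using DERIV_inverse'[OF xx x0] .
  then have "((\<lambda>t. inverse (x t \<bullet> x t) *\<^sub>R x t) has_vector_derivative
      (inverse (x t \<bullet> x t) *\<^sub>R d + (- (inverse (x t \<bullet> x t) * (2 * (d \<bullet> x t)) * inverse (x t \<bullet> x t))) *\<^sub>R x t)) (at t)"
    using x by (rule has_vector_derivative_scaleR)
  also have "inverse (x t \<bullet> x t) *\<^sub>R d + (- (inverse (x t \<bullet> x t) * (2 * (d \<bullet> x t)) * inverse (x t \<bullet> x t))) *\<^sub>R x t =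
      inverse (x t \<bullet> x t) *\<^sub>R reflect (x t) d"
    by (simp add: reflect_def scaleR_diff_right divide_inverse mult_ac)
  finally have "((\<lambda>t. q + inverse (x t \<bullet> x t) *\<^sub>R x t) has_vector_derivative (0 + inverse (x t \<bullet> x t) *\<^sub>R reflect (x t) d)) (at t)"
    by (intro has_vector_derivative_add has_vector_derivative_const)
  moreover have "(\<lambda>t. q + inverse (x t \<bullet> x t) *\<^sub>R x t) = (\<lambda>t. inversion q (\<gamma> t))"
    by (simp add: inversion_def x_def power2_norm_eq_inner)
  ultimately have "((\<lambda>t. inversion q (\<gamma> t)) has_vector_derivative (inverse (x t \<bullet> x t) *\<^sub>R reflect (x t) d)) (at t)"
    by simp
  moreover have "norm (inverse (x t \<bullet> x t) *\<^sub>R reflect (x t) d) = norm d / (norm (\<gamma> t - q))\<^sup>2"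
    by (simp add: x_def power2_norm_eq_inner divide_inverse mult.commute)
  ultimately show ?thesis by blast
qed

text \<open>In polar coordinates about the centre the inversion is the substitution \<open>r \<mapsto> 1 / r\<close>.\<close>

lemma nn_integral_inversion:
  fixes \<sigma> :: "'a::euclidean_space \<Rightarrow> ennreal"
  assumes [measurable]: "\<sigma> \<in> borel_measurable borel"
  shows "(\<integral>\<^sup>+w. (\<sigma> (inversion q w) * ennreal (1 / (norm (w - q))\<^sup>2)) ^ DIM('a) \<partial>lborel) = (\<integral>\<^sup>+x. \<sigma> x ^ DIM('a) \<partial>lborel)"
proof -
  define n where "n = DIM('a)"
  have n: "n = Suc (n - 1)" by (simp add: n_def)
  define \<Phi> where "\<Phi> s = (\<integral>\<^sup>+u. \<sigma> (q + s *\<^sub>R u) ^ n \<partial>sphere_measure)" for s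
  interpret S: finite_measure "sphere_measure :: 'a measure" by (rule lborel_hom.finite_measure_cone)
  have [measurable]: "\<Phi> \<in> borel_measurable borel" unfolding \<Phi>_def by measurable
  define F where "F w = (\<sigma> (inversion q w) * ennreal (1 / (norm (w - q))\<^sup>2)) ^ n" for w
  have [measurable]: "F \<in> borel_measurable borel" unfolding F_def by measurable
  have "(\<integral>\<^sup>+w. F w \<partial>lborel) = (\<integral>\<^sup>+x. F (q + x) \<partial>lborel)"
    using nn_integral_lborel_affine[of F 1 q] by simp
  also have "\<dots> = (\<integral>\<^sup>+r. ennreal (r ^ (n - 1)) * indicator {0<..} r * (\<integral>\<^sup>+u. F (q + r *\<^sub>R u) \<partial>sphere_measure) \<partial>lborel)"
    unfolding n_def by (rule lborel_hom.nn_integral_polar) measurable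
  also have "\<dots> = (\<integral>\<^sup>+r. ennreal (1 / r ^ (n + 1)) * \<Phi> (1 / r) * indicator {0<..} r \<partial>lborel)"
  proof (rule nn_integral_cong)
    fix r :: real
    show "ennreal (r ^ (n - 1)) * indicator {0<..} r * (\<integral>\<^sup>+u. F (q + r *\<^sub>R u) \<partial>sphere_measure) =
      ennreal (1 / r ^ (n + 1)) * \<Phi> (1 / r) * indicator {0<..} r"
    proof (cases "0 < r")
      case True
      have "(\<integral>\<^sup>+u. F (q + r *\<^sub>R u) \<partial>sphere_measure) = (\<integral>\<^sup>+u. ennreal (1 / r ^ (2 * n)) * \<sigma> (q + (1 / r) *\<^sub>R u) ^ n \<partial>sphere_measure)"
      proof (rule nn_integral_cong_AE, use lborel_hom.AE_cone_measure_norm in eventually_elim)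
        fix u :: 'a assume u: "norm u = 1"
        have "inversion q (q + r *\<^sub>R u) = q + (1 / r) *\<^sub>R u"
          using True u by (simp add: inversion_def power2_eq_square divide_inverse)
        moreover have "(r\<^sup>2) ^ n = r ^ (n * 2)"
          by (simp only: power_mult[symmetric] mult.commute)
        ultimately show "F (q + r *\<^sub>R u) = ennreal (1 / r ^ (2 * n)) * \<sigma> (q + (1 / r) *\<^sub>R u) ^ n"
          using True u by (simp add: F_def power_mult_distrib ennreal_power power_divide mult.commute)
      qed
      also have "\<dots> = ennreal (1 / r ^ (2 * n)) * \<Phi> (1 / r)"
        unfolding \<Phi>_def by (rule nn_integral_cmult) measurable
      finally have 1: "(\<integral>\<^sup>+u. F (q + r *\<^sub>R u) \<partial>sphere_measure) = ennreal (1 / r ^ (2 * n)) * \<Phi> (1 / r)" .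
      \<comment> \<open>The polar weight r^(n-1) and the factor r^(-2n) of the transported density
        give r^(-n-1). The substitution r = 1/s, with its weight s^(-2), turns this back into the
        polar weight s^(n-1).\<close>
      have "r ^ (2 * n) = r ^ (n - 1) * r ^ (n + 1)"
        unfolding power_add[symmetric] using n by (intro arg_cong[where f = "power r"]) linarith
      then have "r ^ (n - 1) * (1 / r ^ (2 * n)) = 1 / r ^ (n + 1)" using True by simp
      then have "ennreal (r ^ (n - 1)) * ennreal (1 / r ^ (2 * n)) = ennreal (1 / r ^ (n + 1))"
        using True by (simp only: ennreal_mult'[symmetric] zero_le_power less_imp_le)
      then show ?thesis using True by (simp only: 1 mult.assoc[symmetric]) simp
    qed simp
  qed
  also have "\<dots> = (\<integral>\<^sup>+s. ennreal (1 / (1 / s) ^ (n + 1)) * \<Phi> (1 / (1 / s)) * ennreal (1 / s\<^sup>2) * indicator {0<..} s \<partial>lborel)"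
    by (rule nn_integral_inverse_substitution) measurable
  also have "\<dots> = (\<integral>\<^sup>+s. ennreal (s ^ (n - 1)) * indicator {0<..} s * \<Phi> s \<partial>lborel)"
  proof (rule nn_integral_cong)
    fix s :: real
    show "ennreal (1 / (1 / s) ^ (n + 1)) * \<Phi> (1 / (1 / s)) * ennreal (1 / s\<^sup>2) * indicator {0<..} s =
      ennreal (s ^ (n - 1)) * indicator {0<..} s * \<Phi> s"
    proof (cases "0 < s")
      case True
      have "s ^ (n + 1) = s ^ (n - 1) * s\<^sup>2"
        unfolding power_add[symmetric] using n by (intro arg_cong[where f = "power s"]) linarith
      then have "1 / (1 / s) ^ (n + 1) * (1 / s\<^sup>2) = s ^ (n - 1)"
        using True by (simp add: power_divide)
      then have "ennreal (1 / (1 / s) ^ (n + 1)) * ennreal (1 / s\<^sup>2) = ennreal (s ^ (n - 1))"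
        using True by (metis ennreal_mult' less_imp_le zero_le_divide_1_iff zero_le_power)
      then have "ennreal (1 / (1 / s) ^ (n + 1)) * \<Phi> s * ennreal (1 / s\<^sup>2) = ennreal (s ^ (n - 1)) * \<Phi> s"
        by (metis mult.assoc mult.commute)
      then show ?thesis using True by simp
    qed simp
  qed
  also have "\<dots> = (\<integral>\<^sup>+x. \<sigma> (q + x) ^ n \<partial>lborel)"
    unfolding \<Phi>_def n_def by (rule lborel_hom.nn_integral_polar[symmetric]) measurable
  also have "\<dots> = (\<integral>\<^sup>+x. \<sigma> x ^ n \<partial>lborel)"
    using nn_integral_lborel_affine[of "\<lambda>x. \<sigma> x ^ n" 1 q] by simp
  finally show ?thesis by (simp add: F_def n_def)
qed

section \<open>Apollonius balls and the choice of the centre\<close>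

text \<open>Completing the square in l^2 |p - a|^2 \<le> |p|^2 gives exactly this ball; the
  comparison point has been moved to the origin.\<close>

lemma apollonius:
  fixes p a :: "'a::real_inner"
  assumes "1 < l" and le: "norm (p - (l\<^sup>2 / (l\<^sup>2 - 1)) *\<^sub>R a) \<le> l / (l\<^sup>2 - 1) * norm a"
  shows "l * norm (p - a) \<le> norm p"
proof -
  define m where "m = l\<^sup>2 - 1"
  have m: "0 < m" using assms(1) by (auto simp: m_def one_less_power)
  have expand: "(norm (p - c *\<^sub>R a))\<^sup>2 = p \<bullet> p - 2 * c * (p \<bullet> a) + c\<^sup>2 * (a \<bullet> a)" for c
    unfolding power2_norm_eq_inner
    by (simp add: inner_diff_left inner_diff_right inner_commute power2_eq_square algebra_simps)
  have "(norm (p - (l\<^sup>2 / m) *\<^sub>R a))\<^sup>2 \<le> (l / m * norm a)\<^sup>2"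
    using le by (intro power_mono) (auto simp: m_def)
  also have "\<dots> = l\<^sup>2 / m\<^sup>2 * (a \<bullet> a)"
    by (simp add: power_mult_distrib power_divide power2_norm_eq_inner)
  finally have "p \<bullet> p - 2 * (l\<^sup>2 / m) * (p \<bullet> a) + (l\<^sup>2 / m)\<^sup>2 * (a \<bullet> a) \<le> l\<^sup>2 / m\<^sup>2 * (a \<bullet> a)"
    unfolding expand .
  then have "m * (p \<bullet> p - 2 * (l\<^sup>2 / m) * (p \<bullet> a) + (l\<^sup>2 / m)\<^sup>2 * (a \<bullet> a)) \<le> m * (l\<^sup>2 / m\<^sup>2 * (a \<bullet> a))"
    using m by (intro mult_left_mono) auto
  moreover have "m * (p \<bullet> p - 2 * (l\<^sup>2 / m) * (p \<bullet> a) + (l\<^sup>2 / m)\<^sup>2 * (a \<bullet> a)) - m * (l\<^sup>2 / m\<^sup>2 * (a \<bullet> a)) =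
      l\<^sup>2 * ((p - a) \<bullet> (p - a)) - p \<bullet> p"
  proof -
    have "m * (p \<bullet> p - 2 * (l\<^sup>2 / m) * (p \<bullet> a) + (l\<^sup>2 / m)\<^sup>2 * (a \<bullet> a)) - m * (l\<^sup>2 / m\<^sup>2 * (a \<bullet> a)) =
        m * (p \<bullet> p) - 2 * l\<^sup>2 * (p \<bullet> a) + l\<^sup>2 * ((l\<^sup>2 - 1) / m) * (a \<bullet> a)"
      using m by (simp add: field_simps power2_eq_square)
    also have "(l\<^sup>2 - 1) / m = 1" using m by (simp add: m_def)
    finally show ?thesis
      by (simp add: m_def inner_diff_left inner_diff_right inner_commute algebra_simps)
  qed
  ultimately have "l\<^sup>2 * ((p - a) \<bullet> (p - a)) \<le> p \<bullet> p" by linarith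
  then have "(l * norm (p - a))\<^sup>2 \<le> (norm p)\<^sup>2"
    by (simp add: power_mult_distrib power2_norm_eq_inner)
  then show ?thesis by (rule power2_le_imp_le) simp
qed

text \<open>
  The Apollonius balls of \<open>a\<close> and \<open>x\<close> with respect to \<open>b\<close> with ratio \<open>l\<close> meet as soon as
  \<open>l |a - x| \<le> |a - b| + |x - b|\<close>; the centre divides the segment between their centres.
\<close>

lemma annulus_center:
  fixes a b x :: "'a::euclidean_space"
  assumes ax: "a \<noteq> x" and le: "norm (a - x) \<le> norm (b - x)"
  obtains p where "(1 + norm (a - b) / norm (a - x)) * norm (p - a) \<le> norm (p - b)"
    "(1 + norm (a - b) / norm (a - x)) * norm (p - x) \<le> norm (p - b)"
proof (cases "a = b")
  case True
  then show ?thesis using that[of x] by (simp add: norm_minus_commute)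
next
  case False
  define a' x' where "a' = a - b" and "x' = x - b"
  define D Q A where "D = norm a'" and "Q = norm x'" and "A = norm (a' - x')"
  have pos: "0 < D" "0 < A" "A \<le> Q" "0 \<le> Q"
    using False ax le by (auto simp: D_def Q_def A_def a'_def x'_def norm_minus_commute)
  define l where "l = 1 + D / A"
  have l: "1 < l" using pos by (simp add: l_def)
  define m where "m = l\<^sup>2 - 1"
  have m: "0 < m" using l by (simp add: m_def one_less_power)
  \<comment> \<open>l A = A + D, so A \<le> Q is precisely what makes the two balls meet. This is
    why the roles of the two points of F may have to be exchanged later.\<close>
  have lA: "l * A \<le> D + Q" using pos by (simp add: l_def distrib_right)
  define p where "p = (l\<^sup>2 / m) *\<^sub>R ((Q / (D + Q)) *\<^sub>R a' + (D / (D + Q)) *\<^sub>R x')"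
  have DQ: "0 < D + Q" using pos by simp
  have QD: "Q / (D + Q) = 1 - D / (D + Q)" "D / (D + Q) = 1 - Q / (D + Q)"
    using DQ by (simp_all add: field_simps)
  have p1: "p - (l\<^sup>2 / m) *\<^sub>R a' = (l\<^sup>2 / m * (D / (D + Q))) *\<^sub>R (x' - a')"
    unfolding p_def QD(1) by (simp add: algebra_simps)
  have p2: "p - (l\<^sup>2 / m) *\<^sub>R x' = (l\<^sup>2 / m * (Q / (D + Q))) *\<^sub>R (a' - x')"
    unfolding p_def QD(2) by (simp add: algebra_simps)
  have key: "l\<^sup>2 / m * (z / (D + Q)) * A \<le> l / m * z" if "0 \<le> z" for z
  proof -
    have "l\<^sup>2 / m * (z / (D + Q)) * A = (l / m * z) * (l * A / (D + Q))"
      by (simp add: power2_eq_square)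
    also have "\<dots> \<le> (l / m * z) * 1"
      using lA DQ l m that by (intro mult_left_mono) auto
    finally show ?thesis by simp
  qed
  have "l * norm (p - a') \<le> norm p"
  proof (rule apollonius[OF l])
    have "norm (p - (l\<^sup>2 / m) *\<^sub>R a') = l\<^sup>2 / m * (D / (D + Q)) * A"
      unfolding p1 using pos m DQ by (simp add: A_def norm_minus_commute abs_mult)
    then show "norm (p - (l\<^sup>2 / (l\<^sup>2 - 1)) *\<^sub>R a') \<le> l / (l\<^sup>2 - 1) * norm a'"
      using key[of D] pos by (simp add: m_def D_def)
  qed
  moreover have "l * norm (p - x') \<le> norm p"
  proof (rule apollonius[OF l])
    have "norm (p - (l\<^sup>2 / m) *\<^sub>R x') = l\<^sup>2 / m * (Q / (D + Q)) * A"
      unfolding p2 using pos m DQ by (simp add: A_def[symmetric] abs_mult)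
    then show "norm (p - (l\<^sup>2 / (l\<^sup>2 - 1)) *\<^sub>R x') \<le> l / (l\<^sup>2 - 1) * norm x'"
      using key[of Q] pos by (simp add: m_def Q_def)
  qed
  moreover have "l = 1 + norm (a - b) / norm (a - x)"
    by (simp add: l_def D_def A_def a'_def x'_def)
  ultimately show ?thesis
    using that[of "p + b"] by (simp add: a'_def x'_def algebra_simps)
qed

section \<open>Rings\<close>

text \<open>
  The Moebius image of \<open>z\<close> under a transformation sending \<open>y\<close> to infinity, for \<open>z \<noteq> y\<close>.
  \<open>from_chart y\<close> inverts it at finite points.
\<close>

fun chart :: "'a::euclidean_space option \<Rightarrow> 'a option \<Rightarrow> 'a" where
  "chart None z = the z"
| "chart (Some q) None = q"
| "chart (Some q) (Some w) = inversion q w"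

fun from_chart :: "'a::euclidean_space option \<Rightarrow> 'a \<Rightarrow> 'a" where
  "from_chart None w = w"
| "from_chart (Some q) w = inversion q w"

text \<open>The conformal factor of \<open>from_chart\<close>: lengths are multiplied by it and
  volumes by its n-th power.\<close>

fun chart_scale :: "'a::euclidean_space option \<Rightarrow> 'a \<Rightarrow> real" where
  "chart_scale None w = 1"
| "chart_scale (Some q) w = 1 / (norm (w - q))\<^sup>2"

text \<open>For finite \<open>y\<close> the second assumption excludes z = \<infinity>, whose image
  is the centre of the inversion and cannot be carried back to a finite point.\<close>

lemma from_chart_chart:
  assumes "z \<noteq> y" "y \<noteq> Some (chart y z)"
  shows "Some (from_chart y (chart y z)) = z"
proof (cases y)
  case None
  then show ?thesis using assms by (cases z) auto
next
  case (Some q)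
  then show ?thesis using assms by (cases z) (auto simp: inversion_inversion)
qed

lemma measurable_from_chart [measurable]: "from_chart y \<in> borel_measurable borel"
proof (cases y)
  case None
  then have "from_chart y = (\<lambda>w. w)" by (simp add: fun_eq_iff)
  then show ?thesis by simp
next
  case (Some q)
  then have "from_chart y = inversion q" by (simp add: fun_eq_iff)
  then show ?thesis by simp
qed

lemma measurable_chart_scale [measurable]: "chart_scale y \<in> borel_measurable borel"
proof (cases y)
  case None
  then have "chart_scale y = (\<lambda>w. 1)" by (simp add: fun_eq_iff)
  then show ?thesis by simp
next
  case (Some q)
  then have "chart_scale y = (\<lambda>w. 1 / (norm (w - q))\<^sup>2)" by (simp add: fun_eq_iff)
  then show ?thesis by simp
qed

lemma nn_integral_from_chart:
  fixes \<sigma> :: "'a::euclidean_space \<Rightarrow> ennreal"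
  assumes "\<sigma> \<in> borel_measurable borel"
  shows "(\<integral>\<^sup>+w. (\<sigma> (from_chart y w) * ennreal (chart_scale y w)) ^ DIM('a) \<partial>lborel) = (\<integral>\<^sup>+x. \<sigma> x ^ DIM('a) \<partial>lborel)"
  by (cases y) (auto simp: nn_integral_inversion[OF assms])

lemma from_chart_has_vector_derivative:
  assumes "(\<gamma> has_vector_derivative d) (at t)" "y \<noteq> Some (\<gamma> t)"
  shows "\<exists>D. ((\<lambda>t. from_chart y (\<gamma> t)) has_vector_derivative D) (at t) \<and> norm D = norm d * chart_scale y (\<gamma> t)"
  using assms inversion_has_vector_derivative[OF assms(1)] by (cases y) auto

lemma continuous_on_from_chart:
  assumes "continuous_on S \<gamma>" "\<And>t. t \<in> S \<Longrightarrow> y \<noteq> Some (\<gamma> t)"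
  shows "continuous_on S (\<lambda>t. from_chart y (\<gamma> t))" "continuous_on S (\<lambda>t. chart_scale y (\<gamma> t))"
  using assms by (cases y; auto simp: inversion_def intro!: continuous_intros)+

lemma chart_scale_pos: "y \<noteq> Some w \<Longrightarrow> 0 < chart_scale y w"
  by (cases y) auto

section \<open>Charts and the cross-ratio\<close>

lemma chordal_commute: "chordal z w = chordal w z"
  by (cases z; cases w) (auto simp: norm_minus_commute mult.commute)

lemma chordal_pos: "z \<noteq> w \<Longrightarrow> 0 < chordal z w"
  by (cases z; cases w) (auto intro!: divide_pos_pos mult_pos_pos simp: add_pos_nonneg)

text \<open>The weights sqrt(1 + |z|^2) in the chordal metric cancel, except those of
  \<open>y\<close>, which make up the constant \<open>K\<close>. As the cross-ratio is a quotient of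
  two such distances, the value of \<open>K\<close> is irrelevant.\<close>

lemma norm_chart_diff:
  obtains K where "0 < K"
    "\<And>z w. z \<noteq> y \<Longrightarrow> w \<noteq> y \<Longrightarrow> norm (chart y z - chart y w) = K * (chordal z w / (chordal z y * chordal w y))"
proof (cases y)
  case None
  have pos: "0 < 1 + (norm x)\<^sup>2" for x :: 'a by (simp add: add_pos_nonneg)
  show ?thesis
    by (rule that[of 1]) (use None pos in \<open>auto simp: less_imp_neq[symmetric]\<close>)
next
  case (Some q)
  define s where "s x = sqrt (1 + (norm x)\<^sup>2)" for x :: 'a
  have s: "0 < s x" for x by (simp add: s_def add_pos_nonneg)
  have ch: "chordal (Some u) (Some v) = norm (u - v) / (s u * s v)" "chordal (Some u) None = 1 / s u"
    "chordal None (Some u) = 1 / s u" for u v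
    by (simp_all add: s_def)
  show ?thesis
  proof (rule that[of "1 / (s q)\<^sup>2"])
    fix z w assume zw: "z \<noteq> y" "w \<noteq> y"
    have ff: "norm (inversion q u - inversion q v) = 1 / (s q)\<^sup>2 * (chordal (Some u) (Some v) / (chordal (Some u) y * chordal (Some v) y))"
      if "u \<noteq> q" "v \<noteq> q" for u v
      using that s[of u] s[of v] s[of q]
      by (simp add: Some norm_inversion_inversion ch field_simps power2_eq_square del: chordal.simps)
    have fi: "norm (inversion q u - q) = 1 / (s q)\<^sup>2 * (chordal (Some u) None / (chordal (Some u) y * chordal None y))"
      if "u \<noteq> q" for u
      using that s[of u] s[of q]
      by (simp add: Some norm_inversion_diff ch field_simps power2_eq_square del: chordal.simps)
    show "norm (chart y z - chart y w) = 1 / (s q)\<^sup>2 * (chordal z w / (chordal z y * chordal w y))"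
    proof (cases z; cases w)
      fix v assume "z = None" "w = Some v"
      then show ?thesis using fi[of v] zw
        by (simp add: Some norm_minus_commute chordal_commute mult.commute)
    qed (use zw ff fi in \<open>auto simp: Some simp del: chordal.simps(1-3)\<close>)
  qed (use s[of q] in auto)
qed

lemma cross_ratio_chart:
  assumes "a \<noteq> y" "b \<noteq> y" "x \<noteq> y" "a \<noteq> x"
  shows "cross_ratio a x b y = norm (chart y a - chart y b) / norm (chart y a - chart y x)"
    and "chart y a \<noteq> chart y x"
proof -
  obtain K where K: "0 < K"
    "\<And>z w. z \<noteq> y \<Longrightarrow> w \<noteq> y \<Longrightarrow> norm (chart y z - chart y w) = K * (chordal z w / (chordal z y * chordal w y))"
    using norm_chart_diff[of y] by blast
  have p: "0 < chordal a y" "0 < chordal b y" "0 < chordal x y" "0 < chordal a x"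
    using assms by (simp_all add: chordal_pos)
  show "cross_ratio a x b y = norm (chart y a - chart y b) / norm (chart y a - chart y x)"
    using K(1) p assms by (simp add: K(2) cross_ratio_def field_simps)
  have "0 < norm (chart y a - chart y x)"
    using K(1) p assms by (simp add: K(2))
  then show "chart y a \<noteq> chart y x" by auto
qed

section \<open>Chart spheres separate the extended space\<close>

lemma openin_ext_top:
  fixes V :: "(real ^ 'n::finite) set"
  assumes "open V" "t \<Longrightarrow> bounded (- V)"
  shows "openin ext_top (Some ` V \<union> (if t then {None} else {}))"
proof (cases t)
  case True
  have "compact (- V)" using assms True by (simp add: compact_eq_bounded_closed closed_Compl)
  moreover have "Some ` V \<union> {None} = topspace ext_top - Some ` (- V)"
    by auto
  ultimately show ?thesis
    using True unfolding openin_Alexandroff_compactification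
    by (auto simp: compact_imp_closed intro!: exI[of _ "- V"])
qed (use assms in simp)

text \<open>The negative quadratic term dominates far out. It supplies the boundedness needed for a
  set containing infinity to be open.\<close>

lemma bounded_quadratic_superlevel:
  fixes b q :: "'a::euclidean_space"
  assumes "l < 0"
  shows "bounded {w. 0 \<le> l * (norm (w - q))\<^sup>2 + b \<bullet> (w - q) + m}"
proof (rule bounded_subset[OF bounded_cball])
  show "{w. 0 \<le> l * (norm (w - q))\<^sup>2 + b \<bullet> (w - q) + m} \<subseteq> cball q (1 + (norm b + \<bar>m\<bar>) / (- l))"
  proof
    fix w assume "w \<in> {w. 0 \<le> l * (norm (w - q))\<^sup>2 + b \<bullet> (w - q) + m}"
    then have w: "0 \<le> l * (norm (w - q))\<^sup>2 + b \<bullet> (w - q) + m" by simp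
    define s where "s = norm (w - q)"
    have cs: "b \<bullet> (w - q) \<le> norm b * s" unfolding s_def by (rule norm_cauchy_schwarz)
    have "s \<le> 1 + (norm b + \<bar>m\<bar>) / (- l)"
    proof (cases "s \<le> 1")
      case True
      moreover have "0 \<le> (norm b + \<bar>m\<bar>) / (- l)" using assms by (intro divide_nonneg_pos) auto
      ultimately show ?thesis by linarith
    next
      case False
      have "(- l) * s\<^sup>2 \<le> norm b * s + \<bar>m\<bar>" using w cs by (simp add: s_def[symmetric])
      also have "\<dots> \<le> norm b * s + \<bar>m\<bar> * s" using False mult_left_mono[of 1 s "\<bar>m\<bar>"] by simp
      finally have "((- l) * s) * s \<le> (norm b + \<bar>m\<bar>) * s" by (simp add: power2_eq_square algebra_simps)
      then have "(- l) * s \<le> norm b + \<bar>m\<bar>"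
        by (rule mult_right_le_imp_le) (use False in simp)
      then have "s \<le> (norm b + \<bar>m\<bar>) / (- l)" using assms by (simp add: field_simps)
      then show ?thesis by simp
    qed
    then show "w \<in> cball q (1 + (norm b + \<bar>m\<bar>) / (- l))"
      by (simp add: s_def dist_norm norm_minus_commute)
  qed
qed

text \<open>
  Clearing denominators turns the inverted sphere into the zero set of a quadratic polynomial with
  leading coefficient \<open>|q - c|\<^sup>2 - r\<^sup>2\<close>, whose sign decides on which side infinity lies.
\<close>

lemma openin_chart_ball:
  fixes y :: "('n::finite) ext_space"
  assumes r: "0 < r"
  shows "openin ext_top {z. z \<noteq> y \<and> norm (chart y z - c) < r}" (is ?inside)
    and "openin ext_top {z. z = y \<or> r < norm (chart y z - c)}" (is ?outside)
proof -
  have "?inside \<and> ?outside"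
  proof (cases y)
    case None
    have "{z. z \<noteq> y \<and> norm (chart y z - c) < r} = Some ` {w. norm (w - c) < r} \<union> (if False then {None} else {})"
    proof (intro set_eqI)
      fix z show "z \<in> {z. z \<noteq> y \<and> norm (chart y z - c) < r} \<longleftrightarrow>
          z \<in> Some ` {w. norm (w - c) < r} \<union> (if False then {None} else {})"
        by (cases z) (auto simp: None)
    qed
    moreover have "open {w. norm (w - c) < r}"
      by (intro open_Collect_less continuous_intros)
    ultimately have 1: ?inside using openin_ext_top[of "{w. norm (w - c) < r}" False] by simp
    have "{z. z = y \<or> r < norm (chart y z - c)} = Some ` {w. r < norm (w - c)} \<union> (if True then {None} else {})"
    proof (intro set_eqI)
      fix z show "z \<in> {z. z = y \<or> r < norm (chart y z - c)} \<longleftrightarrow>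
          z \<in> Some ` {w. r < norm (w - c)} \<union> (if True then {None} else {})"
        by (cases z) (auto simp: None)
    qed
    moreover have "open {w. r < norm (w - c)}"
      by (intro open_Collect_less continuous_intros)
    moreover have "bounded (- {w. r < norm (w - c)})"
      by (rule bounded_subset[OF bounded_cball[of c r]]) (auto simp: dist_norm norm_minus_commute)
    ultimately have 2: ?outside using openin_ext_top[of "{w. r < norm (w - c)}" True] by simp
    from 1 2 show ?thesis ..
  next
    case (Some q)
    define l b where "l = (norm (q - c))\<^sup>2 - r\<^sup>2" and "b = 2 *\<^sub>R (q - c)"
    have bx: "b \<bullet> x = 2 * ((q - c) \<bullet> x)" for x by (simp only: b_def inner_scaleR_left)
    define P where "P w = l * (norm (w - q))\<^sup>2 + b \<bullet> (w - q) + 1" for w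
    have P: "(norm (w - q))\<^sup>2 * ((norm (inversion q w - c))\<^sup>2 - r\<^sup>2) = P w" if "w \<noteq> q" for w
    proof -
      define x where "x = w - q"
      have x: "x \<bullet> x \<noteq> 0" using that by (simp add: x_def)
      have "inversion q w - c = (q - c) + x /\<^sub>R (x \<bullet> x)"
        by (simp add: inversion_def x_def power2_norm_eq_inner)
      then have "(norm (inversion q w - c))\<^sup>2 = (norm (q - c))\<^sup>2 + 2 * ((q - c) \<bullet> x) / (x \<bullet> x) + 1 / (x \<bullet> x)"
        using x by (simp only: power2_norm_eq_inner inner_add_left inner_add_right)
          (simp add: inner_commute divide_inverse)
      then show ?thesis
        using x by (simp add: P_def l_def bx x_def[symmetric] power2_norm_eq_inner[of x] field_simps)
    qed
    have sq: "norm v < r \<longleftrightarrow> (norm v)\<^sup>2 - r\<^sup>2 < 0" "r < norm v \<longleftrightarrow> 0 < (norm v)\<^sup>2 - r\<^sup>2" for v :: "real ^ 'n"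
      using r power_strict_mono[of "norm v" r 2] power_strict_mono[of r "norm v" 2]
        power_mono[of r "norm v" 2] power_mono[of "norm v" r 2] by (auto simp: not_less[symmetric])
    have P_lt: "norm (inversion q w - c) < r \<longleftrightarrow> P w < 0" "r < norm (inversion q w - c) \<longleftrightarrow> 0 < P w" if "w \<noteq> q" for w
      unfolding sq P[OF that, symmetric] using that by (auto simp: mult_less_0_iff zero_less_mult_iff)
    \<comment> \<open>The polynomial also classifies the centre of the inversion correctly: being
      positive there, it puts \<open>y\<close> outside every chart sphere, as befits the point sent
      to infinity.\<close>
    have Pq: "P q = 1" by (simp add: P_def)
    have cont: "continuous_on UNIV P" unfolding P_def by (intro continuous_intros)
    have "{z. z \<noteq> y \<and> norm (chart y z - c) < r} = Some ` {w. P w < 0} \<union> (if l < 0 then {None} else {})"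
    proof (intro set_eqI)
      fix z show "z \<in> {z. z \<noteq> y \<and> norm (chart y z - c) < r} \<longleftrightarrow> z \<in> Some ` {w. P w < 0} \<union> (if l < 0 then {None} else {})"
      proof (cases z)
        case (Some w)
        then show ?thesis using P_lt(1)[of w] Pq by (cases "w = q") (auto simp: \<open>y = Some q\<close> image_iff)
      qed (use sq(1)[of "q - c"] in \<open>auto simp: \<open>y = Some q\<close> l_def\<close>)
    qed
    moreover have "open {w. P w < 0}"
      using cont by (intro open_Collect_less continuous_on_const) auto
    moreover have "bounded (- {w. P w < 0})" if "l < 0"
      using bounded_quadratic_superlevel[OF that, of q b 1] by (simp add: P_def Compl_eq not_less)
    ultimately have 1: ?inside using openin_ext_top[of "{w. P w < 0}" "l < 0"] by simp
    have "{z. z = y \<or> r < norm (chart y z - c)} = Some ` {w. 0 < P w} \<union> (if 0 < l then {None} else {})"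
    proof (intro set_eqI)
      fix z show "z \<in> {z. z = y \<or> r < norm (chart y z - c)} \<longleftrightarrow> z \<in> Some ` {w. 0 < P w} \<union> (if 0 < l then {None} else {})"
      proof (cases z)
        case (Some w)
        then show ?thesis using P_lt(2)[of w] Pq by (cases "w = q") (auto simp: \<open>y = Some q\<close> image_iff)
      qed (use sq(2)[of "q - c"] in \<open>auto simp: \<open>y = Some q\<close> l_def\<close>)
    qed
    moreover have "open {w. 0 < P w}"
      using cont by (intro open_Collect_less continuous_on_const) auto
    moreover have "bounded (- {w. 0 < P w})" if "0 < l"
    proof -
      have "- {w. 0 < P w} = {w. 0 \<le> (- l) * (norm (w - q))\<^sup>2 + (- b) \<bullet> (w - q) + - 1}"
        by (auto simp: P_def not_less)
      then show ?thesis using bounded_quadratic_superlevel[of "- l" q "- b" "- 1"] that by simp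
    qed
    ultimately have 2: ?outside using openin_ext_top[of "{w. 0 < P w}" "0 < l"] by simp
    from 1 2 show ?thesis ..
  qed
  then show ?inside ?outside by auto
qed

lemma connectedin_meets_chart_sphere:
  fixes y :: "('n::finite) ext_space"
  assumes conn: "connectedin ext_top S" and r: "0 < r"
    and z1: "z1 \<in> S" "z1 \<noteq> y" "norm (chart y z1 - c) < r"
    and z2: "z2 \<in> S" "z2 = y \<or> r < norm (chart y z2 - c)"
  shows "\<exists>z\<in>S. z \<noteq> y \<and> norm (chart y z - c) = r"
proof (rule ccontr)
  define U1 U2 where "U1 = {z. z \<noteq> y \<and> norm (chart y z - c) < r}"
    and "U2 = {z. z = y \<or> r < norm (chart y z - c)}"
  assume "\<not> ?thesis"
  then have "S \<subseteq> U1 \<union> U2" by (auto simp: U1_def U2_def neq_iff)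
  moreover have "U1 \<inter> U2 \<inter> S = {}" "U1 \<inter> S \<noteq> {}" "U2 \<inter> S \<noteq> {}"
    using z1 z2 by (auto simp: U1_def U2_def)
  moreover have "openin ext_top U1" "openin ext_top U2"
    unfolding U1_def U2_def by (rule openin_chart_ball[OF r])+
  ultimately show False
    using conn unfolding connectedin by meson
qed

section \<open>Admissible densities in a chart and the capacity bound\<close>

text \<open>A curve on a chart sphere is carried back to the original space, where \<sigma> can be
  tested against it; the chain rule multiplies its speed by \<open>chart_scale\<close>. Because the
  sphere avoids the image of infinity, the curve stays finite and its speed continuous, so it is
  rectifiable.\<close>

lemma admissible_on_sphere:
  fixes \<sigma> :: "real ^ 'n::finite \<Rightarrow> ennreal"
  assumes \<sigma>: "\<sigma> \<in> admissible (joining_curves E F)" and \<gamma>: "sphere_curve c r e f \<gamma> k"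
    and ends: "Some (from_chart y e) \<in> E" "Some (from_chart y f) \<in> F"
    and avoid: "\<And>w. w \<in> sphere c r \<Longrightarrow> y \<noteq> Some w"
  shows "1 \<le> (\<integral>\<^sup>+t. (\<sigma> (from_chart y (\<gamma> t)) * ennreal (chart_scale y (\<gamma> t))) * ennreal k * indicator {0<..<1} t \<partial>lborel)"
proof -
  define \<beta> where "\<beta> t = from_chart y (\<gamma> t)" for t
  define v where "v t = k * chart_scale y (\<gamma> t)" for t
  have on: "y \<noteq> Some (\<gamma> t)" if "t \<in> {0..1}" for t
    using \<gamma> avoid[of "\<gamma> t"] that unfolding sphere_curve_def by blast
  have k: "0 < k" and cont: "continuous_on {0..1} \<gamma>" using \<gamma> by (auto simp: sphere_curve_def)
  interpret C: piecewise_smooth_curve \<beta> v "{1 / 2}"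
  proof
    show "continuous_on {0..1} \<beta>"
      unfolding \<beta>_def by (rule continuous_on_from_chart[OF cont on])
    show "continuous_on {0..1} v"
      unfolding v_def by (intro continuous_intros continuous_on_from_chart[OF cont on])
    show "0 < v t" if "t \<in> {0..1}" for t
      unfolding v_def using k chart_scale_pos[OF on[OF that]] by simp
    fix t :: real assume t: "t \<in> {0<..<1} - {1 / 2}"
    then obtain d where d: "(\<gamma> has_vector_derivative d) (at t)" "norm d = k"
      using \<gamma> unfolding sphere_curve_def by blast
    show "\<exists>d. (\<beta> has_vector_derivative d) (at t) \<and> norm d = v t"
      using from_chart_has_vector_derivative[OF d(1) on[of t]] t d(2) unfolding \<beta>_def v_def by auto
  qed simp
  define \<Gamma> where "\<Gamma> = (\<lambda>t. Some (\<beta> t))"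
  have the: "the \<circ> \<Gamma> = \<beta>" by (simp add: \<Gamma>_def fun_eq_iff)
  have "continuous_map (top_of_set {0..1}) euclidean \<beta>"
    using C.cont_curve by (simp add: continuous_map_iff_continuous)
  from continuous_map_compose[OF this continuous_map_Some] have "pathin ext_top \<Gamma>"
    by (simp add: pathin_def \<Gamma>_def o_def)
  then have "\<Gamma> \<in> joining_curves E F"
    using ends \<gamma> by (simp add: joining_curves_def \<Gamma>_def \<beta>_def sphere_curve_def)
  moreover have "locally_rectifiable \<Gamma>"
    unfolding locally_rectifiable_def rectifiable_on_def the using C.curve_length_finite
    by (auto simp: \<Gamma>_def)
  moreover have "\<sigma> \<in> borel_measurable borel" using \<sigma> by (simp add: admissible_def)
  ultimately have "1 \<le> line_integral \<sigma> \<beta>"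
    using \<sigma> unfolding admissible_def the[symmetric] by blast
  also have "\<dots> = (\<integral>\<^sup>+t. \<sigma> (\<beta> t) * ennreal (v t) * indicator {0<..<1} t \<partial>lborel)"
    by (rule C.line_integral_eq) fact
  also have "\<dots> = (\<integral>\<^sup>+t. (\<sigma> (from_chart y (\<gamma> t)) * ennreal (chart_scale y (\<gamma> t))) * ennreal k * indicator {0<..<1} t \<partial>lborel)"
    using k by (intro nn_integral_cong) (simp add: \<beta>_def v_def ennreal_mult' mult_ac)
  finally show ?thesis .
qed

lemma admissible_annulus_bound:
  fixes \<sigma> :: "real ^ 'n::finite \<Rightarrow> ennreal" and E F :: "'n ext_space set"
  assumes dim: "2 \<le> CARD('n)" and \<sigma>: "\<sigma> \<in> admissible (joining_curves E F)"
    and E: "connectedin ext_top E" "x \<in> E" "y \<in> E" and F: "connectedin ext_top F" "a \<in> F" "b \<in> F"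
    and disj: "E \<inter> F = {}" and xy: "x \<noteq> y"
    and far: "l * norm (p - chart y a) \<le> norm (p - chart y b)" "l * norm (p - chart y x) \<le> norm (p - chart y b)"
    and l: "1 \<le> l"
  shows "ennreal (ring_const CARD('n) * ln l) \<le> (\<integral>\<^sup>+x. \<sigma> x ^ CARD('n) \<partial>lborel)"
proof (cases rule: ring_const_cases[OF dim])
  case 1
  then show ?thesis by simp
next
  case (2 I)
  have \<sigma>m [measurable]: "\<sigma> \<in> borel_measurable borel" using \<sigma> by (simp add: admissible_def)
  have ne: "a \<noteq> y" "b \<noteq> y" "a \<noteq> x" using E F disj by auto
  \<comment> \<open>Every sphere with radius strictly between has x and a inside, b outside, and y
    outside as the point at infinity; so it separates points of E as well as points of F.\<close>
  define r0 r1 where "r0 = max (norm (chart y a - p)) (norm (chart y x - p))" and "r1 = norm (chart y b - p)"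
  have "chart y a \<noteq> chart y x" using cross_ratio_chart(2)[of a y b x] ne xy by simp
  then have r0: "0 < r0"
    by (metis less_max_iff_disj r0_def right_minus_eq zero_less_norm_iff)
  have r1: "l * r0 \<le> r1"
    using far by (simp add: r0_def r1_def max_def norm_minus_commute)
  have "1 * r0 \<le> l * r0" using l r0 by (intro mult_right_mono) auto
  then have r01: "r0 \<le> r1" using r1 by simp
  \<comment> \<open>The radius of the sphere through \<open>q\<close>, the chart image of infinity
    when \<open>y\<close> is finite. If \<open>y\<close> is infinity itself no sphere is bad, and 0
    is a dummy value.\<close>
  define \<rho> where "\<rho> = (case y of None \<Rightarrow> 0 | Some q \<Rightarrow> norm (q - p))"
  define \<tau> where "\<tau> w = \<sigma> (from_chart y w) * ennreal (chart_scale y w)" for w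
  have [measurable]: "\<tau> \<in> borel_measurable borel" unfolding \<tau>_def by measurable
  have "ennreal (unit_sphere_area (DIM(real ^ 'n) - 2) / I ^ (DIM(real ^ 'n) - 1) * ln (r1 / r0)) \<le> (\<integral>\<^sup>+x. \<tau> x ^ DIM(real ^ 'n) \<partial>lborel)"
  proof (rule shell_lower_bound[where c = p and \<rho> = \<rho>])
    fix r assume r: "r \<in> {r0<..<r1} - {\<rho>}"
    then have rpos: "0 < r" using r0 by auto
    have avoid: "y \<noteq> Some w" if "w \<in> sphere p r" for w
      using that r by (auto simp: \<rho>_def dist_norm norm_minus_commute)
    obtain z1 where z1: "z1 \<in> E" "z1 \<noteq> y" "norm (chart y z1 - p) = r"
      using connectedin_meets_chart_sphere[OF E(1) rpos, of x y p y] E xy r by (auto simp: r0_def)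
    obtain z2 where z2: "z2 \<in> F" "z2 \<noteq> y" "norm (chart y z2 - p) = r"
      using connectedin_meets_chart_sphere[OF F(1) rpos, of a y p b] F ne r by (auto simp: r0_def r1_def)
    have s: "chart y z1 \<in> sphere p r" "chart y z2 \<in> sphere p r"
      using z1 z2 by (auto simp: dist_norm norm_minus_commute)
    have recover: "Some (from_chart y (chart y z1)) = z1" "Some (from_chart y (chart y z2)) = z2"
      by (rule from_chart_chart[OF z1(2) avoid[OF s(1)]], rule from_chart_chart[OF z2(2) avoid[OF s(2)]])
    have "chart y z1 \<noteq> chart y z2"
    proof
      assume "chart y z1 = chart y z2"
      then have "z1 = z2" using recover by metis
      then show False using z1(1) z2(1) disj by blast
    qed
    moreover have "1 \<le> (\<integral>\<^sup>+t. \<tau> (\<gamma> t) * ennreal k * indicator {0<..<1} t \<partial>lborel)"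
      if "sphere_curve p r (chart y z1) (chart y z2) \<gamma> k" for \<gamma> k
      unfolding \<tau>_def by (rule admissible_on_sphere[OF \<sigma> that]) (use recover z1 z2 avoid in auto)
    ultimately show "\<exists>e\<in>sphere p r. \<exists>f\<in>sphere p r. e \<noteq> f \<and>
       (\<forall>\<gamma> k. sphere_curve p r e f \<gamma> k \<longrightarrow> 1 \<le> (\<integral>\<^sup>+t. \<tau> (\<gamma> t) * ennreal k * indicator {0<..<1} t \<partial>lborel))"
      using s by blast
  qed (use dim r0 r01 2 in auto)
  also have "(\<integral>\<^sup>+x. \<tau> x ^ DIM(real ^ 'n) \<partial>lborel) = (\<integral>\<^sup>+x. \<sigma> x ^ DIM(real ^ 'n) \<partial>lborel)"
    unfolding \<tau>_def by (rule nn_integral_from_chart) measurable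
  finally have bound: "ennreal (ring_const CARD('n) * ln (r1 / r0)) \<le> (\<integral>\<^sup>+x. \<sigma> x ^ CARD('n) \<partial>lborel)"
    using 2(3) by simp
  have "l \<le> r1 / r0" using r1 r0 by (simp add: pos_le_divide_eq)
  then have "ln l \<le> ln (r1 / r0)" using l by (intro ln_mono) auto
  moreover have "0 \<le> ring_const CARD('n)" using 2 by (simp add: unit_sphere_area_def)
  ultimately have "ennreal (ring_const CARD('n) * ln l) \<le> ennreal (ring_const CARD('n) * ln (r1 / r0))"
    by (intro ennreal_leI mult_left_mono)
  then show ?thesis using bound by (rule order_trans)
qed

lemma ring_const_nonneg: "0 \<le> ring_const n"
  by (simp add: ring_const_def unit_sphere_area_def)

lemma admissible_cross_ratio_bound:
  fixes \<sigma> :: "real ^ 'n::finite \<Rightarrow> ennreal" and E F :: "'n ext_space set"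
  assumes dim: "2 \<le> CARD('n)" and \<sigma>: "\<sigma> \<in> admissible (joining_curves E F)"
    and E: "connectedin ext_top E" "x \<in> E" "y \<in> E" and F: "connectedin ext_top F" "a \<in> F" "b \<in> F"
    and disj: "E \<inter> F = {}"
  shows "ennreal (ring_const CARD('n) * ln (1 + cross_ratio a x b y)) \<le> (\<integral>\<^sup>+x. \<sigma> x ^ CARD('n) \<partial>lborel)"
proof (cases "x = y")
  case True
  then have "cross_ratio a x b y = 0"
    by (cases y) (auto simp: cross_ratio_def)
  then show ?thesis by simp
next
  case False
  have ne: "a \<noteq> y" "b \<noteq> y" "a \<noteq> x" "b \<noteq> x" using E F disj by auto
  define A D Q where "A = norm (chart y a - chart y x)" and "D = norm (chart y a - chart y b)"
    and "Q = norm (chart y b - chart y x)"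
  have cr: "cross_ratio a x b y = D / A"
    unfolding A_def D_def using cross_ratio_chart(1)[of a y b x] ne False by simp
  have neq: "chart y a \<noteq> chart y x" "chart y b \<noteq> chart y x"
    using cross_ratio_chart(2) ne False by blast+
  then have pos: "0 < A" "0 < Q" "0 \<le> D" by (auto simp: A_def Q_def D_def)
  note bound = admissible_annulus_bound[OF dim \<sigma> E F(1) _ _ disj False]
  show ?thesis
  proof (cases "A \<le> Q")
    case True
    then obtain p where "(1 + D / A) * norm (p - chart y a) \<le> norm (p - chart y b)"
      "(1 + D / A) * norm (p - chart y x) \<le> norm (p - chart y b)"
      using annulus_center[OF neq(1), of "chart y b"] unfolding A_def D_def Q_def by blast
    then show ?thesis
      unfolding cr using pos by (intro bound[OF F(2,3)]) auto
  next
    case False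
    \<comment> \<open>With a and b exchanged the ratio becomes D / Q. Now Q < A, so the bound
      obtained is at least the one wanted.\<close>
    have D: "D = norm (chart y b - chart y a)" by (simp add: D_def norm_minus_commute)
    obtain p where "(1 + D / Q) * norm (p - chart y b) \<le> norm (p - chart y a)"
      "(1 + D / Q) * norm (p - chart y x) \<le> norm (p - chart y a)"
      using annulus_center[OF neq(2), of "chart y a"] False unfolding A_def D Q_def by (metis linear)
    then have "ennreal (ring_const CARD('n) * ln (1 + D / Q)) \<le> (\<integral>\<^sup>+x. \<sigma> x ^ CARD('n) \<partial>lborel)"
      using pos by (intro bound[OF F(3,2)]) auto
    moreover have "ln (1 + D / A) \<le> ln (1 + D / Q)"
      using pos False by (intro ln_mono add_left_mono divide_left_mono) (auto intro: add_pos_nonneg)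
    then have "ennreal (ring_const CARD('n) * ln (1 + D / A)) \<le> ennreal (ring_const CARD('n) * ln (1 + D / Q))"
      by (intro ennreal_leI mult_left_mono ring_const_nonneg)
    ultimately show ?thesis unfolding cr by (meson order_trans)
  qed
qed

theorem lemma5p7:
  fixes R E F :: "('n::finite) ext_space set"
  assumes "CARD('n) \<ge> 2"
    and "is_ring R E F"
  shows "ring_capacity E F \<ge> ennreal (1 / 2 * ring_const CARD('n)) * moebius_diam E F"
proof -
  let ?C = "subtopology ext_top (- R)"
  have top: "topspace (ext_top :: 'n ext_space topology) = UNIV"
    by (auto simp: notin_range_Some)
  have R: "openin ext_top R" and comp: "connected_components_of ?C = {E, F}" and "E \<noteq> F"
    using assms(2) by (auto simp: is_ring_def)
  have comps: "E \<in> connected_components_of ?C" "F \<in> connected_components_of ?C"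
    using comp by auto
  have conn: "connectedin ext_top E" "connectedin ext_top F"
    using comps connectedin_connected_components_of[of _ ?C] by (auto simp: connectedin_subtopology)
  have disj: "E \<inter> F = {}"
    using connected_components_of_disjoint[OF comps] \<open>E \<noteq> F\<close> by (simp add: disjnt_def)
  \<comment> \<open>The metric takes its points a, b from the boundary of the complement of F, while
    the estimates need them in F. A component of the closed set \<open>- R\<close> is closed, so
    that boundary lies in F.\<close>
  have "closedin ext_top (- R)"
    using R top by (simp add: closedin_def Diff_Diff_Int Compl_eq_Diff_UNIV)
  moreover have "closedin ?C F" using comps by (intro closedin_connected_components_of)
  ultimately have "closedin ext_top F" by (meson closedin_closed_subtopology closedin_trans_full)
  moreover have "ext_top frontier_of (- F) = ext_top frontier_of F"
    using frontier_of_complement[of ext_top F] top by (simp add: Compl_eq_Diff_UNIV)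
  ultimately have frontier: "ext_top frontier_of (- F) \<subseteq> F"
    by (simp add: frontier_of_subset_closedin)
  show ?thesis
    unfolding ring_capacity_def modulus_def
  proof (rule INF_greatest)
    fix \<sigma> :: "real ^ 'n \<Rightarrow> ennreal" assume \<sigma>: "\<sigma> \<in> admissible (joining_curves E F)"
    have "ennreal (1 / 2 * ring_const CARD('n)) * ennreal (ln (1 + cross_ratio a x b y)) \<le> (\<integral>\<^sup>+x. \<sigma> x ^ CARD('n) \<partial>lborel)"
      if "x \<in> E" "y \<in> E" "a \<in> F" "b \<in> F" for x y a b
    proof -
      \<comment> \<open>Only here does the factor 1/2 enter, by weakening the sharper bound.\<close>
      have "ennreal (1 / 2 * ring_const CARD('n)) * ennreal (ln (1 + cross_ratio a x b y))
          \<le> ennreal (ring_const CARD('n)) * ennreal (ln (1 + cross_ratio a x b y))"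
        by (intro mult_right_mono ennreal_leI) (use ring_const_nonneg in auto)
      also have "\<dots> = ennreal (ring_const CARD('n) * ln (1 + cross_ratio a x b y))"
        by (simp add: ennreal_mult' ring_const_nonneg)
      also have "\<dots> \<le> (\<integral>\<^sup>+x. \<sigma> x ^ CARD('n) \<partial>lborel)"
        using that conn disj assms(1) \<sigma> by (intro admissible_cross_ratio_bound)
      finally show ?thesis .
    qed
    then show "ennreal (1 / 2 * ring_const CARD('n)) * moebius_diam E F \<le> (\<integral>\<^sup>+x. \<sigma> x ^ CARD('n) \<partial>lborel)"
      unfolding moebius_diam_def moebius_metric_def SUP_mult_left_ennreal
      using frontier by (intro SUP_least) blast
  qed
qed

end
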